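(* Assume that Assumption A or Assumption B (stated in the context) is satisfied. Let $U$ be the space $\mathcal{S}_\delta(\Omega)$ equipped with the energy norm $\|\cdot\|_U=\|\cdot\|_{\mathcal{S}_\delta(\Omega)}$, and let $V$ be the space $\mathcal{S}_\delta(\Omega)$ equipped with the optimal test norm $$\|v\|_{\mathrm{opt},V}=\sup_{u\in U,\,u\neq 0}\frac{|b(u,v)|}{\|u\|_U}.$$ Then for any $\epsilon>0$ the weak nonlocal convection-diffusion problem $$\text{find } u\in U \text{ such that } b(u,v)=(f_\delta,v)\quad\text{for all } v\in V$$ is well-posed. More precisely, for any $f_\delta\in V^*$ there exists a unique solution $u\in U$, and it satisfies $$\|u\|_U=\|f_\delta\|_{V^*},\qquad \|f_\delta\|_{V^*}:=\sup_{v\in V,\,v\ne 0}\frac{|(f_\delta,v)|}{\|v\|_{\mathrm{opt},V}}.$$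
   Context: Let $d\ge 1$ be an integer, $\Omega\subset\mathbb{R}^d$ an open bounded domain, $\delta>0$, $B_\delta(x)$ the Euclidean ball of radius $\delta$ centered at $x$, $\Omega_{\mathcal{I}_\delta}=\{x\in\mathbb{R}^d\setminus\Omega:\operatorname{dist}(x,\partial\Omega)<\delta\}$ and $\Omega_\delta=\Omega\cup\Omega_{\mathcal{I}_\delta}$. Kernels. $\gamma^{\mathrm{diff}}$ is a non-negative, non-increasing function on $[0,1]$ (extended by zero to $(1,\infty)$) with $\int_{B_1(0)}\gamma^{\mathrm{diff}}(|s|)|s|^2\,ds=d$; $\gamma^{\mathrm{diff}}_\delta(|s|)=\delta^{-(d+2)}\gamma^{\mathrm{diff}}(|s|/\delta)$. For each $x\in\mathbb{R}^d$ the influence region $\mathcal{H}_\delta(x)\subset B_\delta(x)$ is a sector of the ball with $|\mathcal{H}_\delta(x)|/|B_\delta(x)|=\eta$, where $\eta>0$ is independent of $x$. The convection kernel is the non-negative function $\gamma^{\mathrm{conv}}(|s|)=\frac{|s|}{\eta}\gamma^{\mathrm{diff}}(|s|)$ (so that $\int_{B_1(0)}\gamma^{\mathrm{conv}}(|s|)|s|\,ds=d/\eta$), and $\gamma^{\mathrm{conv}}_\delta(|s|)=\delta^{-(d+1)}\gamma^{\mathrm{conv}}(|s|/\delta)$. Nonlocal gradient: $\mathcal{G}_\delta u(x)=\int_{\mathcal{H}_\delta(x)}\frac{y-x}{|y-x|}\gamma^{\mathrm{conv}}_\delta(|y-x|)(u(y)-u(x))\,dy$. Energy space: $$\mathcal{S}_\delta(\Omega)=\Big\{u\in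 L^2(\Omega_\delta):\int_{\Omega_\delta}\int_{\Omega_\delta}\gamma^{\mathrm{diff}}_\delta(|y-x|)(u(y)-u(x))^2\,dy\,dx<\infty,\ u|_{\Omega_{\mathcal{I}_\delta}}=0\Big\},$$ with inner product $a(u,v)=\int_{\Omega_\delta}\int_{\Omega_\delta}\gamma^{\mathrm{diff}}_\delta(|y-x|)(u(y)-u(x))(v(y)-v(x))\,dy\,dx$ and energy norm $\|u\|_{\mathcal{S}_\delta(\Omega)}=a(u,u)^{1/2}$ (a norm, by the nonlocal Poincaré inequality, making $\mathcal{S}_\delta(\Omega)$ a Hilbert space). Bilinear form: for a vector field $\mathbf{b}\in L^\infty(\mathbb{R}^d;\mathbb{R}^d)$ and $\epsilon>0$, $b(u,v)=\epsilon\,a(u,v)+(\mathbf{b}\cdot\mathcal{G}_\delta u,v)$ for $u,v\in\mathcal{S}_\delta(\Omega)$, where $(\cdot,\cdot)$ is the $L^2(\Omega)$ inner product. For $f_\delta\in V^*$ (the dual of $V$), $(f_\delta,v)$ denotes the duality pairing. Assumption A. $\mathbf{b}(x)\equiv\mathbf{b}\in\mathbb{R}^d$ is constant and $\mathcal{H}_\delta(x)=B_\delta(x)$ for all $x$. Assumption B. $\mathbf{b}\in L^\infty(\mathbb{R}^d;\mathbb{R}^d)$ satisfies $-\mathcal{D}_\delta(\mathbf{b})\ge 0$, where $$\mathcal{D}_\delta(\mathbf{b})(x)=\int_{\mathbb{R}^d}\big(\mathbf{b}(x)1_{\mathcal{H}_\delta(x)}(y)+\mathbf{b}(y)1_{\mathcal{H}_\delta(y)}(x)\big)\cdot\frac{y-x}{|y-x|}\gamma^{\mathrm{conv}}_\delta(|y-x|)\,dy,$$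 and $\mathcal{H}_\delta(x)$ is the hemisphere $\mathcal{H}_\delta(x)=\{y\in B_\delta(x):-\mathbf{b}(x)\cdot(y-x)>0\}$. *)

theory Defs
  imports "HOL-Analysis.Analysis"
begin

text \<open>
  The Euclidean space R^d is a type \<open>'a :: euclidean_space\<close> with \<open>d = DIM('a)\<close>.
  Elements of Lebesgue spaces are represented by Borel functions \<open>'a \<Rightarrow> real\<close>;
  only their values on the extended domain matter, and two of them stand for the same element
  iff they agree almost everywhere there.
\<close>

definition interaction_domain :: "real \<Rightarrow> 'a::euclidean_space set \<Rightarrow> 'a set" where
  "interaction_domain \<delta> \<Omega> = {x. x \<notin> \<Omega> \<and> infdist x (frontier \<Omega>) < \<delta>}"

definition extended_domain :: "real \<Rightarrow> 'a::euclidean_space set \<Rightarrow> 'a set" where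
  "extended_domain \<delta> \<Omega> = \<Omega> \<union> interaction_domain \<delta> \<Omega>"

definition ae_eq_on :: "'a::euclidean_space set \<Rightarrow> ('a \<Rightarrow> real) \<Rightarrow> ('a \<Rightarrow> real) \<Rightarrow> bool" where
  "ae_eq_on A u v \<longleftrightarrow> (AE x in lborel. x \<in> A \<longrightarrow> u x = v x)"


text \<open>
  The profile \<open>\<gamma>\<close> is the unscaled diffusion kernel. The scaled kernels are written
  as functions of the vector \<open>s = y - x\<close>, so that the dimension can be read off its type.
\<close>

definition diff_kernel :: "(real \<Rightarrow> real) \<Rightarrow> real \<Rightarrow> 'a::euclidean_space \<Rightarrow> real" where
  "diff_kernel \<gamma> \<delta> s = \<gamma> (norm s / \<delta>) / \<delta> ^ (DIM('a) + 2)"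

definition conv_profile :: "(real \<Rightarrow> real) \<Rightarrow> real \<Rightarrow> real \<Rightarrow> real" where
  "conv_profile \<gamma> \<eta> r = r / \<eta> * \<gamma> r"

definition conv_kernel :: "(real \<Rightarrow> real) \<Rightarrow> real \<Rightarrow> real \<Rightarrow> 'a::euclidean_space \<Rightarrow> real" where
  "conv_kernel \<gamma> \<eta> \<delta> s = conv_profile \<gamma> \<eta> (norm s / \<delta>) / \<delta> ^ (DIM('a) + 1)"


text \<open>A sector is the part of the ball lying in a Borel cone with apex at the centre; the cone
  need not contain its apex, as for the open hemisphere.\<close>

definition ball_sector :: "'a::euclidean_space \<Rightarrow> real \<Rightarrow> 'a set \<Rightarrow> bool" where
  "ball_sector x \<delta> S \<longleftrightarrow>
     (\<exists>K\<in>sets borel. (\<forall>v\<in>K. \<forall>t>0. t *\<^sub>R v \<in> K) \<and> S = {y \<in> ball x \<delta>. y - x \<in> K})"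

definition influence_region :: "real \<Rightarrow> real \<Rightarrow> ('a::euclidean_space \<Rightarrow> 'a set) \<Rightarrow> bool" where
  "influence_region \<delta> \<eta> H \<longleftrightarrow>
     (\<forall>x. ball_sector x \<delta> (H x) \<and> measure lborel (H x) / measure lborel (ball x \<delta>) = \<eta>)"

definition L_infinity_field :: "('a::euclidean_space \<Rightarrow> 'a) \<Rightarrow> bool" where
  "L_infinity_field b \<longleftrightarrow> b \<in> borel_measurable lborel \<and> (\<exists>C. AE x in lborel. norm (b x) \<le> C)"


text \<open>The unit vector (y - x)/|y - x| is \<open>sgn (y - x)\<close>.\<close>

definition nonlocal_gradient ::
  "(real \<Rightarrow> real) \<Rightarrow> real \<Rightarrow> real \<Rightarrow> ('a::euclidean_space \<Rightarrow> 'a set) \<Rightarrow> ('a \<Rightarrow> real) \<Rightarrow> 'a \<Rightarrow> 'a" where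
  "nonlocal_gradient \<gamma> \<eta> \<delta> H u x =
     (LINT y:H x|lborel. (conv_kernel \<gamma> \<eta> \<delta> (y - x) * (u y - u x)) *\<^sub>R sgn (y - x))"

definition divergence_integrand ::
  "(real \<Rightarrow> real) \<Rightarrow> real \<Rightarrow> real \<Rightarrow> ('a::euclidean_space \<Rightarrow> 'a set) \<Rightarrow> ('a \<Rightarrow> 'a) \<Rightarrow> 'a \<Rightarrow> 'a \<Rightarrow> real" where
  "divergence_integrand \<gamma> \<eta> \<delta> H b x y =
     ((indicator (H x) y *\<^sub>R b x + indicator (H y) x *\<^sub>R b y) \<bullet> sgn (y - x))
       * conv_kernel \<gamma> \<eta> \<delta> (y - x)"

definition nonlocal_divergence ::
  "(real \<Rightarrow> real) \<Rightarrow> real \<Rightarrow> real \<Rightarrow> ('a::euclidean_space \<Rightarrow> 'a set) \<Rightarrow> ('a \<Rightarrow> 'a) \<Rightarrow> 'a \<Rightarrow> real" where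
  "nonlocal_divergence \<gamma> \<eta> \<delta> H b x = (LINT y|lborel. divergence_integrand \<gamma> \<eta> \<delta> H b x y)"


definition energy_space :: "(real \<Rightarrow> real) \<Rightarrow> real \<Rightarrow> 'a::euclidean_space set \<Rightarrow> ('a \<Rightarrow> real) set" where
  "energy_space \<gamma> \<delta> \<Omega> =
     {u. set_borel_measurable lborel (extended_domain \<delta> \<Omega>) u
       \<and> set_integrable lborel (extended_domain \<delta> \<Omega>) (\<lambda>x. (u x)\<^sup>2)
       \<and> (\<integral>\<^sup>+ x\<in>extended_domain \<delta> \<Omega>. (\<integral>\<^sup>+ y\<in>extended_domain \<delta> \<Omega>.
            ennreal (diff_kernel \<gamma> \<delta> (y - x) * (u y - u x)\<^sup>2) \<partial>lborel) \<partial>lborel) < \<infinity>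
       \<and> ae_eq_on (interaction_domain \<delta> \<Omega>) u (\<lambda>x. 0)}"

definition energy_inner ::
  "(real \<Rightarrow> real) \<Rightarrow> real \<Rightarrow> 'a::euclidean_space set \<Rightarrow> ('a \<Rightarrow> real) \<Rightarrow> ('a \<Rightarrow> real) \<Rightarrow> real" where
  "energy_inner \<gamma> \<delta> \<Omega> u v =
     (LINT x:extended_domain \<delta> \<Omega>|lborel. LINT y:extended_domain \<delta> \<Omega>|lborel.
        diff_kernel \<gamma> \<delta> (y - x) * (u y - u x) * (v y - v x))"

definition energy_norm :: "(real \<Rightarrow> real) \<Rightarrow> real \<Rightarrow> 'a::euclidean_space set \<Rightarrow> ('a \<Rightarrow> real) \<Rightarrow> real" where
  "energy_norm \<gamma> \<delta> \<Omega> u = sqrt (energy_inner \<gamma> \<delta> \<Omega> u u)"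

definition convdiff_form ::
  "(real \<Rightarrow> real) \<Rightarrow> real \<Rightarrow> real \<Rightarrow> ('a::euclidean_space \<Rightarrow> 'a set) \<Rightarrow> ('a \<Rightarrow> 'a) \<Rightarrow> real \<Rightarrow> 'a set
     \<Rightarrow> ('a \<Rightarrow> real) \<Rightarrow> ('a \<Rightarrow> real) \<Rightarrow> real" where
  "convdiff_form \<gamma> \<eta> \<delta> H b \<epsilon> \<Omega> u v =
     \<epsilon> * energy_inner \<gamma> \<delta> \<Omega> u v
       + (LINT x:\<Omega>|lborel. (b x \<bullet> nonlocal_gradient \<gamma> \<eta> \<delta> H u x) * v x)"

text \<open>The nonzero elements, in the almost everywhere sense.\<close>

definition nonzero_energy_space ::
  "(real \<Rightarrow> real) \<Rightarrow> real \<Rightarrow> 'a::euclidean_space set \<Rightarrow> ('a \<Rightarrow> real) set" where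
  "nonzero_energy_space \<gamma> \<delta> \<Omega> =
     {u \<in> energy_space \<gamma> \<delta> \<Omega>. \<not> ae_eq_on (extended_domain \<delta> \<Omega>) u (\<lambda>x. 0)}"

definition opt_norm ::
  "(real \<Rightarrow> real) \<Rightarrow> real \<Rightarrow> real \<Rightarrow> ('a::euclidean_space \<Rightarrow> 'a set) \<Rightarrow> ('a \<Rightarrow> 'a) \<Rightarrow> real \<Rightarrow> 'a set
     \<Rightarrow> ('a \<Rightarrow> real) \<Rightarrow> real" where
  "opt_norm \<gamma> \<eta> \<delta> H b \<epsilon> \<Omega> v =
     (SUP u\<in>nonzero_energy_space \<gamma> \<delta> \<Omega>.
        \<bar>convdiff_form \<gamma> \<eta> \<delta> H b \<epsilon> \<Omega> u v\<bar> / energy_norm \<gamma> \<delta> \<Omega> u)"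

text \<open>The dual of the test space. Boundedness forces a functional to vanish on functions that are
  zero almost everywhere, hence to depend only on the almost everywhere class of its argument.\<close>

definition opt_dual ::
  "(real \<Rightarrow> real) \<Rightarrow> real \<Rightarrow> real \<Rightarrow> ('a::euclidean_space \<Rightarrow> 'a set) \<Rightarrow> ('a \<Rightarrow> 'a) \<Rightarrow> real \<Rightarrow> 'a set
     \<Rightarrow> (('a \<Rightarrow> real) \<Rightarrow> real) set" where
  "opt_dual \<gamma> \<eta> \<delta> H b \<epsilon> \<Omega> =
     {f. (\<forall>v\<in>energy_space \<gamma> \<delta> \<Omega>. \<forall>w\<in>energy_space \<gamma> \<delta> \<Omega>. f (\<lambda>x. v x + w x) = f v + f w)
       \<and> (\<forall>c. \<forall>v\<in>energy_space \<gamma> \<delta> \<Omega>. f (\<lambda>x. c * v x) = c * f v)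
       \<and> (\<exists>C. \<forall>v\<in>energy_space \<gamma> \<delta> \<Omega>. \<bar>f v\<bar> \<le> C * opt_norm \<gamma> \<eta> \<delta> H b \<epsilon> \<Omega> v)}"

definition opt_dual_norm ::
  "(real \<Rightarrow> real) \<Rightarrow> real \<Rightarrow> real \<Rightarrow> ('a::euclidean_space \<Rightarrow> 'a set) \<Rightarrow> ('a \<Rightarrow> 'a) \<Rightarrow> real \<Rightarrow> 'a set
     \<Rightarrow> (('a \<Rightarrow> real) \<Rightarrow> real) \<Rightarrow> real" where
  "opt_dual_norm \<gamma> \<eta> \<delta> H b \<epsilon> \<Omega> f =
     (SUP v\<in>nonzero_energy_space \<gamma> \<delta> \<Omega>. \<bar>f v\<bar> / opt_norm \<gamma> \<eta> \<delta> H b \<epsilon> \<Omega> v)"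


definition assumption_A :: "real \<Rightarrow> ('a::euclidean_space \<Rightarrow> 'a set) \<Rightarrow> ('a \<Rightarrow> 'a) \<Rightarrow> bool" where
  "assumption_A \<delta> H b \<longleftrightarrow> (\<exists>c. \<forall>x. b x = c) \<and> (\<forall>x. H x = ball x \<delta>)"

text \<open>
  The integrability clause says that the integral defining the nonlocal divergence exists.
  It is needed because a non-convergent Bochner integral has the value 0 by convention; it holds
  for every bounded field as soon as the convection kernel is integrable, in particular if the
  profile of the diffusion kernel is bounded.
\<close>

definition assumption_B ::
  "(real \<Rightarrow> real) \<Rightarrow> real \<Rightarrow> real \<Rightarrow> ('a::euclidean_space \<Rightarrow> 'a set) \<Rightarrow> ('a \<Rightarrow> 'a) \<Rightarrow> bool" where
  "assumption_B \<gamma> \<eta> \<delta> H b \<longleftrightarrow>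
     (AE x in lborel. integrable lborel (divergence_integrand \<gamma> \<eta> \<delta> H b x))
     \<and> (AE x in lborel. - nonlocal_divergence \<gamma> \<eta> \<delta> H b x \<ge> 0)
     \<and> (\<forall>x. H x = {y \<in> ball x \<delta>. - (b x \<bullet> (y - x)) > 0})"

end

theory Submission imports Defs "HOL-Library.Function_Algebras"
begin

text \<open>
  A coercive bounded bilinear form \<open>B\<close> on a Hilbert space is an isomorphism onto the dual in either
  argument. The optimal test norm of \<open>v\<close> is the norm of \<open>B (\<cdot>) v\<close>, so the norm of \<open>u\<close> is attained in
  \<open>sup \<bar>B u v\<bar> / \<parallel>v\<parallel>\<close> at the \<open>v\<close> representing the functional \<open>a u\<close>; this is the isometry
  \<open>\<parallel>u\<parallel> = \<parallel>f\<parallel>\<close>.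

  Extending the functions by zero turns the energy into a double integral over the whole space, where
  translating along a fixed small step until one has left \<open>\<Omega>\<close> yields the nonlocal Poincare inequality,
  and Fatou's lemma yields completeness. The convection term is bounded by the second moment of the
  diffusion kernel. It vanishes on the diagonal under Assumption A because the kernel is odd. Under
  Assumption B it dominates half the nonlocal divergence tested with \<open>u\<^sup>2\<close>; for this the convection
  kernel has to be integrable, which is forced by the existence of the divergence integral.
\<close>

section \<open>Optimal test norms\<close>

text \<open>Only the second moment of the diffusion kernel is known to be finite. A profile like
  r^(-d-1) at the origin is allowed, and then the convection kernel is not integrable: the gradient
  exists only through the difference u(y) - u(x), and the kernel times w(x)^2 and the kernel times
  w(x) w(y) cannot be integrated separately. This shapes both positivity proofs. Under Assumption A
  the singularity can be cut out, because every symmetric truncation of an odd kernel is still odd.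
  Under Assumption B the sign of the divergence is known for the full kernel only, so integrability
  has to be recovered first. There it helps that a hemisphere of positive measure forces b to vanish
  nowhere, so the integrand of the divergence cannot be small for the trivial reason b = 0.

  Two further choices come from working with functions instead of classes: the energy is only a
  seminorm, and b, bounded merely almost everywhere, keeps its exact values because these define the
  hemispheres; a bounded representative is carried along beside it.\<close>

instantiation "fun" :: (type, real_vector) real_vector
begin

definition scaleR_fun_def: "c *\<^sub>R f = (\<lambda>x. c *\<^sub>R f x)"

instance
  by standard (auto simp: scaleR_fun_def fun_eq_iff algebra_simps)

end

lemma scaleR_fun_apply [simp]: "(c *\<^sub>R f) x = c *\<^sub>R f x"
  by (simp add: scaleR_fun_def)

text \<open>Functions that agree almost everywhere are not identified, so \<open>a\<close> is only
  positive semidefinite and nonzero null vectors exist. The carrier is a subspace of a vector space,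
  in the application the space of all functions; this is the purpose of the instance above.\<close>

locale semi_inner =
  fixes S :: "'v::real_vector set" and a :: "'v \<Rightarrow> 'v \<Rightarrow> real"
  assumes subspace_S: "subspace S"
    and add_left: "\<lbrakk>u \<in> S; v \<in> S; w \<in> S\<rbrakk> \<Longrightarrow> a (u + v) w = a u w + a v w"
    and scale_left: "\<lbrakk>u \<in> S; w \<in> S\<rbrakk> \<Longrightarrow> a (c *\<^sub>R u) w = c * a u w"
    and sym: "\<lbrakk>u \<in> S; v \<in> S\<rbrakk> \<Longrightarrow> a u v = a v u"
    and nonneg: "u \<in> S \<Longrightarrow> 0 \<le> a u u"
begin

definition nrm :: "'v \<Rightarrow> real" where "nrm u = sqrt (a u u)"

lemma mem_add [simp, intro]: "u \<in> S \<Longrightarrow> v \<in> S \<Longrightarrow> u + v \<in> S"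
  and mem_scale [simp, intro]: "u \<in> S \<Longrightarrow> c *\<^sub>R u \<in> S"
  and mem_diff [simp, intro]: "u \<in> S \<Longrightarrow> v \<in> S \<Longrightarrow> u - v \<in> S"
  and mem_zero [simp, intro]: "0 \<in> S"
  using subspace_S by (auto simp: subspace_def subspace_diff)

lemma add_right: "\<lbrakk>u \<in> S; v \<in> S; w \<in> S\<rbrakk> \<Longrightarrow> a w (u + v) = a w u + a w v"
  by (metis add_left sym mem_add)

lemma scale_right: "\<lbrakk>u \<in> S; w \<in> S\<rbrakk> \<Longrightarrow> a w (c *\<^sub>R u) = c * a w u"
  by (metis scale_left sym mem_scale)

lemma diff_left: "\<lbrakk>u \<in> S; v \<in> S; w \<in> S\<rbrakk> \<Longrightarrow> a (u - v) w = a u w - a v w"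
  using add_left[of u "(-1) *\<^sub>R v" w] scale_left[of v w "-1"] mem_scale[of v "-1"] by simp

lemma diff_right: "\<lbrakk>u \<in> S; v \<in> S; w \<in> S\<rbrakk> \<Longrightarrow> a w (u - v) = a w u - a w v"
  by (metis diff_left sym mem_diff)

lemmas expand = add_left add_right scale_left scale_right diff_left diff_right

lemma nrm_nonneg [simp]: "u \<in> S \<Longrightarrow> 0 \<le> nrm u"
  by (simp add: nrm_def nonneg)

lemma nrm_sq: "u \<in> S \<Longrightarrow> (nrm u)\<^sup>2 = a u u"
  by (simp add: nrm_def nonneg)

definition bilinear_on :: "('v \<Rightarrow> 'v \<Rightarrow> real) \<Rightarrow> bool" where
  "bilinear_on B \<longleftrightarrow>
     (\<forall>u\<in>S. \<forall>v\<in>S. \<forall>w\<in>S. B (u + v) w = B u w + B v w \<and> B w (u + v) = B w u + B w v)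
     \<and> (\<forall>c. \<forall>u\<in>S. \<forall>w\<in>S. B (c *\<^sub>R u) w = c * B u w \<and> B w (c *\<^sub>R u) = c * B w u)"

lemma bilinear_on_a: "bilinear_on a"
  by (auto simp: bilinear_on_def expand)

lemma bilinear_on_diff:
  assumes "bilinear_on B" "u \<in> S" "v \<in> S" "w \<in> S"
  shows "B (u - v) w = B u w - B v w" "B w (u - v) = B w u - B w v"
proof -
  have "u - v = u + (-1) *\<^sub>R v" by simp
  then show "B (u - v) w = B u w - B v w" "B w (u - v) = B w u - B w v"
    using assms unfolding bilinear_on_def by (simp_all only: mem_scale)
qed

text \<open>Replacing \<open>(u, v)\<close> by \<open>(t u, v / t)\<close> and optimizing over \<open>t\<close>.\<close>

lemma bilinear_bound:
  assumes B: "bilinear_on B" and bd: "\<And>u v. u \<in> S \<Longrightarrow> v \<in> S \<Longrightarrow> \<bar>B u v\<bar> \<le> C * (a u u + a v v)"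
    and u: "u \<in> S" and v: "v \<in> S"
  shows "\<bar>B u v\<bar> \<le> 2 * C * nrm u * nrm v"
proof -
  have scaled: "\<bar>B u v\<bar> \<le> C * (t\<^sup>2 * a u u + a v v / t\<^sup>2)" if "t > 0" for t
  proof -
    have "B (t *\<^sub>R u) ((1/t) *\<^sub>R v) = B u v"
      using B u v that unfolding bilinear_on_def by simp
    moreover have "a (t *\<^sub>R u) (t *\<^sub>R u) + a ((1/t) *\<^sub>R v) ((1/t) *\<^sub>R v) = t\<^sup>2 * a u u + a v v / t\<^sup>2"
      using u v by (simp add: expand power2_eq_square)
    ultimately show ?thesis
      using bd[of "t *\<^sub>R u" "(1/t) *\<^sub>R v"] u v by simp
  qed
  consider "a u u = 0" | "a v v = 0" | "a u u > 0" "a v v > 0"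
    using nonneg u v by (metis less_eq_real_def)
  then show ?thesis
  proof cases
    \<comment> \<open>The optimal scaling degenerates to infinity (in the next case to zero), so the
      scaled bound is passed to the limit.\<close>
    case 1
    have "((\<lambda>t. C * a v v / t\<^sup>2) \<longlongrightarrow> 0) at_top"
      by (intro tendsto_divide_0[OF tendsto_const] filterlim_at_top_imp_at_infinity
          filterlim_pow_at_top filterlim_ident) auto
    moreover have "eventually (\<lambda>t. \<bar>B u v\<bar> \<le> C * a v v / t\<^sup>2) at_top"
      using eventually_gt_at_top[of 0] by eventually_elim (use scaled 1 in auto)
    ultimately have "\<bar>B u v\<bar> \<le> 0"
      by (rule tendsto_lowerbound) simp
    then show ?thesis using 1 by (simp add: nrm_def)
  next
    case 2
    have "((\<lambda>t. C * a u u / t\<^sup>2) \<longlongrightarrow> 0) at_top"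
      by (intro tendsto_divide_0[OF tendsto_const] filterlim_at_top_imp_at_infinity
          filterlim_pow_at_top filterlim_ident) auto
    moreover have "eventually (\<lambda>t. \<bar>B u v\<bar> \<le> C * a u u / t\<^sup>2) at_top"
      using eventually_gt_at_top[of 0]
    proof eventually_elim
      case (elim t)
      then show ?case using scaled[of "1/t"] 2 by (simp add: power_one_over divide_simps)
    qed
    ultimately have "\<bar>B u v\<bar> \<le> 0"
      by (rule tendsto_lowerbound) simp
    then show ?thesis using 2 by (simp add: nrm_def)
  next
    case 3
    define p q where "p = nrm u" and "q = nrm v"
    have pq: "p > 0" "q > 0" "a u u = p\<^sup>2" "a v v = q\<^sup>2"
      using 3 u v by (auto simp: p_def q_def nrm_sq) (auto simp: nrm_def)
    have "(sqrt (q / p))\<^sup>2 = q / p" using pq by simp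
    then have "\<bar>B u v\<bar> \<le> C * (q / p * p\<^sup>2 + q\<^sup>2 / (q / p))"
      using scaled[of "sqrt (q / p)"] pq by simp
    also have "\<dots> = 2 * C * p * q" using pq by (simp add: power2_eq_square)
    finally show ?thesis by (simp add: p_def q_def)
  qed
qed

text \<open>Nonnegativity on u + v and u - v gives the additive bound with constant 1/2; the scaling
  argument turns it into a product, and null vectors need no separate treatment.\<close>

lemma Cauchy_Schwarz:
  assumes u: "u \<in> S" and v: "v \<in> S"
  shows "\<bar>a u v\<bar> \<le> nrm u * nrm v"
proof -
  have "\<bar>a u v\<bar> \<le> 1/2 * (a u u + a v v)" if "u \<in> S" "v \<in> S" for u v
    using nonneg[of "u + v"] nonneg[of "u - v"] sym[of u v] that
    by (simp add: expand abs_le_iff)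
  from bilinear_bound[OF bilinear_on_a this u v] show ?thesis by simp
qed

end

text \<open>Every Cauchy sequence has a subsequence with increments of seminorm at most
  \<open>(1/2)^n\<close>, so this is full completeness. The rapid form is the one in which almost
  everywhere convergence of the functions can be read off directly.\<close>

locale complete_semi_inner = semi_inner +
  assumes rapid_complete: "\<And>X. \<lbrakk>\<And>n. X n \<in> S; \<And>n. a (X (Suc n) - X n) (X (Suc n) - X n) \<le> (1/4)^n\<rbrakk>
      \<Longrightarrow> \<exists>x\<in>S. (\<lambda>n. a (X n - x) (X n - x)) \<longlonglongrightarrow> 0"
begin

text \<open>The representer minimizes the quadratic functional \<open>J\<close>; the parallelogram
  law makes a minimizing sequence Cauchy.\<close>

lemma riesz:
  assumes f_add: "\<And>u v. u \<in> S \<Longrightarrow> v \<in> S \<Longrightarrow> f (u + v) = f u + f v"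
    and f_scale: "\<And>c u. u \<in> S \<Longrightarrow> f (c *\<^sub>R u) = c * f u"
    and f_bound: "\<And>u. u \<in> S \<Longrightarrow> \<bar>f u\<bar> \<le> C * nrm u"
  shows "\<exists>u\<in>S. \<forall>v\<in>S. a u v = f v"
proof -
  define J where "J u = a u u - 2 * f u" for u
  have J_lower: "- (C\<^sup>2) \<le> J u" if "u \<in> S" for u
  proof -
    have "0 \<le> (nrm u - C)\<^sup>2" by simp
    then show ?thesis
      using f_bound[OF that] nrm_sq[OF that] by (simp add: J_def power2_diff abs_le_iff algebra_simps)
  qed
  define m where "m = Inf (J ` S)"
  have bdd: "bdd_below (J ` S)" using J_lower by (auto simp: bdd_below_def)
  have m_le: "m \<le> J u" if "u \<in> S" for u
    unfolding m_def using bdd that by (intro cInf_lower) auto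
  \<comment> \<open>The tolerance is chosen so that the parallelogram law, which multiplies it by 2
    at n and at n + 1, yields increments below \<open>(1/4)^n\<close>.\<close>
  have "\<exists>u\<in>S. J u < m + (1/4)^n / 4" for n
  proof -
    have "\<exists>y\<in>J ` S. y < m + (1/4)^n / 4"
      unfolding m_def by (rule cInf_lessD) (use mem_zero in auto)
    then show ?thesis by auto
  qed
  then obtain X where X: "\<And>n. X n \<in> S" "\<And>n. J (X n) < m + (1/4)^n / 4" by metis
  have "a (X (Suc n) - X n) (X (Suc n) - X n) \<le> (1/4)^n" for n
  proof -
    let ?x = "X (Suc n)" and ?y = "X n"
    have "J ((1/2) *\<^sub>R (?x + ?y)) = (1/2) * J ?x + (1/2) * J ?y - (1/4) * a (?x - ?y) (?x - ?y)"
      using X(1) by (simp add: J_def expand f_add f_scale sym[of ?y ?x] field_simps)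
    moreover have "m \<le> J ((1/2) *\<^sub>R (?x + ?y))" using X(1) by (intro m_le) auto
    ultimately have "a (?x - ?y) (?x - ?y) \<le> 2 * J ?x + 2 * J ?y - 4 * m" by simp
    also have "\<dots> \<le> (1/4)^Suc n / 2 + (1/4)^n / 2"
      using X(2)[of n] X(2)[of "Suc n"] by simp
    also have "\<dots> \<le> (1/4)^n" by simp
    finally show ?thesis .
  qed
  from rapid_complete[OF X(1) this] obtain x where x: "x \<in> S"
    and lim: "(\<lambda>n. a (X n - x) (X n - x)) \<longlonglongrightarrow> 0" by blast
  have lim_a: "(\<lambda>n. a (X n) v) \<longlonglongrightarrow> a x v" if v: "v \<in> S" for v
  proof -
    have "(\<lambda>n. nrm (X n - x) * nrm v) \<longlonglongrightarrow> sqrt 0 * nrm v"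
      unfolding nrm_def by (intro tendsto_intros lim)
    then have "(\<lambda>n. nrm (X n - x) * nrm v) \<longlonglongrightarrow> 0" by simp
    then have "(\<lambda>n. a (X n - x) v) \<longlonglongrightarrow> 0"
      by (rule Lim_null_comparison[OF always_eventually, rotated])
        (use Cauchy_Schwarz[OF mem_diff[OF X(1) x] v] in simp)
    then have "(\<lambda>n. a (X n) v - a x v) \<longlonglongrightarrow> 0"
      using X(1) x v by (simp add: diff_left)
    then show ?thesis by (rule LIM_zero_cancel)
  qed
  \<comment> \<open>The minimizing property in the direction v, passed to the limit along
    \<open>X\<close>. Only the values \<open>a (X n) v\<close> have to converge, not
    \<open>J (X n)\<close>.\<close>
  have ineq: "0 \<le> 2 * t * (a x v - f v) + t\<^sup>2 * a v v" if v: "v \<in> S" for v t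
  proof -
    have "- ((1/4)^n / 4) \<le> 2 * t * (a (X n) v - f v) + t\<^sup>2 * a v v" for n
    proof -
      have "J (X n + t *\<^sub>R v) = J (X n) + 2 * t * (a (X n) v - f v) + t\<^sup>2 * a v v"
        using X(1) v by (simp add: J_def expand f_add f_scale sym[of v "X n"] power2_eq_square algebra_simps)
      moreover have "m \<le> J (X n + t *\<^sub>R v)" using X(1) v by (intro m_le) auto
      ultimately show ?thesis using X(2)[of n] by simp
    qed
    moreover have "(\<lambda>n. - ((1/4::real)^n / 4)) \<longlonglongrightarrow> 0"
      by (rule tendsto_eq_intros refl LIMSEQ_power_zero | simp)+
    moreover have "(\<lambda>n. 2 * t * (a (X n) v - f v) + t\<^sup>2 * a v v) \<longlonglongrightarrow> 2 * t * (a x v - f v) + t\<^sup>2 * a v v"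
      by (intro tendsto_intros lim_a v)
    ultimately show ?thesis by (meson LIMSEQ_le)
  qed
  have "a x v = f v" if v: "v \<in> S" for v
  proof -
    define p where "p = a x v - f v"
    \<comment> \<open>Nearly the minimizer of the quadratic polynomial in t; the added 1 keeps the
      denominator positive when v is a null vector.\<close>
    define t where "t = - p / (a v v + 1)"
    have pos: "a v v + 1 > 0" using nonneg[OF v] by simp
    have "2 * t * p + t\<^sup>2 * a v v \<le> 2 * t * p + t\<^sup>2 * (a v v + 1)" by (simp add: algebra_simps)
    also have "\<dots> = - p\<^sup>2 / (a v v + 1)"
      using pos by (simp add: t_def power2_eq_square divide_simps)
    finally have "p\<^sup>2 / (a v v + 1) \<le> 0" using ineq[OF v, of t] by (simp add: p_def)
    then have "p\<^sup>2 \<le> 0" using pos by (simp add: divide_le_0_iff)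
    then show ?thesis by (simp add: p_def)
  qed
  then show ?thesis using x by blast
qed

text \<open>With \<open>A\<close> the adjoint of the operator of \<open>B\<close>, the form \<open>B (A z) v = a (A z) (A v)\<close> is again a
  complete inner product, so its Riesz representers \<open>z\<close> give solutions \<open>A z\<close>.\<close>

lemma lax_milgram:
  assumes B: "bilinear_on B"
    and bound: "\<And>u v. u \<in> S \<Longrightarrow> v \<in> S \<Longrightarrow> \<bar>B u v\<bar> \<le> M * nrm u * nrm v"
    and coercive: "\<And>u. u \<in> S \<Longrightarrow> \<epsilon> * a u u \<le> B u u" and "\<epsilon> > 0"
    and f_add: "\<And>u v. u \<in> S \<Longrightarrow> v \<in> S \<Longrightarrow> f (u + v) = f u + f v"
    and f_scale: "\<And>c u. u \<in> S \<Longrightarrow> f (c *\<^sub>R u) = c * f u"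
    and f_bound: "\<And>u. u \<in> S \<Longrightarrow> \<bar>f u\<bar> \<le> C * nrm u"
  shows "\<exists>u\<in>S. \<forall>v\<in>S. B u v = f v"
proof -
  have "\<exists>w\<in>S. \<forall>u\<in>S. a w u = B u v" if v: "v \<in> S" for v
    by (rule riesz[where C = "M * nrm v"]) (use B bound v in \<open>auto simp: bilinear_on_def mult_ac\<close>)
  then obtain A where A: "\<And>v. v \<in> S \<Longrightarrow> A v \<in> S" "\<And>u v. u \<in> S \<Longrightarrow> v \<in> S \<Longrightarrow> a (A v) u = B u v"
    by metis
  define s where "s z v = B (A z) v" for z v
  have s_eq: "s z v = a (A z) (A v)" if "z \<in> S" "v \<in> S" for z v
    using that A(1) A(2)[OF A(1)[OF that(1)] that(2)] by (simp add: s_def sym)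
  have lower: "\<epsilon>\<^sup>2 * a v v \<le> s v v" if v: "v \<in> S" for v
  proof (cases "nrm v = 0")
    case True
    then show ?thesis using nrm_sq[OF v] s_eq[OF v v] nonneg[OF A(1)[OF v]] by simp
  next
    case False
    then have pos: "nrm v > 0" using nrm_nonneg[OF v] by linarith
    have "\<epsilon> * (nrm v)\<^sup>2 \<le> a (A v) v" using coercive[OF v] A(2)[OF v v] nrm_sq[OF v] by simp
    also have "\<dots> \<le> nrm (A v) * nrm v" using Cauchy_Schwarz[OF A(1)[OF v] v] by simp
    finally have "\<epsilon> * nrm v \<le> nrm (A v)" using pos by (simp add: power2_eq_square)
    then have "(\<epsilon> * nrm v)\<^sup>2 \<le> (nrm (A v))\<^sup>2"
      using \<open>\<epsilon> > 0\<close> pos by (intro power_mono) auto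
    then show ?thesis using v A(1)[OF v] s_eq[OF v v] by (simp add: power_mult_distrib nrm_sq)
  qed
  \<comment> \<open>\<open>s v v\<close> is the square of \<open>nrm (A v)\<close>, so half of it
    reappears on the right and is absorbed, without a division by \<open>nrm (A v)\<close>.\<close>
  have upper: "s v v \<le> M\<^sup>2 * a v v" if v: "v \<in> S" for v
  proof -
    have "s v v \<le> M * nrm (A v) * nrm v" unfolding s_def using bound[OF A(1)[OF v] v] by simp
    also have "\<dots> \<le> ((nrm (A v))\<^sup>2 + M\<^sup>2 * (nrm v)\<^sup>2) / 2"
      using sum_squares_bound[of "nrm (A v)" "M * nrm v"] by (simp add: power_mult_distrib mult_ac)
    finally show ?thesis
      using v A(1)[OF v] s_eq[OF v v] by (simp add: nrm_sq)
  qed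
  have s_add: "s z (u + v) = s z u + s z v" if "z \<in> S" "u \<in> S" "v \<in> S" for z u v
    using B that A(1) unfolding bilinear_on_def s_def by blast
  have s_scale: "s z (c *\<^sub>R u) = c * s z u" if "z \<in> S" "u \<in> S" for z u c
    using B that A(1) unfolding bilinear_on_def s_def by blast
  have s_sym: "s z v = s v z" if "z \<in> S" "v \<in> S" for z v
    using that A(1) by (simp add: s_eq sym)
  interpret s: semi_inner S s
  proof
    show "subspace S" by (rule subspace_S)
    show "s (u + v) w = s u w + s v w" if "u \<in> S" "v \<in> S" "w \<in> S" for u v w
      using s_add[of w u v] that by (simp add: s_sym)
    show "s (c *\<^sub>R u) w = c * s u w" if "u \<in> S" "w \<in> S" for u w c
      using s_scale[of w u c] that by (simp add: s_sym)
    show "s u v = s v u" if "u \<in> S" "v \<in> S" for u v using that by (rule s_sym)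
    show "0 \<le> s u u" if "u \<in> S" for u using that A(1) by (simp add: s_eq nonneg)
  qed
  interpret s: complete_semi_inner S s
  proof
    fix X assume X: "\<And>n. X n \<in> S" "\<And>n. s (X (Suc n) - X n) (X (Suc n) - X n) \<le> (1/4)^n"
    \<comment> \<open>By \<open>lower\<close>, a is at most s divided by the square of \<epsilon>;
      scaling by \<epsilon> restores the normalization \<open>(1/4)^n\<close> that
      \<open>rapid_complete\<close> expects.\<close>
    define Y where "Y n = \<epsilon> *\<^sub>R X n" for n
    have "\<exists>y\<in>S. (\<lambda>n. a (Y n - y) (Y n - y)) \<longlonglongrightarrow> 0"
    proof (rule rapid_complete)
      show "Y n \<in> S" for n using X(1) by (simp add: Y_def)
      show "a (Y (Suc n) - Y n) (Y (Suc n) - Y n) \<le> (1/4)^n" for n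
      proof -
        have "Y (Suc n) - Y n = \<epsilon> *\<^sub>R (X (Suc n) - X n)" by (simp add: Y_def scaleR_diff_right)
        then have "a (Y (Suc n) - Y n) (Y (Suc n) - Y n) = \<epsilon>\<^sup>2 * a (X (Suc n) - X n) (X (Suc n) - X n)"
          using X(1) by (simp add: scale_left scale_right power2_eq_square)
        also have "\<dots> \<le> (1/4)^n"
          using lower[of "X (Suc n) - X n"] X by (meson mem_diff order_trans)
        finally show ?thesis .
      qed
    qed
    then obtain y where y: "y \<in> S" "(\<lambda>n. a (Y n - y) (Y n - y)) \<longlonglongrightarrow> 0" by blast
    define x where "x = (1/\<epsilon>) *\<^sub>R y"
    have x: "x \<in> S" using y by (simp add: x_def)
    have eq: "X n - x = (1/\<epsilon>) *\<^sub>R (Y n - y)" for n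
      using \<open>\<epsilon> > 0\<close> by (simp add: x_def Y_def scaleR_diff_right)
    have "a (X n - x) (X n - x) = (1/\<epsilon>)\<^sup>2 * a (Y n - y) (Y n - y)" for n
      unfolding eq using X(1) y by (simp add: Y_def scale_left scale_right power2_eq_square)
    then have "(\<lambda>n. M\<^sup>2 * a (X n - x) (X n - x)) \<longlonglongrightarrow> 0"
      using tendsto_mult_left[OF y(2), of "M\<^sup>2 * (1/\<epsilon>)\<^sup>2"] by (simp add: mult.assoc)
    then have "(\<lambda>n. s (X n - x) (X n - x)) \<longlonglongrightarrow> 0"
      by (rule Lim_null_comparison[OF always_eventually, rotated])
        (use upper[OF mem_diff[OF X(1) x]] s.nonneg[OF mem_diff[OF X(1) x]] in simp)
    then show "\<exists>x\<in>S. (\<lambda>n. s (X n - x) (X n - x)) \<longlonglongrightarrow> 0" using x by blast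
  qed
  have "\<exists>z\<in>S. \<forall>v\<in>S. s z v = f v"
  proof (rule s.riesz[OF f_add f_scale])
    fix v assume v: "v \<in> S"
    have "\<epsilon> * nrm v \<le> s.nrm v"
      unfolding nrm_def s.nrm_def using real_sqrt_le_mono[OF lower[OF v]] \<open>\<epsilon> > 0\<close>
      by (simp add: real_sqrt_mult)
    then have "nrm v \<le> s.nrm v / \<epsilon>" using \<open>\<epsilon> > 0\<close> by (simp add: field_simps)
    then have "\<bar>C\<bar> * nrm v \<le> \<bar>C\<bar> * (s.nrm v / \<epsilon>)" by (intro mult_left_mono) auto
    moreover have "C * nrm v \<le> \<bar>C\<bar> * nrm v" using v by (intro mult_right_mono) auto
    ultimately show "\<bar>f v\<bar> \<le> (\<bar>C\<bar> / \<epsilon>) * s.nrm v" using f_bound[OF v] by simp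
  qed
  then obtain z where "z \<in> S" "\<forall>v\<in>S. s z v = f v" by blast
  then show ?thesis using A(1) unfolding s_def by blast
qed

text \<open>The constants M and \<epsilon> do not enter the isometry: they give solvability for B
  and for its transpose, and make \<open>opt\<close> equivalent to \<open>nrm\<close>. Nonemptiness
  of N matters because the supremum of an empty set of reals is unspecified.\<close>

theorem optimal_test_norm:
  assumes B: "bilinear_on B"
    and bound: "\<And>u v. u \<in> S \<Longrightarrow> v \<in> S \<Longrightarrow> \<bar>B u v\<bar> \<le> M * nrm u * nrm v"
    and coercive: "\<And>u. u \<in> S \<Longrightarrow> \<epsilon> * a u u \<le> B u u" and "\<epsilon> > 0"
    and N_def: "N = {u \<in> S. nrm u \<noteq> 0}" and N_ne: "N \<noteq> {}"
    and opt_def: "\<And>v. opt v = (SUP u\<in>N. \<bar>B u v\<bar> / nrm u)"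
    and f_add: "\<And>u v. u \<in> S \<Longrightarrow> v \<in> S \<Longrightarrow> f (u + v) = f u + f v"
    and f_scale: "\<And>c u. u \<in> S \<Longrightarrow> f (c *\<^sub>R u) = c * f u"
    and f_bound: "\<And>u. u \<in> S \<Longrightarrow> \<bar>f u\<bar> \<le> C * opt u"
  shows "\<exists>u\<in>S. (\<forall>v\<in>S. B u v = f v) \<and> (\<forall>w\<in>S. (\<forall>v\<in>S. B w v = f v) \<longrightarrow> nrm (w - u) = 0)
           \<and> nrm u = (SUP v\<in>N. \<bar>f v\<bar> / opt v)"
proof -
  have N: "u \<in> S" "nrm u > 0" if "u \<in> N" for u
    using that nrm_nonneg[of u] unfolding N_def by (simp_all add: less_le)
  have quot: "\<bar>B u v\<bar> / nrm u \<le> M * nrm v" if "u \<in> N" "v \<in> S" for u v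
    using bound[of u v] N[OF that(1)] that(2) by (simp add: divide_le_eq mult_ac)
  have bdd: "bdd_above ((\<lambda>u. \<bar>B u v\<bar> / nrm u) ` N)" if "v \<in> S" for v
    using quot that by (auto simp: bdd_above_def)
  have opt_upper: "opt v \<le> M * nrm v" if "v \<in> S" for v
    unfolding opt_def using N_ne quot that by (intro cSUP_least) auto
  have opt_nonneg: "0 \<le> opt v" if v: "v \<in> S" for v
  proof -
    obtain u where u: "u \<in> N" using N_ne by blast
    have "0 \<le> \<bar>B u v\<bar> / nrm u" using N[OF u] by simp
    also have "\<dots> \<le> opt v" unfolding opt_def using u bdd[OF v] by (intro cSUP_upper) auto
    finally show ?thesis .
  qed
  have opt_bound: "\<bar>B u v\<bar> \<le> nrm u * opt v" if "u \<in> S" "v \<in> S" for u v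
  proof (cases "u \<in> N")
    case True
    have "\<bar>B u v\<bar> / nrm u \<le> opt v" unfolding opt_def using True bdd that by (intro cSUP_upper) auto
    then show ?thesis using N[OF True] by (simp add: divide_le_eq mult_ac)
  next
    case False
    then show ?thesis using bound[OF that] that by (simp add: N_def)
  qed
  \<comment> \<open>Coercivity, with v itself as competitor in the supremum. Without positivity the
    quotients by \<open>opt v\<close> would be 0 by the convention for division.\<close>
  have opt_pos: "opt v > 0" if v: "v \<in> N" for v
  proof -
    have "0 < \<epsilon> * a v v" using N[OF v] \<open>\<epsilon> > 0\<close> nrm_sq[of v] by (metis zero_less_mult_iff zero_less_power)
    also have "\<dots> \<le> nrm v * opt v" using coercive[of v] opt_bound[of v v] N[OF v] by force
    finally show ?thesis using N[OF v] by (simp add: zero_less_mult_iff)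
  qed
  have "\<exists>u\<in>S. \<forall>v\<in>S. B u v = f v"
  proof (rule lax_milgram[OF B bound coercive \<open>\<epsilon> > 0\<close> f_add f_scale])
    fix u assume u: "u \<in> S"
    have "C * opt u \<le> \<bar>C\<bar> * opt u" using opt_nonneg[OF u] by (intro mult_right_mono) auto
    also have "\<dots> \<le> \<bar>C\<bar> * (M * nrm u)" using opt_upper[OF u] by (intro mult_left_mono) auto
    finally show "\<bar>f u\<bar> \<le> (\<bar>C\<bar> * M) * nrm u" using f_bound[OF u] by simp
  qed
  then obtain u where u: "u \<in> S" "\<And>v. v \<in> S \<Longrightarrow> B u v = f v" by blast
  have unique: "nrm (w - u) = 0" if w: "w \<in> S" "\<forall>v\<in>S. B w v = f v" for w
  proof -
    have "B (w - u) (w - u) = B w (w - u) - B u (w - u)"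
      using bilinear_on_diff[OF B] w u by simp
    also have "\<dots> = 0" using w u by simp
    finally have "\<epsilon> * a (w - u) (w - u) \<le> 0" using coercive[of "w - u"] w u by simp
    then have "a (w - u) (w - u) \<le> 0" using \<open>\<epsilon> > 0\<close> by (simp add: mult_le_0_iff)
    then show ?thesis using nonneg[of "w - u"] w u by (simp add: nrm_def)
  qed
  have le: "\<bar>f v\<bar> / opt v \<le> nrm u" if "v \<in> N" for v
    using opt_bound[OF u(1), of v] u(2)[of v] opt_pos[OF that] N[OF that] by (simp add: divide_le_eq)
  have bddf: "bdd_above ((\<lambda>v. \<bar>f v\<bar> / opt v) ` N)" using le by (auto simp: bdd_above_def)
  have "nrm u = (SUP v\<in>N. \<bar>f v\<bar> / opt v)"
  proof (rule antisym)
    show "(SUP v\<in>N. \<bar>f v\<bar> / opt v) \<le> nrm u" using N_ne le by (intro cSUP_least) auto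
    show "nrm u \<le> (SUP v\<in>N. \<bar>f v\<bar> / opt v)"
    \<comment> \<open>For a null vector u the optimal test function is null as well and lies outside
      N; the supremum is still nonnegative because N is nonempty.\<close>
    proof (cases "nrm u = 0")
      case True
      obtain v where v: "v \<in> N" using N_ne by blast
      have "0 \<le> \<bar>f v\<bar> / opt v" using opt_pos[OF v] by simp
      also have "\<dots> \<le> (SUP v\<in>N. \<bar>f v\<bar> / opt v)" using v bddf by (intro cSUP_upper) auto
      finally show ?thesis using True by simp
    next
      case False
      then have pos: "nrm u > 0" using nrm_nonneg[OF u(1)] by linarith
      \<comment> \<open>The transposed form has the same bound and the same coercivity
        constant.\<close>
      have "\<exists>v\<in>S. \<forall>w\<in>S. B w v = a u w"
      proof (rule lax_milgram[where B = "\<lambda>v w. B w v" and M = M and \<epsilon> = \<epsilon> and C = "nrm u"])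
        show "bilinear_on (\<lambda>v w. B w v)" using B unfolding bilinear_on_def by blast
        show "\<bar>B w v\<bar> \<le> M * nrm v * nrm w" if "v \<in> S" "w \<in> S" for v w
          using bound[OF that(2,1)] by (simp add: mult_ac)
      qed (use coercive \<open>\<epsilon> > 0\<close> u(1) Cauchy_Schwarz in \<open>auto simp: expand\<close>)
      then obtain v where v: "v \<in> S" "\<And>w. w \<in> S \<Longrightarrow> B w v = a u w" by blast
      have fv: "f v = (nrm u)\<^sup>2" using u v by (simp add: nrm_sq u(2)[symmetric])
      have "nrm v \<noteq> 0" using bound[OF u(1) v(1)] u(2)[OF v(1)] fv pos by auto
      then have vN: "v \<in> N" using v by (simp add: N_def)
      have "opt v \<le> nrm u" unfolding opt_def
      proof (rule cSUP_least[OF N_ne])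
        fix w assume w: "w \<in> N"
        show "\<bar>B w v\<bar> / nrm w \<le> nrm u"
          using Cauchy_Schwarz[OF u(1) N(1)[OF w]] N[OF w] v by (simp add: divide_le_eq)
      qed
      then have "nrm u \<le> \<bar>f v\<bar> / opt v"
        using opt_pos[OF vN] pos by (simp add: fv le_divide_eq power2_eq_square)
      also have "\<dots> \<le> (SUP v\<in>N. \<bar>f v\<bar> / opt v)" using vN bddf by (intro cSUP_upper) auto
      finally show ?thesis .
    qed
  qed
  then show ?thesis using u unique by blast
qed

end

section \<open>Integrals over Euclidean space and the nonlocal Poincare inequality\<close>

lemma nn_integral_lborel_shift:
  fixes f :: "'a::euclidean_space \<Rightarrow> ennreal"
  assumes [measurable]: "f \<in> borel_measurable borel"
  shows "(\<integral>\<^sup>+x. f (c + x) \<partial>lborel) = (\<integral>\<^sup>+x. f x \<partial>lborel)"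
proof -
  have "(\<integral>\<^sup>+x. f x \<partial>lborel) = (\<integral>\<^sup>+x. f x \<partial>(distr lborel borel ((+) c)))"
    by (simp only: lborel_distr_plus)
  also have "\<dots> = (\<integral>\<^sup>+x. f (c + x) \<partial>lborel)"
    by (subst nn_integral_distr) auto
  finally show ?thesis by simp
qed

lemma nn_integral_lborel_scale:
  fixes f :: "'a::euclidean_space \<Rightarrow> ennreal"
  assumes [measurable]: "f \<in> borel_measurable borel" and c: "c \<noteq> 0"
  shows "(\<integral>\<^sup>+x. f x \<partial>lborel) = ennreal (\<bar>c\<bar> ^ DIM('a)) * (\<integral>\<^sup>+x. f (c *\<^sub>R x) \<partial>lborel)"
proof -
  have "(\<integral>\<^sup>+x. f x \<partial>lborel) = (\<integral>\<^sup>+x. f x \<partial>(density (distr lborel borel (\<lambda>x. 0 + c *\<^sub>R x)) (\<lambda>_. \<bar>c\<bar>^DIM('a))))"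
    by (simp only: lborel_affine[OF c, of 0, symmetric])
  also have "\<dots> = ennreal (\<bar>c\<bar> ^ DIM('a)) * (\<integral>\<^sup>+x. f (c *\<^sub>R x) \<partial>lborel)"
    by (subst nn_integral_density) (auto simp: nn_integral_distr nn_integral_cmult)
  finally show ?thesis .
qed

lemma nn_integral_lborel_uminus:
  fixes f :: "'a::euclidean_space \<Rightarrow> ennreal"
  assumes "f \<in> borel_measurable borel"
  shows "(\<integral>\<^sup>+x. f (- x) \<partial>lborel) = (\<integral>\<^sup>+x. f x \<partial>lborel)"
  using nn_integral_lborel_scale[OF assms, of "-1"] by simp

lemma distr_lborel_uminus: "distr lborel borel uminus = (lborel :: 'a::euclidean_space measure)"
  using lborel_affine[of "-1" "0::'a"] by (simp add: density_1 uminus_add_conv_diff[abs_def] cong: distr_cong)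

text \<open>Reflection at the origin preserves the measure and changes the sign. For a
  non-integrable \<open>g\<close> the value is 0 by convention.\<close>

lemma integral_lborel_odd:
  fixes g :: "'a::euclidean_space \<Rightarrow> real"
  assumes [measurable]: "g \<in> borel_measurable borel" and odd: "\<And>s. g (- s) = - g s"
  shows "(LINT s|lborel. g s) = 0"
proof -
  have "(LINT s|lborel. g s) = (LINT s|distr lborel borel uminus. g s)"
    by (simp add: distr_lborel_uminus)
  also have "\<dots> = (LINT s|lborel. g (- s))" by (subst integral_distr) auto
  also have "\<dots> = - (LINT s|lborel. g s)" by (simp add: odd)
  finally show ?thesis by simp
qed

lemma integrable_lborel_shift:
  fixes f :: "'a::euclidean_space \<Rightarrow> real"
  assumes [measurable]: "f \<in> borel_measurable borel"
  shows "integrable lborel (\<lambda>y. f (y - x)) \<longleftrightarrow> integrable lborel f"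
proof -
  have "integrable (distr lborel borel ((+) (-x))) f \<longleftrightarrow> integrable lborel (\<lambda>y. f (- x + y))"
    by (rule integrable_distr_eq) auto
  then show ?thesis by (simp add: lborel_distr_plus)
qed

lemma integral_lborel_shift:
  fixes f :: "'a::euclidean_space \<Rightarrow> real"
  assumes [measurable]: "f \<in> borel_measurable borel"
  shows "(LINT y|lborel. f (y - x)) = (LINT y|lborel. f y)"
proof -
  have "(LINT y|lborel. f y) = (LINT y|distr lborel borel ((+) (-x)). f y)"
    by (simp only: lborel_distr_plus)
  also have "\<dots> = (LINT y|lborel. f (- x + y))" by (subst integral_distr) auto
  finally show ?thesis by simp
qed

text \<open>The exceptional set need not be measurable, so it is covered by a Borel null set N,
  whose cylinder is null by Fubini.\<close>

lemma AE_lborel_fst: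
  assumes "AE x in lborel. P (x :: 'a::euclidean_space)"
  shows "AE p in lborel \<Otimes>\<^sub>M (lborel :: 'a measure). P (fst p)"
proof -
  obtain N where N: "{x. \<not> P x} \<subseteq> N" "N \<in> null_sets lborel"
    using assms by (auto simp: eventually_ae_filter)
  have [measurable]: "N \<in> sets borel" using N by auto
  have "AE p in lborel \<Otimes>\<^sub>M (lborel :: 'a measure). fst p \<notin> N"
  proof (rule lborel_pair.AE_pair_measure)
    show "AE x in lborel. AE y in lborel. fst (x, y) \<notin> N"
      using AE_not_in[OF N(2)] by eventually_elim simp
  qed measurable
  then show ?thesis by eventually_elim (use N in auto)
qed

lemma AE_lborel_snd:
  assumes "AE x in lborel. P (x :: 'a::euclidean_space)"
  shows "AE p in (lborel :: 'a measure) \<Otimes>\<^sub>M lborel. P (snd p)"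
proof -
  obtain N where N: "{x. \<not> P x} \<subseteq> N" "N \<in> null_sets lborel"
    using assms by (auto simp: eventually_ae_filter)
  have [measurable]: "N \<in> sets borel" using N by auto
  have "AE p in (lborel :: 'a measure) \<Otimes>\<^sub>M lborel. snd p \<notin> N"
  proof (rule lborel_pair.AE_pair_measure)
    show "AE x in lborel. AE y in lborel. snd (x, y) \<notin> N"
      by (simp add: AE_not_in[OF N(2)])
  qed measurable
  then show ?thesis by eventually_elim (use N in auto)
qed

text \<open>For fixed x the integral over y is translation invariant, so the double integral
  factorizes.\<close>

lemma integrable_convolution_fst:
  fixes g h :: "'a::euclidean_space \<Rightarrow> real"
  assumes g: "integrable lborel g" and h: "integrable lborel h"
  shows "integrable (lborel \<Otimes>\<^sub>M lborel) (\<lambda>(x, y). g (y - x) * h x)"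
    and "(LINT (x, y)|(lborel \<Otimes>\<^sub>M lborel). g (y - x) * h x) = (LINT s|lborel. g s) * (LINT x|lborel. h x)"
proof -
  have [measurable]: "g \<in> borel_measurable borel" "h \<in> borel_measurable borel"
    using g h by auto
  show *: "integrable (lborel \<Otimes>\<^sub>M lborel) (\<lambda>(x, y). g (y - x) * h x)"
  proof (rule lborel_pair.Fubini_integrable)
    have "(\<lambda>x. LINT y|lborel. norm (g (y - x) * h x)) = (\<lambda>x. (LINT s|lborel. \<bar>g s\<bar>) * \<bar>h x\<bar>)"
      using integral_lborel_shift[of "\<lambda>s. \<bar>g s\<bar>"] by (simp add: abs_mult)
    then show "integrable lborel (\<lambda>x. LINT y|lborel. norm (case (x, y) of (x, y) \<Rightarrow> g (y - x) * h x))"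
      using h by simp
    show "AE x in lborel. integrable lborel (\<lambda>y. case (x, y) of (x, y) \<Rightarrow> g (y - x) * h x)"
      using g by (simp add: integrable_lborel_shift)
  qed measurable
  show "(LINT (x, y)|(lborel \<Otimes>\<^sub>M lborel). g (y - x) * h x) = (LINT s|lborel. g s) * (LINT x|lborel. h x)"
    using lborel_pair.integral_fst'[OF *] by (simp add: integral_lborel_shift)
qed

lemma integrable_convolution_snd:
  fixes g h :: "'a::euclidean_space \<Rightarrow> real"
  assumes g: "integrable lborel g" and h: "integrable lborel h"
  shows "integrable (lborel \<Otimes>\<^sub>M lborel) (\<lambda>(x, y). g (y - x) * h y)"
proof -
  have [measurable]: "g \<in> borel_measurable borel" using g by auto
  have "integrable (distr lborel borel uminus) g" using g by (simp add: distr_lborel_uminus)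
  then have "integrable lborel (\<lambda>s. g (- s))" by (subst (asm) integrable_distr_eq) auto
  from lborel_pair.integrable_product_swap[OF integrable_convolution_fst(1)[OF this h]]
  show ?thesis by simp
qed

lemma double_integral_cong_AE:
  fixes F G :: "'a::euclidean_space \<times> 'a \<Rightarrow> real"
  assumes [measurable]: "F \<in> borel_measurable (lborel \<Otimes>\<^sub>M lborel)" "G \<in> borel_measurable (lborel \<Otimes>\<^sub>M lborel)"
    and eq: "AE x in lborel. AE y in lborel. F (x, y) = G (x, y)"
  shows "(LINT x|lborel. LINT y|lborel. F (x, y)) = (LINT x|lborel. LINT y|lborel. G (x, y))"
proof (rule integral_cong_AE)
  show "AE x in lborel. (LINT y|lborel. F (x, y)) = (LINT y|lborel. G (x, y))"
    using eq by eventually_elim (rule integral_cong_AE, auto)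
qed measurable

lemma (in semi_inner) nrm_triangle:
  assumes u: "u \<in> S" and v: "v \<in> S"
  shows "nrm (u + v) \<le> nrm u + nrm v"
proof (rule power2_le_imp_le)
  have "(nrm (u + v))\<^sup>2 = (nrm u)\<^sup>2 + 2 * a u v + (nrm v)\<^sup>2"
    using u v by (simp add: nrm_sq expand sym)
  also have "\<dots> \<le> (nrm u)\<^sup>2 + 2 * (nrm u * nrm v) + (nrm v)\<^sup>2"
    using Cauchy_Schwarz[OF u v] by simp
  finally show "(nrm (u + v))\<^sup>2 \<le> (nrm u + nrm v)\<^sup>2" by (simp add: power2_sum algebra_simps)
qed (use u v in auto)

lemma (in semi_inner) rapid_Cauchy:
  assumes X: "\<And>n. X n \<in> S" "\<And>n. a (X (Suc n) - X n) (X (Suc n) - X n) \<le> (1/4)^n"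
  shows "nrm (X m - X (m + k)) \<le> 2 * (1/2)^m"
proof -
  have step: "nrm (X n - X (Suc n)) \<le> (1/2)^n" for n
  proof (rule power2_le_imp_le)
    have "a (X n - X (Suc n)) (X n - X (Suc n)) = a (X (Suc n) - X n) (X (Suc n) - X n)"
      using X(1) by (simp add: expand)
    moreover have "((1/2::real)^n)\<^sup>2 = (1/4)^n"
      by (simp add: power2_eq_square power_mult_distrib[symmetric])
    ultimately show "(nrm (X n - X (Suc n)))\<^sup>2 \<le> ((1/2)^n)\<^sup>2"
      using X(1) X(2)[of n] by (simp add: nrm_sq)
  qed simp
  \<comment> \<open>The partial geometric sum in closed form is inductive; the bound
    \<open>2 * (1/2)^m\<close> alone is not.\<close>
  have "nrm (X m - X (m + k)) \<le> 2 * (1/2)^m - 2 * (1/2)^(m + k)"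
  proof (induction k)
    case 0
    then show ?case using scale_left[of 0 0 0] by (simp add: nrm_def)
  next
    case (Suc k)
    have "nrm (X m - X (m + Suc k)) \<le> nrm (X m - X (m + k)) + nrm (X (m + k) - X (Suc (m + k)))"
      using nrm_triangle[of "X m - X (m + k)" "X (m + k) - X (Suc (m + k))"] X(1) by simp
    also have "\<dots> \<le> 2 * (1/2)^m - 2 * (1/2)^(m + k) + (1/2)^(m + k)"
      using Suc step[of "m + k"] by simp
    finally show ?case by simp
  qed
  then show ?thesis by (smt (verit) zero_le_power zero_le_divide_1_iff)
qed

text \<open>The kernel may be singular at the origin as long as its second moment is finite.
  \<open>K_lower\<close> leaves out the origin because the profile is monotone on positive radii
  only.\<close>

locale nonlocal_kernel =
  fixes K :: "'a::euclidean_space \<Rightarrow> real" and \<Omega> :: "'a set"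
  assumes K_measurable [measurable]: "K \<in> borel_measurable borel"
    and K_nonneg: "0 \<le> K s"
    and K_even: "K (- s) = K s"
    and K_moment: "integrable lborel (\<lambda>s. K s * (norm s)\<^sup>2)"
    and K_lower: "\<exists>\<rho>>0. \<exists>c>0. \<forall>s. 0 < norm s \<and> norm s < \<rho> \<longrightarrow> c \<le> K s"
    and \<Omega>_open: "open \<Omega>" and \<Omega>_bounded: "bounded \<Omega>" and \<Omega>_ne: "\<Omega> \<noteq> {}"
begin

lemma \<Omega>_borel [measurable]: "\<Omega> \<in> sets borel"
  using \<Omega>_open by auto

text \<open>A single step s bounds the integral of w^2 by N^2 times that of (w(x + s) - w(x))^2.
  Averaging over a ball of steps on which K is at least \<open>c\<^sub>0\<close> recovers part of
  the energy, whence the constant \<open>N\<^sup>2 / (c\<^sub>0 * V)\<close>.\<close>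

lemma poincare_nn:
  "\<exists>C>0. \<forall>w\<in>borel_measurable borel. (\<forall>x. x \<notin> \<Omega> \<longrightarrow> w x = 0) \<longrightarrow>
     (\<integral>\<^sup>+x. ennreal ((w x)\<^sup>2) \<partial>lborel)
       \<le> ennreal C * (\<integral>\<^sup>+(x, y). ennreal (K (y - x) * (w y - w x)\<^sup>2) \<partial>(lborel \<Otimes>\<^sub>M lborel))"
proof -
  obtain \<rho> c\<^sub>0 where \<rho>_pos: "\<rho> > 0" and c\<^sub>0_pos: "c\<^sub>0 > 0"
    and K_ge: "\<And>s. 0 < norm s \<Longrightarrow> norm s < \<rho> \<Longrightarrow> c\<^sub>0 \<le> K s"
    using K_lower by metis
  obtain R where R: "R > 0" "\<And>x. x \<in> \<Omega> \<Longrightarrow> norm x \<le> R"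
    using \<Omega>_bounded by (auto simp: bounded_pos)
  \<comment> \<open>Each step is longer than \<rho>/4, so N of them exceed the diameter bound 2 R
    and leave \<Omega>.\<close>
  define N :: nat where "N = nat \<lceil>8 * R / \<rho>\<rceil> + 1"
  have N: "real N * \<rho> > 8 * R" "N > 0"
  proof -
    have "real N > 8 * R / \<rho>" unfolding N_def by linarith
    then show "real N * \<rho> > 8 * R" using \<rho>_pos by (simp add: field_simps)
  qed (simp add: N_def)
  obtain e :: 'a where e: "norm e = 1" using norm_Basis SOME_Basis by blast
  \<comment> \<open>A ball of steps away from the origin: they are long enough to leave \<Omega>
    after N steps and short enough for the lower bound on K.\<close>
  define A :: "'a set" where "A = ball ((\<rho>/2) *\<^sub>R e) (\<rho>/4)"
  have A: "\<rho>/4 < norm s" "norm s < \<rho>" if "s \<in> A" for s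
  proof -
    have "norm ((\<rho>/2) *\<^sub>R e) = \<rho>/2" using e \<rho>_pos by simp
    then show "\<rho>/4 < norm s" "norm s < \<rho>"
      using that norm_triangle_ineq2[of "(\<rho>/2) *\<^sub>R e" s] norm_triangle_ineq3[of "(\<rho>/2) *\<^sub>R e" s] \<rho>_pos
      by (auto simp: A_def dist_norm abs_le_iff)
  qed
  have A_meas [measurable]: "A \<in> sets borel" by (simp add: A_def)
  define V where "V = unit_ball_vol (real DIM('a)) * (\<rho>/4) ^ DIM('a)"
  have V: "emeasure lborel A = ennreal V" "V > 0"
    using \<rho>_pos by (auto simp: A_def V_def emeasure_ball)
  define C where "C = (real N)\<^sup>2 / (c\<^sub>0 * V)"
  have "C > 0" using N c\<^sub>0_pos V by (simp add: C_def)
  show ?thesis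
  proof (intro exI[of _ C] conjI ballI impI)
    fix w :: "'a \<Rightarrow> real" assume w_meas [measurable]: "w \<in> borel_measurable borel" and w0: "\<forall>x. x \<notin> \<Omega> \<longrightarrow> w x = 0"
    let ?I = "\<integral>\<^sup>+x. ennreal ((w x)\<^sup>2) \<partial>lborel"
    define Q where "Q s = (\<integral>\<^sup>+x. ennreal ((w (s + x) - w x)\<^sup>2) \<partial>lborel)" for s
    have Q_meas [measurable]: "Q \<in> borel_measurable borel" unfolding Q_def by measurable
    have Q: "?I \<le> ennreal ((real N)\<^sup>2) * Q s" if s: "s \<in> A" for s
    proof -
      \<comment> \<open>Telescoping along x, x + s, ..., x + N s, where w is 0 at the end, and
        Cauchy-Schwarz for the sum. The second factor N comes later, from N translates with equal
        integrals.\<close>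
      have pt: "(w x)\<^sup>2 \<le> real N * (\<Sum>i<N. (w (s + (real i *\<^sub>R s + x)) - w (real i *\<^sub>R s + x))\<^sup>2)" for x
      proof (cases "x \<in> \<Omega>")
        case True
        have "x + real N *\<^sub>R s \<notin> \<Omega>"
        proof
          assume "x + real N *\<^sub>R s \<in> \<Omega>"
          then have "norm (real N *\<^sub>R s) \<le> 2 * R"
            using R(2)[OF True] R(2)[of "x + real N *\<^sub>R s"] norm_triangle_ineq4[of "x + real N *\<^sub>R s" x] by simp
          moreover have "real N * (\<rho>/4) < real N * norm s" using A[OF s] N by simp
          ultimately show False using N R by simp
        qed
        then have end0: "w (x + real N *\<^sub>R s) = 0" using w0 by blast
        have "(\<Sum>i<N. w (s + (real i *\<^sub>R s + x)) - w (real i *\<^sub>R s + x))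
            = (\<Sum>i<N. w (x + real (Suc i) *\<^sub>R s) - w (x + real i *\<^sub>R s))"
          by (simp add: algebra_simps)
        also have "\<dots> = - w x"
          using sum_lessThan_telescope[of "\<lambda>i. w (x + real i *\<^sub>R s)" N] end0 by simp
        finally show ?thesis
          using sum_squared_le_sum_of_squares[of "\<lambda>i. w (s + (real i *\<^sub>R s + x)) - w (real i *\<^sub>R s + x)" "{..<N}"]
          by (simp add: mult.commute)
      qed (use w0 in \<open>simp add: sum_nonneg\<close>)
      have "?I \<le> (\<integral>\<^sup>+x. ennreal (real N) * (\<Sum>i<N. ennreal ((w (s + (real i *\<^sub>R s + x)) - w (real i *\<^sub>R s + x))\<^sup>2)) \<partial>lborel)"
        using pt by (intro nn_integral_mono) (simp add: ennreal_mult[symmetric] sum_nonneg)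
      also have "\<dots> = ennreal (real N) * (\<Sum>i<N. \<integral>\<^sup>+x. ennreal ((w (s + (real i *\<^sub>R s + x)) - w (real i *\<^sub>R s + x))\<^sup>2) \<partial>lborel)"
        by (subst nn_integral_cmult, measurable, subst nn_integral_sum) auto
      also have "\<dots> = ennreal (real N) * (\<Sum>i<N. Q s)"
        unfolding Q_def
        by (subst nn_integral_lborel_shift[where f = "\<lambda>x. ennreal ((w (s + x) - w x)\<^sup>2)"]) auto
      also have "\<dots> = ennreal ((real N)\<^sup>2) * Q s"
        by (simp add: power2_eq_square ennreal_mult mult.assoc ennreal_of_nat_eq_real_of_nat)
      finally show ?thesis .
    qed
    have KQ: "(\<integral>\<^sup>+s. ennreal (K s) * Q s \<partial>lborel)
       = (\<integral>\<^sup>+(x, y). ennreal (K (y - x) * (w y - w x)\<^sup>2) \<partial>(lborel \<Otimes>\<^sub>M lborel))"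
    proof -
      have "(\<integral>\<^sup>+s. ennreal (K s) * Q s \<partial>lborel)
          = (\<integral>\<^sup>+s. \<integral>\<^sup>+x. ennreal (K s * (w (s + x) - w x)\<^sup>2) \<partial>lborel \<partial>lborel)"
        unfolding Q_def by (simp add: nn_integral_cmult[symmetric] ennreal_mult K_nonneg)
      also have "\<dots> = (\<integral>\<^sup>+x. \<integral>\<^sup>+s. ennreal (K s * (w (s + x) - w x)\<^sup>2) \<partial>lborel \<partial>lborel)"
        by (rule lborel_pair.Fubini') measurable
      also have "\<dots> = (\<integral>\<^sup>+x. \<integral>\<^sup>+y. ennreal (K (y - x) * (w y - w x)\<^sup>2) \<partial>lborel \<partial>lborel)"
      proof (rule nn_integral_cong)
        fix x
        show "(\<integral>\<^sup>+s. ennreal (K s * (w (s + x) - w x)\<^sup>2) \<partial>lborel) = (\<integral>\<^sup>+y. ennreal (K (y - x) * (w y - w x)\<^sup>2) \<partial>lborel)"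
          using nn_integral_lborel_shift[of "\<lambda>y. ennreal (K (y - x) * (w y - w x)\<^sup>2)" x] by (simp add: add.commute)
      qed
      also have "\<dots> = (\<integral>\<^sup>+(x, y). ennreal (K (y - x) * (w y - w x)\<^sup>2) \<partial>(lborel \<Otimes>\<^sub>M lborel))"
        by (subst lborel.nn_integral_fst[symmetric]) auto
      finally show ?thesis .
    qed
    have "ennreal V * ?I = (\<integral>\<^sup>+s. indicator A s * ?I \<partial>lborel)"
      using V by (simp add: nn_integral_multc)
    also have "\<dots> \<le> (\<integral>\<^sup>+s. ennreal ((real N)\<^sup>2 / c\<^sub>0) * (ennreal (K s) * Q s) \<partial>lborel)"
    proof (rule nn_integral_mono)
      fix s
      show "indicator A s * ?I \<le> ennreal ((real N)\<^sup>2 / c\<^sub>0) * (ennreal (K s) * Q s)"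
      proof (cases "s \<in> A")
        case True
        have "(real N)\<^sup>2 \<le> (real N)\<^sup>2 / c\<^sub>0 * K s"
          using K_ge[of s] A[OF True] c\<^sub>0_pos N \<rho>_pos by (cases "s = 0") (auto simp: field_simps)
        then have "ennreal ((real N)\<^sup>2) \<le> ennreal ((real N)\<^sup>2 / c\<^sub>0) * ennreal (K s)"
          using c\<^sub>0_pos K_nonneg by (simp add: ennreal_mult[symmetric])
        then have "ennreal ((real N)\<^sup>2) * Q s \<le> ennreal ((real N)\<^sup>2 / c\<^sub>0) * ennreal (K s) * Q s"
          by (rule mult_right_mono) simp
        then show ?thesis using Q[OF True] True by (simp add: mult.assoc)
      qed simp
    qed
    also have "\<dots> = ennreal ((real N)\<^sup>2 / c\<^sub>0) * (\<integral>\<^sup>+s. ennreal (K s) * Q s \<partial>lborel)"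
      by (rule nn_integral_cmult) measurable
    finally have "ennreal (1 / V) * (ennreal V * ?I)
       \<le> ennreal (1 / V) * (ennreal ((real N)\<^sup>2 / c\<^sub>0) * (\<integral>\<^sup>+s. ennreal (K s) * Q s \<partial>lborel))"
      by (intro mult_left_mono) auto
    moreover have "ennreal (1 / V) * ennreal V = 1"
      using V by (simp add: ennreal_mult[symmetric])
    moreover have "ennreal (1 / V) * ennreal ((real N)\<^sup>2 / c\<^sub>0) = ennreal C"
      using V c\<^sub>0_pos by (simp add: ennreal_mult[symmetric] C_def mult.commute)
    ultimately show "?I \<le> ennreal C * (\<integral>\<^sup>+(x, y). ennreal (K (y - x) * (w y - w x)\<^sup>2) \<partial>(lborel \<Otimes>\<^sub>M lborel))"
      by (simp add: KQ mult.assoc[symmetric])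
  qed (rule \<open>C > 0\<close>)
qed

end

section \<open>The energy space on the whole space\<close>

text \<open>Fatou's lemma, in the shape that carries uniform bounds on real sequences over to their
  limit.\<close>

lemma nn_integral_le_of_tendsto_AE:
  fixes f :: "'b \<Rightarrow> real"
  assumes [measurable]: "\<And>k. g k \<in> borel_measurable M"
    and lim: "AE x in M. (\<lambda>k. g k x) \<longlonglongrightarrow> f x"
    and le: "eventually (\<lambda>k. (\<integral>\<^sup>+x. ennreal (g k x) \<partial>M) \<le> B) sequentially"
  shows "(\<integral>\<^sup>+x. ennreal (f x) \<partial>M) \<le> B"
proof -
  have "(\<integral>\<^sup>+x. ennreal (f x) \<partial>M) = (\<integral>\<^sup>+x. liminf (\<lambda>k. ennreal (g k x)) \<partial>M)"
  proof (rule nn_integral_cong_AE)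
    show "AE x in M. ennreal (f x) = liminf (\<lambda>k. ennreal (g k x))"
      using lim by eventually_elim (metis lim_imp_Liminf tendsto_ennrealI sequentially_bot)
  qed
  also have "\<dots> \<le> liminf (\<lambda>k. \<integral>\<^sup>+x. ennreal (g k x) \<partial>M)"
    by (rule nn_integral_liminf) measurable
  also have "\<dots> \<le> liminf (\<lambda>k. B)" by (rule Liminf_mono[OF le])
  finally show ?thesis by (simp add: Liminf_const)
qed

lemma abs_mult_le_sum_squares: "\<bar>p * q\<bar> \<le> p\<^sup>2 + q\<^sup>2" for p q :: real
  using sum_squares_bound[of p q] sum_squares_bound[of "- p" q] zero_le_power2[of p] zero_le_power2[of q]
  unfolding abs_le_iff by simp

lemma quarter_power: "((1/2::real)^n)\<^sup>2 = (1/4)^n"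
  by (simp add: power2_eq_square power_mult_distrib[symmetric])

context nonlocal_kernel
begin

text \<open>Vanishing off \<Omega> is required at every point, since the telescoping argument
  follows individual points x + i s.\<close>

definition space0 :: "('a \<Rightarrow> real) set" where
  "space0 = {w \<in> borel_measurable borel. (\<forall>x. x \<notin> \<Omega> \<longrightarrow> w x = 0)
     \<and> integrable lborel (\<lambda>x. (w x)\<^sup>2)
     \<and> integrable (lborel \<Otimes>\<^sub>M lborel) (\<lambda>(x, y). K (y - x) * (w y - w x)\<^sup>2)}"

definition form0 :: "('a \<Rightarrow> real) \<Rightarrow> ('a \<Rightarrow> real) \<Rightarrow> real" where
  "form0 w z = (LINT (x, y)|(lborel \<Otimes>\<^sub>M lborel). K (y - x) * (w y - w x) * (z y - z x))"

lemma space0D: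
  assumes "w \<in> space0"
  shows "w \<in> borel_measurable borel" "x \<notin> \<Omega> \<Longrightarrow> w x = 0" "integrable lborel (\<lambda>x. (w x)\<^sup>2)"
    "integrable (lborel \<Otimes>\<^sub>M lborel) (\<lambda>(x, y). K (y - x) * (w y - w x)\<^sup>2)"
  using assms by (auto simp: space0_def)

lemma integrable_form0:
  assumes w: "w \<in> space0" and z: "z \<in> space0"
  shows "integrable (lborel \<Otimes>\<^sub>M lborel) (\<lambda>(x, y). K (y - x) * (w y - w x) * (z y - z x))"
proof -
  note [measurable] = space0D(1)[OF w] space0D(1)[OF z]
  show ?thesis
  proof (rule Bochner_Integration.integrable_bound)
    show "integrable (lborel \<Otimes>\<^sub>M lborel)
      (\<lambda>p. (case p of (x, y) \<Rightarrow> K (y - x) * (w y - w x)\<^sup>2) + (case p of (x, y) \<Rightarrow> K (y - x) * (z y - z x)\<^sup>2))"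
      by (intro Bochner_Integration.integrable_add space0D w z)
    show "AE p in lborel \<Otimes>\<^sub>M lborel. norm (case p of (x, y) \<Rightarrow> K (y - x) * (w y - w x) * (z y - z x))
      \<le> norm ((case p of (x, y) \<Rightarrow> K (y - x) * (w y - w x)\<^sup>2) + (case p of (x, y) \<Rightarrow> K (y - x) * (z y - z x)\<^sup>2))"
    proof (rule AE_I2, clarsimp)
      fix x y
      let ?p = "w y - w x" and ?q = "z y - z x"
      have "\<bar>?p * ?q\<bar> \<le> ?p\<^sup>2 + ?q\<^sup>2"
        by (rule abs_mult_le_sum_squares)
      then have "K (y - x) * \<bar>?p * ?q\<bar> \<le> K (y - x) * (?p\<^sup>2 + ?q\<^sup>2)"
        by (rule mult_left_mono) (rule K_nonneg)
      then show "\<bar>K (y - x) * ?p * ?q\<bar> \<le> \<bar>K (y - x) * ?p\<^sup>2 + K (y - x) * ?q\<^sup>2\<bar>"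
        by (simp add: abs_mult K_nonneg distrib_left mult.assoc)
    qed
  qed measurable
qed

lemma subspace_space0: "subspace space0"
proof (rule subspaceI)
  show "0 \<in> space0" by (simp add: space0_def zero_fun_def case_prod_unfold)
  fix w assume w: "w \<in> space0"
  note [measurable] = space0D(1)[OF w]
  show "c *\<^sub>R w \<in> space0" for c
  proof -
    have "(\<lambda>(x, y). K (y - x) * (c * w y - c * w x)\<^sup>2) = (\<lambda>p. c\<^sup>2 * (case p of (x, y) \<Rightarrow> K (y - x) * (w y - w x)\<^sup>2))"
      by (auto simp: fun_eq_iff power2_eq_square algebra_simps)
    then show ?thesis
      using w unfolding space0_def by (simp add: scaleR_fun_def power_mult_distrib)
  qed
  fix z assume z: "z \<in> space0"
  note [measurable] = space0D(1)[OF z]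
  show "w + z \<in> space0"
  proof -
    have "integrable lborel (\<lambda>x. (w x + z x)\<^sup>2)"
    proof (rule Bochner_Integration.integrable_bound)
      show "integrable lborel (\<lambda>x. 2 * (w x)\<^sup>2 + 2 * (z x)\<^sup>2)"
        using space0D(3)[OF w] space0D(3)[OF z] by simp
      show "AE x in lborel. norm ((w x + z x)\<^sup>2) \<le> norm (2 * (w x)\<^sup>2 + 2 * (z x)\<^sup>2)"
      proof (rule AE_I2)
        fix x
        show "norm ((w x + z x)\<^sup>2) \<le> norm (2 * (w x)\<^sup>2 + 2 * (z x)\<^sup>2)"
          using sum_squares_bound[of "w x" "z x"] zero_le_power2[of "w x + z x"]
          by (simp add: power2_sum del: zero_le_power2)
      qed
    qed measurable
    moreover have "(\<lambda>(x, y). K (y - x) * ((w y + z y) - (w x + z x))\<^sup>2)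
       = (\<lambda>p. (case p of (x, y) \<Rightarrow> K (y - x) * (w y - w x) * (w y - w x))
           + 2 * (case p of (x, y) \<Rightarrow> K (y - x) * (w y - w x) * (z y - z x))
           + (case p of (x, y) \<Rightarrow> K (y - x) * (z y - z x) * (z y - z x)))"
      by (auto simp: fun_eq_iff power2_eq_square algebra_simps)
    then have "integrable (lborel \<Otimes>\<^sub>M lborel) (\<lambda>(x, y). K (y - x) * ((w y + z y) - (w x + z x))\<^sup>2)"
      by (simp only:) (intro Bochner_Integration.integrable_add integrable_mult_right integrable_form0 w z)
    ultimately show ?thesis
      using w z unfolding space0_def by (simp add: plus_fun_def)
  qed
qed

sublocale E: semi_inner space0 form0
proof
  show "subspace space0" by (rule subspace_space0)
  show "form0 (u + v) w = form0 u w + form0 v w" if "u \<in> space0" "v \<in> space0" "w \<in> space0" for u v w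
  proof -
    have "(\<lambda>(x, y). K (y - x) * ((u + v) y - (u + v) x) * (w y - w x))
       = (\<lambda>p. (case p of (x, y) \<Rightarrow> K (y - x) * (u y - u x) * (w y - w x))
            + (case p of (x, y) \<Rightarrow> K (y - x) * (v y - v x) * (w y - w x)))"
      by (auto simp: fun_eq_iff algebra_simps)
    then show ?thesis
      unfolding form0_def by (simp only: Bochner_Integration.integral_add integrable_form0 that)
  qed
  show "form0 (c *\<^sub>R u) w = c * form0 u w" for u w c
  proof -
    have "(\<lambda>(x, y). K (y - x) * ((c *\<^sub>R u) y - (c *\<^sub>R u) x) * (w y - w x))
       = (\<lambda>p. c * (case p of (x, y) \<Rightarrow> K (y - x) * (u y - u x) * (w y - w x)))"
      by (auto simp: fun_eq_iff algebra_simps)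
    then show ?thesis unfolding form0_def by (simp only: integral_mult_right_zero)
  qed
  show "form0 u v = form0 v u" for u v
    unfolding form0_def by (simp add: mult_ac)
  show "0 \<le> form0 u u" for u
    unfolding form0_def by (rule integral_nonneg_AE) (simp add: case_prod_unfold K_nonneg mult.assoc)
qed

lemma nn_integral_form0:
  assumes "w \<in> space0"
  shows "(\<integral>\<^sup>+(x, y). ennreal (K (y - x) * (w y - w x)\<^sup>2) \<partial>(lborel \<Otimes>\<^sub>M lborel)) = ennreal (form0 w w)"
  using nn_integral_eq_integral[OF space0D(4)[OF assms]] K_nonneg
  by (simp add: form0_def case_prod_unfold power2_eq_square mult.assoc)

lemma poincare: "\<exists>C>0. \<forall>w\<in>space0. (LINT x|lborel. (w x)\<^sup>2) \<le> C * form0 w w"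
proof -
  obtain C where C: "C > 0" "\<And>w. w \<in> borel_measurable borel \<Longrightarrow> (\<forall>x. x \<notin> \<Omega> \<longrightarrow> w x = 0) \<Longrightarrow>
     (\<integral>\<^sup>+x. ennreal ((w x)\<^sup>2) \<partial>lborel)
       \<le> ennreal C * (\<integral>\<^sup>+(x, y). ennreal (K (y - x) * (w y - w x)\<^sup>2) \<partial>(lborel \<Otimes>\<^sub>M lborel))"
    using poincare_nn by blast
  have "(LINT x|lborel. (w x)\<^sup>2) \<le> C * form0 w w" if w: "w \<in> space0" for w
  proof -
    have "ennreal (LINT x|lborel. (w x)\<^sup>2) = (\<integral>\<^sup>+x. ennreal ((w x)\<^sup>2) \<partial>lborel)"
      using nn_integral_eq_integral[OF space0D(3)[OF w]] by simp
    also have "\<dots> \<le> ennreal C * ennreal (form0 w w)"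
      using C(2)[of w] space0D(1,2)[OF w] nn_integral_form0[OF w] by simp
    also have "\<dots> = ennreal (C * form0 w w)" using C(1) E.nonneg[OF w] by (simp add: ennreal_mult)
    finally show ?thesis using C(1) E.nonneg[OF w] by (subst (asm) ennreal_le_iff) auto
  qed
  then show ?thesis using C(1) by blast
qed

text \<open>By the Poincare inequality zero energy forces zero L2 norm; constants are excluded by
  the vanishing outside \<Omega>.\<close>

lemma form0_eq_0_imp:
  assumes w: "w \<in> space0" and "form0 w w = 0"
  shows "AE x in lborel. w x = 0"
proof -
  obtain C where "(LINT x|lborel. (w x)\<^sup>2) \<le> C * form0 w w" using poincare w by blast
  then have "(LINT x|lborel. (w x)\<^sup>2) = 0"
    using assms by (simp add: order_antisym integral_nonneg_AE)
  then show ?thesis using integral_nonneg_eq_0_iff_AE[OF space0D(3)[OF w]] by simp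
qed

lemma form0_eq_0_if_AE:
  assumes [measurable]: "w \<in> borel_measurable borel" "z \<in> borel_measurable borel" and eq: "AE x in lborel. w x = 0"
  shows "form0 w z = 0"
proof -
  have "AE p in lborel \<Otimes>\<^sub>M lborel. (case p of (x, y) \<Rightarrow> K (y - x) * (w y - w x) * (z y - z x)) = 0"
    using AE_lborel_fst[OF eq] AE_lborel_snd[OF eq] by eventually_elim auto
  then show ?thesis unfolding form0_def by (rule integral_eq_zero_AE)
qed

lemma emeasure_\<Omega>: "emeasure lborel \<Omega> < \<infinity>"
  using \<Omega>_bounded by (rule emeasure_bounded_finite)

text \<open>On \<Omega>, of finite measure, an increment \<Delta> satisfies |\<Delta>| \<le> 2^(-n)
  + 2^n \<Delta>^2. The Poincare inequality bounds the integral of \<Delta>^2 by C 4^(-n), so the L1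
  norms are summable.\<close>

lemma summable_increments_AE:
  assumes X: "\<And>n. X n \<in> space0" "\<And>n. form0 (X (Suc n) - X n) (X (Suc n) - X n) \<le> (1/4)^n"
  shows "AE x in lborel. summable (\<lambda>n. \<bar>X (Suc n) x - X n x\<bar>)"
proof -
  obtain C where C: "C > 0" "\<And>w. w \<in> space0 \<Longrightarrow> (LINT x|lborel. (w x)\<^sup>2) \<le> C * form0 w w"
    using poincare by blast
  note [measurable] = space0D(1)[OF X(1)]
  define D where "D = measure lborel \<Omega> + C"
  have "(\<integral>\<^sup>+x. ennreal \<bar>X (Suc n) x - X n x\<bar> \<partial>lborel) \<le> ennreal (D * (1/2)^n)" for n
  proof -
    define \<Delta> where "\<Delta> = X (Suc n) - X n"
    have \<Delta>: "\<Delta> \<in> space0" unfolding \<Delta>_def by (intro E.mem_diff X(1))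
    note [measurable] = space0D(1)[OF \<Delta>]
    have pt: "\<bar>\<Delta> x\<bar> \<le> (1/2)^n * indicator \<Omega> x + 2^n * (\<Delta> x)\<^sup>2" for x
    proof (cases "x \<in> \<Omega>")
      case True
      have "0 \<le> ((1/2)^n - \<bar>\<Delta> x\<bar>)\<^sup>2 + (1/2)^n * \<bar>\<Delta> x\<bar>" by simp
      then have "0 \<le> 2^n * (((1/2)^n - \<bar>\<Delta> x\<bar>)\<^sup>2 + (1/2)^n * \<bar>\<Delta> x\<bar>)" by simp
      also have "\<dots> = 2^n * ((1/2)^n * (1/2)^n) - 2^n * (1/2)^n * \<bar>\<Delta> x\<bar> + 2^n * (\<Delta> x)\<^sup>2"
        by (simp add: power2_diff power2_eq_square[of "(1/2)^n"] algebra_simps)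
      also have "\<dots> = (1/2)^n - \<bar>\<Delta> x\<bar> + 2^n * (\<Delta> x)\<^sup>2"
        by (simp add: power_one_over)
      finally show ?thesis using True by simp
    qed (use space0D(2)[OF \<Delta>] in simp)
    have int1: "integrable lborel (\<lambda>x. (1/2)^n * indicator \<Omega> x :: real)"
      using emeasure_\<Omega> by (intro integrable_mult_right integrable_real_indicator) auto
    have int: "integrable lborel (\<lambda>x. (1/2)^n * indicator \<Omega> x + 2^n * (\<Delta> x)\<^sup>2)"
      using space0D(3)[OF \<Delta>] int1 by simp
    have "(\<integral>\<^sup>+x. ennreal \<bar>\<Delta> x\<bar> \<partial>lborel) \<le> (\<integral>\<^sup>+x. ennreal ((1/2)^n * indicator \<Omega> x + 2^n * (\<Delta> x)\<^sup>2) \<partial>lborel)"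
      by (intro nn_integral_mono ennreal_leI pt)
    also have "\<dots> = ennreal (LINT x|lborel. (1/2)^n * indicator \<Omega> x + 2^n * (\<Delta> x)\<^sup>2)"
      by (rule nn_integral_eq_integral[OF int]) simp
    also have "(LINT x|lborel. (1/2)^n * indicator \<Omega> x + 2^n * (\<Delta> x)\<^sup>2)
        = (1/2)^n * measure lborel \<Omega> + 2^n * (LINT x|lborel. (\<Delta> x)\<^sup>2)"
      using space0D(3)[OF \<Delta>] int1 by simp
    also have "\<dots> \<le> (1/2)^n * measure lborel \<Omega> + 2^n * (C * (1/4)^n)"
    proof -
      have "(LINT x|lborel. (\<Delta> x)\<^sup>2) \<le> C * (1/4)^n"
        using order_trans[OF C(2)[OF \<Delta>] mult_left_mono[of "form0 \<Delta> \<Delta>" "(1/4)^n" C]] X(2)[of n] C(1)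
        by (simp add: \<Delta>_def)
      then show ?thesis by simp
    qed
    also have "\<dots> = D * (1/2)^n"
      using quarter_power[of n] by (simp add: D_def power2_eq_square power_one_over field_simps)
    finally show ?thesis by (simp add: \<Delta>_def ennreal_leI)
  qed
  then have "(\<integral>\<^sup>+x. (\<Sum>n. ennreal \<bar>X (Suc n) x - X n x\<bar>) \<partial>lborel) \<le> (\<Sum>n. ennreal (D * (1/2)^n))"
    by (subst nn_integral_suminf) (auto intro!: suminf_le)
  also have "\<dots> = ennreal (\<Sum>n. D * (1/2)^n)"
    by (rule suminf_ennreal2) (use C(1) in \<open>auto simp: D_def intro!: summable_mult\<close>)
  also have "\<dots> < \<infinity>" by simp
  finally have "AE x in lborel. (\<Sum>n. ennreal \<bar>X (Suc n) x - X n x\<bar>) \<noteq> \<infinity>"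
    by (intro nn_integral_PInf_AE) auto
  then show ?thesis
    by eventually_elim (rule summable_suminf_not_top, auto)
qed

sublocale E: complete_semi_inner space0 form0
proof
  fix X assume X: "\<And>n. X n \<in> space0" "\<And>n. form0 (X (Suc n) - X n) (X (Suc n) - X n) \<le> (1/4)^n"
  obtain C where C: "C > 0" "\<And>w. w \<in> space0 \<Longrightarrow> (LINT x|lborel. (w x)\<^sup>2) \<le> C * form0 w w"
    using poincare by blast
  note [measurable] = space0D(1)[OF X(1)]
  \<comment> \<open>\<open>lim\<close> is total: outside \<Omega> it is the limit of a zero sequence
    and hence exactly 0, and the points of divergence form a null set.\<close>
  define w where "w x = lim (\<lambda>n. X n x)" for x
  have w_meas [measurable]: "w \<in> borel_measurable borel"
    unfolding w_def by (rule borel_measurable_lim_metric) (rule space0D(1)[OF X(1)])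
  have w0: "w x = 0" if "x \<notin> \<Omega>" for x
    using space0D(2)[OF X(1) that] by (simp add: w_def)
  have lim: "AE x in lborel. (\<lambda>n. X n x) \<longlonglongrightarrow> w x"
    using summable_increments_AE[OF X, simplified]
  proof eventually_elim
    case (elim x)
    have "summable (\<lambda>n. X (Suc n) x - X n x)" using elim by (rule summable_rabs_cancel)
    then have "convergent (\<lambda>n. \<Sum>i<n. X (Suc i) x - X i x)" by (simp add: summable_iff_convergent)
    then have "convergent (\<lambda>n. X n x - X 0 x)"
      by (simp only: sum_lessThan_telescope[of "\<lambda>n. X n x"])
    then have "convergent (\<lambda>n. X n x)"
      using convergent_add[OF _ convergent_const[of "X 0 x"], of "\<lambda>n. X n x - X 0 x"] by simp
    then show ?case by (simp add: w_def convergent_LIMSEQ_iff)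
  qed
  have Cauchy: "form0 (X m - X k) (X m - X k) \<le> 4 * (1/4)^m" if "k \<ge> m" for m k
  proof -
    have "form0 (X m - X k) (X m - X k) = (E.nrm (X m - X (m + (k - m))))\<^sup>2"
      using that X(1) by (simp add: E.nrm_sq)
    also have "\<dots> \<le> (2 * (1/2)^m)\<^sup>2"
      using E.rapid_Cauchy[OF X, of m "k - m"] X(1) by (intro power_mono) auto
    finally show ?thesis by (simp add: power_mult_distrib quarter_power del: power_one_over)
  qed
  \<comment> \<open>Fatou in k with m fixed: the Cauchy bound passes from \<open>X k\<close> to the
    limit w.\<close>
  have energy: "(\<integral>\<^sup>+p. ennreal (case p of (x, y) \<Rightarrow> K (y - x) * ((X m - w) y - (X m - w) x)\<^sup>2) \<partial>(lborel \<Otimes>\<^sub>M lborel))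
      \<le> ennreal (4 * (1/4)^m)" for m
  proof (rule nn_integral_le_of_tendsto_AE)
    show "AE p in lborel \<Otimes>\<^sub>M lborel. (\<lambda>k. case p of (x, y) \<Rightarrow> K (y - x) * ((X m - X k) y - (X m - X k) x)\<^sup>2)
       \<longlonglongrightarrow> (case p of (x, y) \<Rightarrow> K (y - x) * ((X m - w) y - (X m - w) x)\<^sup>2)"
      using AE_lborel_fst[OF lim] AE_lborel_snd[OF lim]
      by eventually_elim (auto simp: case_prod_unfold intro!: tendsto_intros)
    show "\<forall>\<^sub>F k in sequentially. (\<integral>\<^sup>+p. ennreal (case p of (x, y) \<Rightarrow> K (y - x) * ((X m - X k) y - (X m - X k) x)\<^sup>2) \<partial>(lborel \<Otimes>\<^sub>M lborel))
       \<le> ennreal (4 * (1/4)^m)"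
      using eventually_ge_at_top[of m]
    proof eventually_elim
      case (elim k)
      show ?case using nn_integral_form0[OF E.mem_diff[OF X(1) X(1)], of m k] Cauchy[OF elim]
        by (simp add: case_prod_unfold ennreal_leI)
    qed
  qed (unfold minus_apply, measurable)
  have L2: "(\<integral>\<^sup>+x. ennreal (((X m - w) x)\<^sup>2) \<partial>lborel) \<le> ennreal (C * (4 * (1/4)^m))" for m
  proof (rule nn_integral_le_of_tendsto_AE)
    show "AE x in lborel. (\<lambda>k. ((X m - X k) x)\<^sup>2) \<longlonglongrightarrow> ((X m - w) x)\<^sup>2"
      using lim by eventually_elim (auto intro!: tendsto_intros)
    show "\<forall>\<^sub>F k in sequentially. (\<integral>\<^sup>+x. ennreal (((X m - X k) x)\<^sup>2) \<partial>lborel) \<le> ennreal (C * (4 * (1/4)^m))"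
      using eventually_ge_at_top[of m]
    proof eventually_elim
      case (elim k)
      have XX: "X m - X k \<in> space0" by (intro E.mem_diff X(1))
      have "(LINT x|lborel. ((X m - X k) x)\<^sup>2) \<le> C * (4 * (1/4)^m)"
        using C(2)[OF XX] mult_left_mono[OF Cauchy[OF elim], of C] C(1) by linarith
      then show ?case
        using nn_integral_eq_integral[OF space0D(3)[OF XX]] by (simp add: ennreal_leI)
    qed
  qed (unfold minus_apply, measurable)
  have mem: "X m - w \<in> space0" for m
  proof -
    have "integrable lborel (\<lambda>x. ((X m - w) x)\<^sup>2)"
      using L2[of m] by (intro integrableI_bounded) (auto simp: le_less_trans)
    moreover have "integrable (lborel \<Otimes>\<^sub>M lborel) (\<lambda>(x, y). K (y - x) * ((X m - w) y - (X m - w) x)\<^sup>2)"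
      using le_less_trans[OF energy[of m]] K_nonneg
      by (intro integrableI_bounded) (auto simp: case_prod_unfold abs_mult)
    ultimately show ?thesis
      using X(1)[of m] w0 unfolding space0_def by (simp add: fun_diff_def)
  qed
  \<comment> \<open>Fatou controls the differences only; w is recovered as
    \<open>X 0 - (X 0 - w)\<close>.\<close>
  have "w \<in> space0" using E.mem_diff[OF X(1)[of 0] mem[of 0]] by simp
  moreover have "(\<lambda>m. form0 (X m - w) (X m - w)) \<longlonglongrightarrow> 0"
  proof (rule tendsto_sandwich[OF _ _ tendsto_const])
    show "\<forall>\<^sub>F m in sequentially. 0 \<le> form0 (X m - w) (X m - w)" using E.nonneg[OF mem] by simp
    have "ennreal (form0 (X m - w) (X m - w)) \<le> ennreal (4 * (1/4)^m)" for m
      using nn_integral_form0[OF mem[of m]] energy[of m] by (simp add: case_prod_unfold)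
    then show "\<forall>\<^sub>F m in sequentially. form0 (X m - w) (X m - w) \<le> 4 * (1/4)^m"
      by (simp add: ennreal_le_iff)
    show "(\<lambda>m. 4 * (1/4::real)^m) \<longlonglongrightarrow> 0"
      by (rule tendsto_mult_right_zero, rule LIMSEQ_power_zero) simp
  qed
  ultimately show "\<exists>x\<in>space0. (\<lambda>n. form0 (X n - x) (X n - x)) \<longlonglongrightarrow> 0" by blast
qed

text \<open>The distance to the complement is 1-Lipschitz, positive exactly on \<Omega>, and
  contributes only at pairs meeting \<Omega>; its energy is thus controlled by the second moment and
  the measure of \<Omega>. The example keeps the suprema in the norms over nonempty sets.\<close>

lemma exists_form0_nonzero: "\<exists>w\<in>space0. form0 w w \<noteq> 0"
proof -
  define w where "w x = infdist x (- \<Omega>)" for x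
  have [measurable]: "w \<in> borel_measurable borel"
    unfolding w_def by (intro borel_measurable_continuous_onI continuous_intros)
  have ne: "- \<Omega> \<noteq> {}" using \<Omega>_bounded not_bounded_UNIV by (metis Compl_empty_eq double_complement)
  have w0: "w x = 0" if "x \<notin> \<Omega>" for x using that by (simp add: w_def)
  have lip: "\<bar>w y - w x\<bar> \<le> norm (y - x)" for x y
    using infdist_triangle_abs[of y "- \<Omega>" x] by (simp add: w_def dist_norm)
  have wpos: "w x > 0" if "x \<in> \<Omega>" for x
    using that \<Omega>_open ne in_closed_iff_infdist_zero[of "- \<Omega>" x] infdist_nonneg[of x "- \<Omega>"]
    by (auto simp: w_def closed_Compl less_le)
  obtain R where R: "\<And>x. x \<in> \<Omega> \<Longrightarrow> norm x \<le> R"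
    using \<Omega>_bounded by (auto simp: bounded_iff)
  obtain z where z: "z \<notin> \<Omega>" using ne by blast
  have int_ind: "integrable lborel (indicator \<Omega> :: 'a \<Rightarrow> real)"
    using emeasure_\<Omega> by (intro integrable_real_indicator) auto
  have "integrable lborel (\<lambda>x. (w x)\<^sup>2)"
  proof (rule Bochner_Integration.integrable_bound)
    show "integrable lborel (\<lambda>x. (R + norm z)\<^sup>2 * indicator \<Omega> x)" using int_ind by simp
    show "AE x in lborel. norm ((w x)\<^sup>2) \<le> norm ((R + norm z)\<^sup>2 * indicator \<Omega> x)"
    proof (rule AE_I2)
      fix x
      show "norm ((w x)\<^sup>2) \<le> norm ((R + norm z)\<^sup>2 * indicator \<Omega> x)"
      proof (cases "x \<in> \<Omega>")
        case True
        have "\<bar>w x\<bar> \<le> R + norm z"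
          using lip[of x z] w0[OF z] R[OF True] norm_triangle_ineq4[of x z] by simp
        then show ?thesis using True by (simp add: abs_le_square_iff[symmetric])
      qed (simp add: w0)
    qed
  qed measurable
  moreover have "integrable (lborel \<Otimes>\<^sub>M lborel) (\<lambda>(x, y). K (y - x) * (w y - w x)\<^sup>2)"
  proof (rule Bochner_Integration.integrable_bound)
    show "integrable (lborel \<Otimes>\<^sub>M lborel) (\<lambda>p. (case p of (x, y) \<Rightarrow> K (y - x) * (norm (y - x))\<^sup>2 * indicator \<Omega> x)
      + (case p of (x, y) \<Rightarrow> K (y - x) * (norm (y - x))\<^sup>2 * indicator \<Omega> y))"
      using integrable_convolution_fst(1)[OF K_moment int_ind] integrable_convolution_snd[OF K_moment int_ind]
      by simp
    show "AE p in lborel \<Otimes>\<^sub>M lborel. norm (case p of (x, y) \<Rightarrow> K (y - x) * (w y - w x)\<^sup>2)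
      \<le> norm ((case p of (x, y) \<Rightarrow> K (y - x) * (norm (y - x))\<^sup>2 * indicator \<Omega> x)
      + (case p of (x, y) \<Rightarrow> K (y - x) * (norm (y - x))\<^sup>2 * indicator \<Omega> y))"
    proof (rule AE_I2, clarsimp)
      fix x y
      have "(w y - w x)\<^sup>2 \<le> (norm (y - x))\<^sup>2" using lip[of y x] by (simp add: abs_le_square_iff[symmetric])
      moreover define q where "q = K (y - x) * (norm (y - x))\<^sup>2"
      ultimately have "K (y - x) * (w y - w x)\<^sup>2 \<le> q" "0 \<le> q"
        using K_nonneg by (auto simp: mult_left_mono)
      moreover have "x \<in> \<Omega> \<or> y \<in> \<Omega> \<or> w y - w x = 0" using w0 by (metis diff_self)
      ultimately show "\<bar>K (y - x) * (w y - w x)\<^sup>2\<bar> \<le> \<bar>K (y - x) * (norm (y - x))\<^sup>2 * indicator \<Omega> x + K (y - x) * (norm (y - x))\<^sup>2 * indicator \<Omega> y\<bar>"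
        unfolding q_def[symmetric] using K_nonneg by (auto simp: indicator_def)
    qed
  qed measurable
  ultimately have w: "w \<in> space0" using w0 by (simp add: space0_def)
  moreover have "form0 w w \<noteq> 0"
  proof
    assume "form0 w w = 0"
    then have "AE x in lborel. w x = 0" using form0_eq_0_imp[OF w] by blast
    then have "AE x in lborel. x \<notin> \<Omega>" by eventually_elim (use wpos in force)
    then have "\<Omega> \<in> null_sets lborel" by (subst (asm) AE_iff_null_sets[symmetric]) auto
    then have "negligible \<Omega>" by (simp add: negligible_iff_null_sets null_sets_completionI)
    then show False using open_not_negligible \<Omega>_open \<Omega>_ne by blast
  qed
  ultimately show ?thesis by blast
qed

end

section \<open>Convection forms\<close>

context nonlocal_kernel
begin

text \<open>\<theta> will collect the velocity, the indicator of the influence region and the factor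
  |y - x|/\<eta> by which the convection kernel differs from K. Hence the standing bound by a
  multiple of |y - x|.\<close>

definition conv0 :: "('a \<Rightarrow> 'a \<Rightarrow> real) \<Rightarrow> ('a \<Rightarrow> real) \<Rightarrow> ('a \<Rightarrow> real) \<Rightarrow> real" where
  "conv0 \<theta> w z = (LINT (x, y)|(lborel \<Otimes>\<^sub>M lborel). \<theta> x y * K (y - x) * (w y - w x) * z x)"

context
  fixes \<theta> :: "'a \<Rightarrow> 'a \<Rightarrow> real" and L :: real
  assumes \<theta>_meas: "(\<lambda>(x, y). \<theta> x y) \<in> borel_measurable (borel \<Otimes>\<^sub>M borel)"
    and \<theta>_bound: "\<And>x y. \<bar>\<theta> x y\<bar> \<le> L * norm (y - x)"
begin

lemma \<theta>_meas': "(\<lambda>p. \<theta> (fst p) (snd p)) \<in> borel_measurable (lborel \<Otimes>\<^sub>M lborel)"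
  "(\<lambda>p. \<theta> (snd p) (fst p)) \<in> borel_measurable (lborel \<Otimes>\<^sub>M lborel)"
proof -
  show "(\<lambda>p. \<theta> (fst p) (snd p)) \<in> borel_measurable (lborel \<Otimes>\<^sub>M lborel)"
    using \<theta>_meas by (simp add: case_prod_unfold cong: measurable_cong_sets)
  then show "(\<lambda>p. \<theta> (snd p) (fst p)) \<in> borel_measurable (lborel \<Otimes>\<^sub>M lborel)"
    using measurable_compose[OF measurable_pair_swap'[of lborel lborel], of "\<lambda>p. \<theta> (fst p) (snd p)" borel]
    by (simp add: case_prod_unfold)
qed

lemma L_nonneg: "0 \<le> L"
proof -
  obtain e :: 'a where "norm e = 1" using norm_Basis SOME_Basis by blast
  then show ?thesis using order_trans[OF abs_ge_zero \<theta>_bound[of 0 e]] by simp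
qed

text \<open>The factor |y - x| from \<theta> is attached to z, so that the kernel meets z only
  through its second moment; the first moment may be infinite.\<close>

lemma conv0_dominated:
  assumes w: "w \<in> space0" and z: "z \<in> space0"
  shows "\<bar>\<theta> x y * K (y - x) * (w y - w x) * z x\<bar>
    \<le> L * (K (y - x) * (w y - w x)\<^sup>2 + K (y - x) * (norm (y - x))\<^sup>2 * (z x)\<^sup>2)"
proof -
  have "\<bar>\<theta> x y * K (y - x) * (w y - w x) * z x\<bar> = \<bar>\<theta> x y\<bar> * (K (y - x) * \<bar>(w y - w x) * z x\<bar>)"
    by (simp add: abs_mult K_nonneg)
  also have "\<dots> \<le> (L * norm (y - x)) * (K (y - x) * \<bar>(w y - w x) * z x\<bar>)"
    by (intro mult_right_mono \<theta>_bound mult_nonneg_nonneg K_nonneg) auto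
  also have "\<dots> = L * K (y - x) * \<bar>(w y - w x) * (norm (y - x) * z x)\<bar>"
    by (simp add: abs_mult)
  also have "\<dots> \<le> L * K (y - x) * ((w y - w x)\<^sup>2 + (norm (y - x) * z x)\<^sup>2)"
    by (intro mult_left_mono abs_mult_le_sum_squares mult_nonneg_nonneg K_nonneg L_nonneg)
  also have "\<dots> = L * (K (y - x) * (w y - w x)\<^sup>2 + K (y - x) * (norm (y - x))\<^sup>2 * (z x)\<^sup>2)"
    by (simp add: power_mult_distrib algebra_simps)
  finally show ?thesis .
qed

lemma integrable_conv0_bound:
  assumes w: "w \<in> space0" and z: "z \<in> space0"
  shows "integrable (lborel \<Otimes>\<^sub>M lborel)
      (\<lambda>(x, y). L * (K (y - x) * (w y - w x)\<^sup>2 + K (y - x) * (norm (y - x))\<^sup>2 * (z x)\<^sup>2))"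
    and "(LINT (x, y)|(lborel \<Otimes>\<^sub>M lborel). L * (K (y - x) * (w y - w x)\<^sup>2 + K (y - x) * (norm (y - x))\<^sup>2 * (z x)\<^sup>2))
      = L * (form0 w w + (LINT s|lborel. K s * (norm s)\<^sup>2) * (LINT x|lborel. (z x)\<^sup>2))"
proof -
  note 1 = space0D(4)[OF w, unfolded case_prod_unfold]
  note 2 = integrable_convolution_fst[OF K_moment space0D(3)[OF z], unfolded case_prod_unfold]
  show "integrable (lborel \<Otimes>\<^sub>M lborel)
      (\<lambda>(x, y). L * (K (y - x) * (w y - w x)\<^sup>2 + K (y - x) * (norm (y - x))\<^sup>2 * (z x)\<^sup>2))"
    unfolding case_prod_unfold
    by (intro integrable_mult_right Bochner_Integration.integrable_add 1 2)
  show "(LINT (x, y)|(lborel \<Otimes>\<^sub>M lborel). L * (K (y - x) * (w y - w x)\<^sup>2 + K (y - x) * (norm (y - x))\<^sup>2 * (z x)\<^sup>2))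
      = L * (form0 w w + (LINT s|lborel. K s * (norm s)\<^sup>2) * (LINT x|lborel. (z x)\<^sup>2))"
    unfolding case_prod_unfold integral_mult_right_zero Bochner_Integration.integral_add[OF 1 2(1)] 2(2)
    by (simp add: form0_def case_prod_unfold power2_eq_square mult.assoc)
qed

lemma integrable_conv0:
  assumes w: "w \<in> space0" and z: "z \<in> space0"
  shows "integrable (lborel \<Otimes>\<^sub>M lborel) (\<lambda>(x, y). \<theta> x y * K (y - x) * (w y - w x) * z x)"
proof (rule Bochner_Integration.integrable_bound[OF integrable_conv0_bound(1)[OF w z]])
  note [measurable] = \<theta>_meas' space0D(1)[OF w] space0D(1)[OF z]
  show "(\<lambda>(x, y). \<theta> x y * K (y - x) * (w y - w x) * z x) \<in> borel_measurable (lborel \<Otimes>\<^sub>M lborel)"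
    unfolding case_prod_unfold by measurable
  show "AE p in lborel \<Otimes>\<^sub>M lborel. norm (case p of (x, y) \<Rightarrow> \<theta> x y * K (y - x) * (w y - w x) * z x)
    \<le> norm (case p of (x, y) \<Rightarrow> L * (K (y - x) * (w y - w x)\<^sup>2 + K (y - x) * (norm (y - x))\<^sup>2 * (z x)\<^sup>2))"
    by (rule AE_I2) (use conv0_dominated[OF w z] order_trans[OF _ abs_ge_self] in \<open>auto simp only: case_prod_unfold real_norm_def\<close>)
qed

lemma bilinear_conv0: "E.bilinear_on (conv0 \<theta>)"
  unfolding E.bilinear_on_def
proof (intro conjI ballI allI)
  fix u v w assume uvw: "u \<in> space0" "v \<in> space0" "w \<in> space0"
  note int = integrable_conv0[unfolded case_prod_unfold]
  show "conv0 \<theta> (u + v) w = conv0 \<theta> u w + conv0 \<theta> v w"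
    unfolding conv0_def case_prod_unfold
    by (subst Bochner_Integration.integral_add[OF int int, symmetric])
      (use uvw in \<open>auto simp: algebra_simps\<close>)
  show "conv0 \<theta> w (u + v) = conv0 \<theta> w u + conv0 \<theta> w v"
    unfolding conv0_def case_prod_unfold
    by (subst Bochner_Integration.integral_add[OF int int, symmetric])
      (use uvw in \<open>auto simp: algebra_simps\<close>)
next
  fix c u w
  show "conv0 \<theta> (c *\<^sub>R u) w = c * conv0 \<theta> u w"
    unfolding conv0_def case_prod_unfold
    by (subst integral_mult_right_zero[symmetric]) (simp add: algebra_simps)
  show "conv0 \<theta> w (c *\<^sub>R u) = c * conv0 \<theta> w u"
    unfolding conv0_def case_prod_unfold
    by (subst integral_mult_right_zero[symmetric]) (simp add: algebra_simps)
qed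

text \<open>The L2 norm of z is absorbed by the Poincare inequality. The additive form is what the
  scaling argument of \<open>bilinear_bound\<close> turns into a product.\<close>

lemma conv0_bound: "\<exists>C. \<forall>w\<in>space0. \<forall>z\<in>space0. \<bar>conv0 \<theta> w z\<bar> \<le> C * (form0 w w + form0 z z)"
proof -
  obtain P where P: "P > 0" "\<And>w. w \<in> space0 \<Longrightarrow> (LINT x|lborel. (w x)\<^sup>2) \<le> P * form0 w w"
    using poincare by blast
  define m where "m = (LINT s|lborel. K s * (norm s)\<^sup>2)"
  have m: "0 \<le> m" unfolding m_def by (rule integral_nonneg_AE) (simp add: K_nonneg)
  have "\<bar>conv0 \<theta> w z\<bar> \<le> L * (1 + m * P) * (form0 w w + form0 z z)" if w: "w \<in> space0" and z: "z \<in> space0" for w z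
  proof -
    have "\<bar>conv0 \<theta> w z\<bar> \<le> (LINT (x, y)|(lborel \<Otimes>\<^sub>M lborel). L * (K (y - x) * (w y - w x)\<^sup>2 + K (y - x) * (norm (y - x))\<^sup>2 * (z x)\<^sup>2))"
      unfolding conv0_def
      by (rule integral_abs_bound[THEN order_trans], rule integral_mono_AE)
        (use integrable_conv0[OF w z] integrable_conv0_bound(1)[OF w z] conv0_dominated[OF w z] in \<open>auto\<close>)
    also have "\<dots> = L * (form0 w w + m * (LINT x|lborel. (z x)\<^sup>2))"
      unfolding m_def by (rule integrable_conv0_bound(2)[OF w z])
    also have "\<dots> \<le> L * (form0 w w + m * (P * form0 z z))"
      using P(2)[OF z] m L_nonneg by (intro mult_left_mono add_left_mono) auto
    also have "\<dots> \<le> L * ((1 + m * P) * (form0 w w + form0 z z))"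
    proof (rule mult_left_mono[OF _ L_nonneg])
      have "0 \<le> m * P * form0 w w" "0 \<le> form0 z z"
        using m P(1) E.nonneg[OF w] E.nonneg[OF z] by auto
      then show "form0 w w + m * (P * form0 z z) \<le> (1 + m * P) * (form0 w w + form0 z z)"
        by (simp add: algebra_simps)
    qed
    finally show ?thesis by (simp add: mult.assoc)
  qed
  then show ?thesis by blast
qed

text \<open>Pointwise, \<open>(w x - w y) * w x \<ge> ((w x)\<^sup>2 - (w y)\<^sup>2) / 2\<close>; exchanging \<open>x\<close> and \<open>y\<close> in the last term
  turns the remainder into the nonlocal divergence tested with \<open>w\<^sup>2\<close>.\<close>

lemma conv0_nonneg_if_upwind:
  assumes int: "integrable lborel (\<lambda>s. K s * norm s)" and nonpos: "\<And>x y. \<theta> x y \<le> 0"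
    and div: "AE x in lborel. 0 \<le> (LINT y|lborel. (\<theta> y x - \<theta> x y) * K (y - x))"
    and w: "w \<in> space0"
  shows "0 \<le> conv0 \<theta> w w"
proof -
  note [measurable] = \<theta>_meas' space0D(1)[OF w]
  let ?M = "lborel \<Otimes>\<^sub>M (lborel :: 'a measure)"
  \<comment> \<open>Here the first moment enters: it makes the terms with w(x)^2 and w(y)^2
    separately integrable.\<close>
  have intK: "integrable ?M (\<lambda>p. L * (K (snd p - fst p) * norm (snd p - fst p) * (w (fst p))\<^sup>2))"
    using integrable_convolution_fst(1)[OF int space0D(3)[OF w]] by (simp add: case_prod_unfold)
  have dom: "\<bar>\<theta> x y * K (y - x) * (w x)\<^sup>2\<bar> \<le> \<bar>L * (K (y - x) * norm (y - x) * (w x)\<^sup>2)\<bar>"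
      "\<bar>\<theta> y x * K (y - x) * (w x)\<^sup>2\<bar> \<le> \<bar>L * (K (y - x) * norm (y - x) * (w x)\<^sup>2)\<bar>" for x y
  proof -
    have *: "\<bar>t * K (y - x) * (w x)\<^sup>2\<bar> \<le> \<bar>L * (K (y - x) * norm (y - x) * (w x)\<^sup>2)\<bar>" if "\<bar>t\<bar> \<le> L * norm (y - x)" for t
    proof -
      have "\<bar>t\<bar> * (K (y - x) * (w x)\<^sup>2) \<le> L * norm (y - x) * (K (y - x) * (w x)\<^sup>2)"
        using that K_nonneg by (intro mult_right_mono) auto
      then show ?thesis by (simp add: abs_mult K_nonneg L_nonneg mult_ac)
    qed
    show "\<bar>\<theta> x y * K (y - x) * (w x)\<^sup>2\<bar> \<le> \<bar>L * (K (y - x) * norm (y - x) * (w x)\<^sup>2)\<bar>"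
      "\<bar>\<theta> y x * K (y - x) * (w x)\<^sup>2\<bar> \<le> \<bar>L * (K (y - x) * norm (y - x) * (w x)\<^sup>2)\<bar>"
      using *[OF \<theta>_bound[of x y]] *[of "\<theta> y x"] \<theta>_bound[of y x] by (auto simp: norm_minus_commute)
  qed
  have int1: "integrable ?M (\<lambda>p. \<theta> (fst p) (snd p) * K (snd p - fst p) * (w (fst p))\<^sup>2)"
    by (rule Bochner_Integration.integrable_bound[OF intK]) (use dom in auto)
  have int2: "integrable ?M (\<lambda>p. \<theta> (snd p) (fst p) * K (snd p - fst p) * (w (fst p))\<^sup>2)"
    by (rule Bochner_Integration.integrable_bound[OF intK]) (use dom in auto)
  have swap: "(\<lambda>(x, y). \<theta> (snd (y, x)) (fst (y, x)) * K (snd (y, x) - fst (y, x)) * (w (fst (y, x)))\<^sup>2)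
      = (\<lambda>p. \<theta> (fst p) (snd p) * K (snd p - fst p) * (w (snd p))\<^sup>2)"
  proof
    fix p :: "'a \<times> 'a"
    show "(case p of (x, y) \<Rightarrow> \<theta> (snd (y, x)) (fst (y, x)) * K (snd (y, x) - fst (y, x)) * (w (fst (y, x)))\<^sup>2)
      = \<theta> (fst p) (snd p) * K (snd p - fst p) * (w (snd p))\<^sup>2"
      using K_even[of "snd p - fst p"] by (simp add: case_prod_unfold)
  qed
  have int3: "integrable ?M (\<lambda>p. \<theta> (fst p) (snd p) * K (snd p - fst p) * (w (snd p))\<^sup>2)"
    using lborel_pair.integrable_product_swap[OF int2] unfolding swap .
  have eq3: "(LINT p|?M. \<theta> (fst p) (snd p) * K (snd p - fst p) * (w (snd p))\<^sup>2)
     = (LINT p|?M. \<theta> (snd p) (fst p) * K (snd p - fst p) * (w (fst p))\<^sup>2)"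
    using lborel_pair.integral_product_swap[OF borel_measurable_integrable[OF int2]] unfolding swap .
  have "0 \<le> (LINT x|lborel. LINT y|lborel. (\<theta> y x - \<theta> x y) * K (y - x) * (w x)\<^sup>2)"
  proof (rule integral_nonneg_AE)
    show "AE x in lborel. 0 \<le> (LINT y|lborel. (\<theta> y x - \<theta> x y) * K (y - x) * (w x)\<^sup>2)"
      using div by eventually_elim simp
  qed
  also have "\<dots> = (LINT p|?M. \<theta> (snd p) (fst p) * K (snd p - fst p) * (w (fst p))\<^sup>2
      - \<theta> (fst p) (snd p) * K (snd p - fst p) * (w (fst p))\<^sup>2)"
    using lborel_pair.integral_fst'[OF Bochner_Integration.integrable_diff[OF int2 int1], unfolded fst_conv snd_conv]
    by (simp only: left_diff_distrib)
  also have "\<dots> = (LINT p|?M. \<theta> (fst p) (snd p) * K (snd p - fst p) * (w (snd p))\<^sup>2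
      - \<theta> (fst p) (snd p) * K (snd p - fst p) * (w (fst p))\<^sup>2)"
    using int1 int2 int3 eq3 by simp
  also have "\<dots> \<le> (LINT p|?M. 2 * (\<theta> (fst p) (snd p) * K (snd p - fst p) * (w (snd p) - w (fst p)) * w (fst p)))"
  proof (rule integral_mono[OF Bochner_Integration.integrable_diff[OF int3 int1] integrable_mult_right])
    show "integrable ?M (\<lambda>p. \<theta> (fst p) (snd p) * K (snd p - fst p) * (w (snd p) - w (fst p)) * w (fst p))"
      using integrable_conv0[OF w w] by (simp add: case_prod_unfold)
    fix p :: "'a \<times> 'a"
    define t where "t = \<theta> (fst p) (snd p) * K (snd p - fst p)"
    have "t \<le> 0" unfolding t_def using nonpos K_nonneg by (simp add: mult_nonpos_nonneg)
    then have "t * (w (snd p) - w (fst p))\<^sup>2 \<le> 0" by (simp add: mult_nonpos_nonneg)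
    then show "t * (w (snd p))\<^sup>2 - t * (w (fst p))\<^sup>2 \<le> 2 * (t * (w (snd p) - w (fst p)) * w (fst p))"
      by (simp add: power2_eq_square algebra_simps)
  qed
  also have "\<dots> = 2 * conv0 \<theta> w w" by (simp add: conv0_def case_prod_unfold)
  finally show ?thesis by simp
qed

end

text \<open>The kernel \<open>g * K\<close> need not be integrable at the origin, so the two antisymmetric terms can only be
  separated after truncation.\<close>

lemma conv0_odd:
  fixes g :: "'a \<Rightarrow> real"
  assumes [measurable]: "g \<in> borel_measurable borel" and bound: "\<And>s. \<bar>g s\<bar> \<le> L * norm s"
    and odd: "\<And>s. g (- s) = - g s" and w: "w \<in> space0"
  shows "conv0 (\<lambda>x y. g (y - x)) w w = 0"
proof -
  note [measurable] = space0D(1)[OF w]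
  let ?M = "lborel \<Otimes>\<^sub>M (lborel :: 'a measure)"
  have \<theta>: "(\<lambda>(x, y). g (y - x)) \<in> borel_measurable (borel \<Otimes>\<^sub>M borel)" by measurable
  \<comment> \<open>Off the ball of radius 1/(n + 1) one has |s| \<le> (n + 1) |s|^2, so the
    truncated kernel is integrable by the second moment.\<close>
  define g' where "g' n s = (if 1 / real (Suc n) \<le> norm s then g s * K s else 0)" for n s
  have [measurable]: "g' n \<in> borel_measurable borel" for n unfolding g'_def by measurable
  have int: "integrable lborel (g' n)" for n
  proof (rule Bochner_Integration.integrable_bound)
    show "integrable lborel (\<lambda>s. \<bar>L\<bar> * real (Suc n) * (K s * (norm s)\<^sup>2))" using K_moment by simp
    show "AE s in lborel. norm (g' n s) \<le> norm (\<bar>L\<bar> * real (Suc n) * (K s * (norm s)\<^sup>2))"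
    proof (rule AE_I2)
      fix s
      show "norm (g' n s) \<le> norm (\<bar>L\<bar> * real (Suc n) * (K s * (norm s)\<^sup>2))"
      proof (cases "1 / real (Suc n) \<le> norm s")
        case True
        have "1 \<le> real (Suc n) * norm s" using True by (simp add: field_simps)
        then have "\<bar>L\<bar> * norm s * 1 \<le> \<bar>L\<bar> * norm s * (real (Suc n) * norm s)"
          by (intro mult_left_mono) auto
        moreover have "\<bar>g s\<bar> \<le> \<bar>L\<bar> * norm s"
          using bound[of s] mult_right_mono[OF abs_ge_self[of L] norm_ge_zero[of s]] by linarith
        ultimately have "\<bar>g s\<bar> * K s \<le> \<bar>L\<bar> * norm s * (real (Suc n) * norm s) * K s"
          using K_nonneg by (intro mult_right_mono) auto
        then show ?thesis using True K_nonneg[of s]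
          by (simp add: g'_def abs_mult power2_eq_square mult_ac)
      qed (simp add: g'_def)
    qed
  qed measurable
  have g'_odd: "g' n (- s) = - g' n s" for n s by (simp add: g'_def odd K_even)
  have zero: "(LINT p|?M. g' n (snd p - fst p) * (w (snd p) - w (fst p)) * w (fst p)) = 0" for n
  proof -
    have i1: "integrable ?M (\<lambda>p. g' n (snd p - fst p) * (w (fst p))\<^sup>2)"
      using integrable_convolution_fst(1)[OF int space0D(3)[OF w]] by (simp add: case_prod_unfold)
    have i2: "integrable ?M (\<lambda>p. g' n (snd p - fst p) * (w (snd p))\<^sup>2)"
      using integrable_convolution_snd[OF int space0D(3)[OF w]] by (simp add: case_prod_unfold)
    have i3: "integrable ?M (\<lambda>p. g' n (snd p - fst p) * (w (snd p) * w (fst p)))"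
    proof (rule Bochner_Integration.integrable_bound[OF Bochner_Integration.integrable_add[OF integrable_norm[OF i1] integrable_norm[OF i2]]])
      show "AE p in ?M. norm (g' n (snd p - fst p) * (w (snd p) * w (fst p)))
        \<le> norm (norm (g' n (snd p - fst p) * (w (fst p))\<^sup>2) + norm (g' n (snd p - fst p) * (w (snd p))\<^sup>2))"
      proof (rule AE_I2)
        fix p
        have "\<bar>g' n (snd p - fst p)\<bar> * \<bar>w (snd p) * w (fst p)\<bar>
            \<le> \<bar>g' n (snd p - fst p)\<bar> * ((w (snd p))\<^sup>2 + (w (fst p))\<^sup>2)"
          by (intro mult_left_mono abs_mult_le_sum_squares) auto
        then show "norm (g' n (snd p - fst p) * (w (snd p) * w (fst p)))
            \<le> norm (norm (g' n (snd p - fst p) * (w (fst p))\<^sup>2) + norm (g' n (snd p - fst p) * (w (snd p))\<^sup>2))"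
          by (simp add: abs_mult distrib_left)
      qed
    qed measurable
    have "(LINT p|?M. g' n (snd p - fst p) * (w (fst p))\<^sup>2) = 0"
      using integrable_convolution_fst(2)[OF int[of n] space0D(3)[OF w]] integral_lborel_odd[of "g' n"] g'_odd
      by (simp add: case_prod_unfold)
    moreover have "(LINT p|?M. g' n (snd p - fst p) * (w (snd p) * w (fst p))) = 0"
    \<comment> \<open>Exchanging x and y keeps the product w(x) w(y) and changes the sign of the odd
      kernel.\<close>
    proof -
      have swap: "(\<lambda>(x, y). g' n (snd (y, x) - fst (y, x)) * (w (snd (y, x)) * w (fst (y, x))))
         = (\<lambda>p. - (g' n (snd p - fst p) * (w (snd p) * w (fst p))))"
      proof
        fix p :: "'a \<times> 'a"
        show "(case p of (x, y) \<Rightarrow> g' n (snd (y, x) - fst (y, x)) * (w (snd (y, x)) * w (fst (y, x))))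
          = - (g' n (snd p - fst p) * (w (snd p) * w (fst p)))"
          using g'_odd[of n "snd p - fst p"] by (simp add: case_prod_unfold)
      qed
      show ?thesis
        using lborel_pair.integral_product_swap[OF borel_measurable_integrable[OF i3]] unfolding swap by simp
    qed
    moreover have "(\<lambda>p. g' n (snd p - fst p) * (w (snd p) - w (fst p)) * w (fst p))
      = (\<lambda>p. g' n (snd p - fst p) * (w (snd p) * w (fst p)) - g' n (snd p - fst p) * (w (fst p))\<^sup>2)"
      by (auto simp: fun_eq_iff power2_eq_square algebra_simps)
    ultimately show ?thesis using i1 i3 by simp
  qed
  have int0: "integrable ?M (\<lambda>p. g (snd p - fst p) * K (snd p - fst p) * (w (snd p) - w (fst p)) * w (fst p))"
    using integrable_conv0[OF \<theta> bound w w] by (simp add: case_prod_unfold)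
  \<comment> \<open>With the difference w(y) - w(x) left unsplit, the full integrand is integrable
    and dominates all truncations.\<close>
  have "(\<lambda>n. LINT p|?M. g' n (snd p - fst p) * (w (snd p) - w (fst p)) * w (fst p))
     \<longlonglongrightarrow> (LINT p|?M. g (snd p - fst p) * K (snd p - fst p) * (w (snd p) - w (fst p)) * w (fst p))"
  proof (rule integral_dominated_convergence[OF _ _ integrable_norm[OF int0]])
    show "AE p in ?M. (\<lambda>n. g' n (snd p - fst p) * (w (snd p) - w (fst p)) * w (fst p))
      \<longlonglongrightarrow> g (snd p - fst p) * K (snd p - fst p) * (w (snd p) - w (fst p)) * w (fst p)"
    proof (intro AE_I2 tendsto_intros)
      fix p :: "'a \<times> 'a"
      let ?s = "snd p - fst p"
      show "(\<lambda>n. g' n ?s) \<longlonglongrightarrow> g ?s * K ?s"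
      \<comment> \<open>At the origin every truncation is 0, and the bound on g forces g(0) = 0
        too.\<close>
      proof (cases "?s = 0")
        case True
        then show ?thesis using bound[of 0] by (simp add: g'_def)
      next
        case False
        then obtain n0 where n0: "inverse (real (Suc n0)) < norm ?s"
          using reals_Archimedean[of "norm ?s"] by auto
        have "eventually (\<lambda>n. g' n ?s = g ?s * K ?s) sequentially"
          using eventually_ge_at_top[of n0]
        proof eventually_elim
          case (elim n)
          have "1 / real (Suc n) \<le> 1 / real (Suc n0)" using elim by (intro divide_left_mono) auto
          then show ?case using n0 by (simp add: g'_def inverse_eq_divide)
        qed
        then show ?thesis by (rule tendsto_eventually)
      qed
    qed
    show "AE p in ?M. norm (g' n (snd p - fst p) * (w (snd p) - w (fst p)) * w (fst p))
      \<le> norm (g (snd p - fst p) * K (snd p - fst p) * (w (snd p) - w (fst p)) * w (fst p))" for n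
      by (rule AE_I2) (simp add: g'_def)
  qed measurable
  then show ?thesis by (simp add: zero conv0_def case_prod_unfold LIMSEQ_const_iff)
qed

end

section \<open>Integrability of the convection kernel\<close>

lemma nn_integral_lborel_transform:
  fixes f :: "'a::euclidean_space \<Rightarrow> ennreal"
  assumes "distr lborel borel T = lborel" and [measurable]: "T \<in> borel_measurable borel" "f \<in> borel_measurable borel"
  shows "(\<integral>\<^sup>+s. f (T s) \<partial>lborel) = (\<integral>\<^sup>+s. f s \<partial>lborel)"
proof -
  have "(\<integral>\<^sup>+s. f s \<partial>lborel) = (\<integral>\<^sup>+s. f s \<partial>distr lborel borel T)" by (simp only: assms(1))
  also have "\<dots> = (\<integral>\<^sup>+s. f (T s) \<partial>lborel)" by (rule nn_integral_distr) auto
  finally show ?thesis by simp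
qed

lemma distr_lborel_reflect:
  fixes i :: "'a::euclidean_space"
  assumes i: "i \<in> Basis"
  shows "distr lborel borel (\<lambda>s. s - (2 * (s \<bullet> i)) *\<^sub>R i) = lborel"
proof -
  define c :: "'a \<Rightarrow> real" where "c j = (if j = i then -1 else 1)" for j
  have T: "(\<lambda>s. 0 + (\<Sum>j\<in>Basis. (c j * (s \<bullet> j)) *\<^sub>R j)) = (\<lambda>s. s - (2 * (s \<bullet> i)) *\<^sub>R i)"
  proof (rule ext, rule euclidean_eqI)
    fix s b :: 'a assume b: "b \<in> Basis"
    show "(0 + (\<Sum>j\<in>Basis. (c j * (s \<bullet> j)) *\<^sub>R j)) \<bullet> b = (s - (2 * (s \<bullet> i)) *\<^sub>R i) \<bullet> b"
      unfolding add_0_left inner_sum_left_Basis[OF b] inner_diff_left inner_scaleR_left inner_Basis[OF i b]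
      by (simp add: c_def)
  qed
  have "lborel = density (distr lborel borel (\<lambda>s. s - (2 * (s \<bullet> i)) *\<^sub>R i)) (\<lambda>_. (\<Prod>j\<in>Basis. \<bar>c j\<bar>))"
    unfolding T[symmetric] by (rule lborel_affine_euclidean) (simp add: c_def)
  also have "(\<Prod>j\<in>Basis. \<bar>c j\<bar>) = 1" by (rule prod.neutral) (simp add: c_def)
  finally show ?thesis by (simp only: ennreal_1 density_1)
qed

lemma distr_lborel_swap:
  fixes i j :: "'a::euclidean_space"
  assumes i: "i \<in> Basis" and j: "j \<in> Basis"
  obtains T :: "'a \<Rightarrow> 'a" where "T \<in> borel_measurable borel" "distr lborel borel T = lborel"
    "\<And>s. norm (T s) = norm s" "\<And>s. T s \<bullet> i = s \<bullet> j"
proof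
  \<comment> \<open>The transposition of two basis vectors. Being an involution, it pulls a box back
    to the box with permuted corners.\<close>
  define q where "q m = (if m = i then j else if m = j then i else m)" for m
  have q: "q m \<in> Basis" if "m \<in> Basis" for m using that i j by (simp add: q_def)
  have qq: "q (q m) = m" for m by (simp add: q_def)
  have bij: "bij_betw q Basis Basis"
    by (rule bij_betw_byWitness[where f' = q]) (use q qq in auto)
  define T :: "'a \<Rightarrow> 'a" where "T s = (\<Sum>m\<in>Basis. (s \<bullet> q m) *\<^sub>R m)" for s
  have T: "T s \<bullet> m = s \<bullet> q m" if "m \<in> Basis" for s m
    using that by (simp add: T_def)
  show T_meas: "T \<in> borel_measurable borel" unfolding T_def by measurable
  show "T s \<bullet> i = s \<bullet> j" for s using T[OF i] by (simp add: q_def)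
  show "norm (T s) = norm s" for s
  proof -
    have "(\<Sum>m\<in>Basis. (s \<bullet> q m)\<^sup>2) = (\<Sum>m\<in>Basis. (s \<bullet> m)\<^sup>2)"
      by (rule sum.reindex_bij_betw[OF bij])
    then show ?thesis
      by (simp add: norm_eq_sqrt_inner euclidean_inner[of s s] euclidean_inner[of "T s" "T s"] T power2_eq_square)
  qed
  have "lborel = distr lborel borel T"
  proof (rule lborel_eqI)
    fix l u :: 'a assume lu: "\<And>b. b \<in> Basis \<Longrightarrow> l \<bullet> b \<le> u \<bullet> b"
    have "T -` box l u = box (T l) (T u)"
    proof (intro set_eqI iffI)
      fix s assume s: "s \<in> T -` box l u"
      show "s \<in> box (T l) (T u)"
        unfolding mem_box
      proof
        fix m :: 'a assume m: "m \<in> Basis"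
        have "l \<bullet> q m < T s \<bullet> q m \<and> T s \<bullet> q m < u \<bullet> q m" using s q[OF m] by (auto simp: mem_box)
        then show "T l \<bullet> m < s \<bullet> m \<and> s \<bullet> m < T u \<bullet> m" using m q[OF m] by (simp add: T qq)
      qed
    next
      fix s assume s: "s \<in> box (T l) (T u)"
      have "l \<bullet> m < T s \<bullet> m \<and> T s \<bullet> m < u \<bullet> m" if m: "m \<in> Basis" for m
      proof -
        have "T l \<bullet> q m < s \<bullet> q m \<and> s \<bullet> q m < T u \<bullet> q m" using s q[OF m] by (auto simp: mem_box)
        then show ?thesis using m q[OF m] by (simp add: T qq)
      qed
      then show "s \<in> T -` box l u" by (simp add: mem_box)
    qed
    then have "emeasure (distr lborel borel T) (box l u) = emeasure lborel (box (T l) (T u))"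
      using T_meas by (simp add: emeasure_distr)
    also have "\<dots> = ennreal (\<Prod>m\<in>Basis. (T u - T l) \<bullet> m)"
      using lu q by (subst emeasure_lborel_box) (auto simp: T)
    also have "(\<Prod>m\<in>Basis. (T u - T l) \<bullet> m) = (\<Prod>m\<in>Basis. (u - l) \<bullet> q m)"
      by (rule prod.cong) (auto simp: inner_diff_left T)
    also have "\<dots> = (\<Prod>m\<in>Basis. (u - l) \<bullet> m)" by (rule prod.reindex_bij_betw[OF bij])
    finally show "emeasure (distr lborel borel T) (box l u) = ennreal (prod ((\<bullet>) (u - l)) Basis)" .
  qed simp
  then show "distr lborel borel T = lborel" by simp
qed

text \<open>Only the symmetries of the cube are used, which costs the factor \<open>d\<^sup>2\<close>.\<close>

lemma nn_integral_radial_cosine: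
  fixes \<phi> :: "real \<Rightarrow> ennreal" and v :: "'a::euclidean_space"
  assumes [measurable]: "(\<lambda>s::'a. \<phi> (norm s)) \<in> borel_measurable borel"
  shows "ennreal (norm v) * (\<integral>\<^sup>+s. \<phi> (norm s) \<partial>(lborel :: 'a measure))
    \<le> ennreal (2 * (real DIM('a))\<^sup>2) * (\<integral>\<^sup>+s. \<phi> (norm s) * ennreal (max 0 (- (v \<bullet> sgn s))) \<partial>(lborel :: 'a measure))"
proof -
  define A where "A = (\<integral>\<^sup>+s. \<phi> (norm s) * ennreal \<bar>v \<bullet> sgn s\<bar> \<partial>(lborel :: 'a measure))"
  define J where "J i = (\<integral>\<^sup>+s. \<phi> (norm s) * ennreal \<bar>i \<bullet> sgn s\<bar> \<partial>(lborel :: 'a measure))" for i :: 'a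
  obtain e :: 'a where e: "e \<in> Basis" using SOME_Basis by blast
  \<comment> \<open>Exchanging two coordinates preserves the radial weight, so the mean cosine is
    the same for all basis vectors.\<close>
  have J_eq: "J i = J e" if i: "i \<in> Basis" for i
  proof -
    obtain T :: "'a \<Rightarrow> 'a" where T [measurable]: "T \<in> borel_measurable borel" and T': "distr lborel borel T = lborel"
      "\<And>s. norm (T s) = norm s" "\<And>s. T s \<bullet> i = s \<bullet> e"
      using distr_lborel_swap[OF i e] by blast
    have "J i = (\<integral>\<^sup>+s. \<phi> (norm (T s)) * ennreal \<bar>i \<bullet> sgn (T s)\<bar> \<partial>lborel)"
      unfolding J_def by (rule nn_integral_lborel_transform[OF T'(1) T, symmetric]) measurable
    also have "\<dots> = J e" unfolding J_def by (simp add: T' sgn_div_norm inner_commute[of i] inner_commute[of e])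
    finally show ?thesis .
  qed
  have total: "(\<integral>\<^sup>+s. \<phi> (norm s) \<partial>(lborel :: 'a measure)) \<le> ennreal (real DIM('a)) * J e"
  proof -
    have "(\<integral>\<^sup>+s. \<phi> (norm s) \<partial>(lborel :: 'a measure)) \<le> (\<integral>\<^sup>+s. (\<Sum>i\<in>Basis. \<phi> (norm s) * ennreal \<bar>i \<bullet> sgn s\<bar>) \<partial>(lborel :: 'a measure))"
    proof (rule nn_integral_mono_AE)
      have "AE s::'a in lborel. s \<noteq> 0" by (rule AE_lborel_singleton)
      then show "AE s::'a in lborel. \<phi> (norm s) \<le> (\<Sum>i\<in>Basis. \<phi> (norm s) * ennreal \<bar>i \<bullet> sgn s\<bar>)"
      proof eventually_elim
        case (elim s)
        have "1 = norm (sgn s)" using elim by (simp add: norm_sgn)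
        also have "\<dots> \<le> (\<Sum>i\<in>Basis. \<bar>i \<bullet> sgn s\<bar>)" using norm_le_l1[of "sgn s"] by (simp add: inner_commute)
        finally have "\<phi> (norm s) * 1 \<le> \<phi> (norm s) * ennreal (\<Sum>i\<in>Basis. \<bar>i \<bullet> sgn s\<bar>)"
          by (intro mult_left_mono) (auto simp flip: ennreal_1 intro: ennreal_leI)
        also have "\<dots> = (\<Sum>i\<in>Basis. \<phi> (norm s) * ennreal \<bar>i \<bullet> sgn s\<bar>)"
          by (simp add: sum_distrib_left[symmetric])
        finally show ?case by simp
      qed
    qed
    also have "\<dots> = (\<Sum>i\<in>(Basis :: 'a set). J i)" unfolding J_def by (rule nn_integral_sum) measurable
    also have "\<dots> = (\<Sum>i\<in>(Basis :: 'a set). J e)" by (intro sum.cong J_eq refl)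
    also have "\<dots> = ennreal (real DIM('a)) * J e" by (simp add: ennreal_of_nat_eq_real_of_nat)
    finally show ?thesis .
  qed
  \<comment> \<open>Reflecting the i-th coordinate changes the cosine with v by twice the product of
    \<open>v \<bullet> i\<close> and the i-th component of \<open>sgn s\<close>; the two cosines
    together dominate this difference, and both have the same average A.\<close>
  have coord: "ennreal \<bar>v \<bullet> i\<bar> * J i \<le> A" if i: "i \<in> Basis" for i
  proof -
    let ?T = "\<lambda>s. s - (2 * (s \<bullet> i)) *\<^sub>R i"
    have nT: "norm (?T s) = norm s" for s
      using i by (simp add: norm_eq_sqrt_inner inner_diff_left inner_diff_right inner_commute[of i s])
    have sT: "v \<bullet> sgn (?T s) = v \<bullet> sgn s - 2 * (i \<bullet> sgn s) * (v \<bullet> i)" for s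
      unfolding sgn_div_norm nT by (simp add: inner_diff_right inner_commute[of i s] algebra_simps)
    have AT: "A = (\<integral>\<^sup>+s. \<phi> (norm s) * ennreal \<bar>v \<bullet> sgn (?T s)\<bar> \<partial>lborel)"
      unfolding A_def
      using nn_integral_lborel_transform[OF distr_lborel_reflect[OF i], of "\<lambda>s. \<phi> (norm s) * ennreal \<bar>v \<bullet> sgn s\<bar>"]
      unfolding nT by simp
    have "ennreal 2 * (ennreal \<bar>v \<bullet> i\<bar> * J i)
       = (\<integral>\<^sup>+s. \<phi> (norm s) * ennreal (2 * \<bar>i \<bullet> sgn s\<bar> * \<bar>v \<bullet> i\<bar>) \<partial>lborel)"
      unfolding J_def by (simp add: nn_integral_cmult[symmetric] ennreal_mult mult_ac del: ennreal_numeral)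
    also have "\<dots> \<le> (\<integral>\<^sup>+s. \<phi> (norm s) * ennreal \<bar>v \<bullet> sgn s\<bar> + \<phi> (norm s) * ennreal \<bar>v \<bullet> sgn (?T s)\<bar> \<partial>lborel)"
    proof (rule nn_integral_mono)
      fix s
      have "2 * \<bar>i \<bullet> sgn s\<bar> * \<bar>v \<bullet> i\<bar> = \<bar>2 * (i \<bullet> sgn s) * (v \<bullet> i)\<bar>" by (simp add: abs_mult)
      also have "\<dots> \<le> \<bar>v \<bullet> sgn s\<bar> + \<bar>v \<bullet> sgn (?T s)\<bar>" unfolding sT by arith
      finally have "\<phi> (norm s) * ennreal (2 * \<bar>i \<bullet> sgn s\<bar> * \<bar>v \<bullet> i\<bar>) \<le> \<phi> (norm s) * ennreal (\<bar>v \<bullet> sgn s\<bar> + \<bar>v \<bullet> sgn (?T s)\<bar>)"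
        by (intro mult_left_mono ennreal_leI) auto
      then show "\<phi> (norm s) * ennreal (2 * \<bar>i \<bullet> sgn s\<bar> * \<bar>v \<bullet> i\<bar>) \<le> \<phi> (norm s) * ennreal \<bar>v \<bullet> sgn s\<bar> + \<phi> (norm s) * ennreal \<bar>v \<bullet> sgn (?T s)\<bar>"
        by (simp add: distrib_left)
    qed
    also have "\<dots> = A + A"
      by (subst nn_integral_add) (auto simp: A_def[symmetric] AT[symmetric])
    also have "\<dots> = ennreal 2 * A" by (simp add: mult_2)
    finally show ?thesis by (subst (asm) ennreal_mult_le_mult_iff) auto
  qed
  have "ennreal (norm v) * J e \<le> ennreal (\<Sum>i\<in>Basis. \<bar>v \<bullet> i\<bar>) * J e"
    by (intro mult_right_mono ennreal_leI norm_le_l1) simp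
  also have "\<dots> = (\<Sum>i\<in>Basis. ennreal \<bar>v \<bullet> i\<bar> * J i)"
    by (simp add: sum_distrib_right[symmetric] J_eq)
  also have "\<dots> \<le> (\<Sum>i\<in>(Basis :: 'a set). A)" by (intro sum_mono coord)
  also have "\<dots> = ennreal (real DIM('a)) * A" by (simp add: ennreal_of_nat_eq_real_of_nat)
  finally have vJ: "ennreal (norm v) * J e \<le> ennreal (real DIM('a)) * A" .
  define B where "B = (\<integral>\<^sup>+s. \<phi> (norm s) * ennreal (max 0 (- (v \<bullet> sgn s))) \<partial>(lborel :: 'a measure))"
  \<comment> \<open>By reflection at the origin the negative part carries half of A. This is the 2
    in the constant; one factor d comes from comparing the total mass with \<open>J e\<close>, the
    other from summing \<open>coord\<close> over the basis.\<close>
  have B': "B = (\<integral>\<^sup>+s. \<phi> (norm s) * ennreal (max 0 (v \<bullet> sgn s)) \<partial>(lborel :: 'a measure))"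
    unfolding B_def
    using nn_integral_lborel_uminus[of "\<lambda>s::'a. \<phi> (norm s) * ennreal (max 0 (v \<bullet> sgn s))"]
    by (simp add: sgn_minus)
  have "A = (\<integral>\<^sup>+s. \<phi> (norm s) * ennreal (max 0 (- (v \<bullet> sgn s))) + \<phi> (norm s) * ennreal (max 0 (v \<bullet> sgn s)) \<partial>(lborel :: 'a measure))"
    unfolding A_def
  proof (rule nn_integral_cong)
    fix s :: 'a
    have "ennreal \<bar>v \<bullet> sgn s\<bar> = ennreal (max 0 (- (v \<bullet> sgn s))) + ennreal (max 0 (v \<bullet> sgn s))"
      by (subst ennreal_plus[symmetric]) (auto simp: max_def abs_if)
    then show "\<phi> (norm s) * ennreal \<bar>v \<bullet> sgn s\<bar> = \<phi> (norm s) * ennreal (max 0 (- (v \<bullet> sgn s))) + \<phi> (norm s) * ennreal (max 0 (v \<bullet> sgn s))"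
      by (simp add: distrib_left)
  qed
  also have "\<dots> = B + B" by (subst nn_integral_add) (auto simp: B_def[symmetric] B'[symmetric])
  finally have AB: "A = ennreal 2 * B" by (simp add: mult_2)
  have "ennreal (norm v) * (\<integral>\<^sup>+s. \<phi> (norm s) \<partial>(lborel :: 'a measure)) \<le> ennreal (norm v) * (ennreal (real DIM('a)) * J e)"
    by (intro mult_left_mono total) simp
  also have "\<dots> = ennreal (real DIM('a)) * (ennreal (norm v) * J e)" by (simp only: mult_ac)
  also have "\<dots> \<le> ennreal (real DIM('a)) * (ennreal (real DIM('a)) * (ennreal 2 * B))"
    unfolding AB[symmetric] by (intro mult_left_mono vJ) simp
  also have "\<dots> = ennreal (2 * (real DIM('a))\<^sup>2) * B"
    by (simp add: ennreal_mult power2_eq_square mult_ac del: ennreal_numeral)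
  finally show ?thesis unfolding B_def .
qed

text \<open>Here p, q, r stand for the components along s of b at x, x + s and x + 2 s, and the
  three differences belong to the pairs of these points. If q \<le> 0, the first difference is
  already the left side. If q > 0, the third is max 0 r, and together with the second it is at least
  the left side.\<close>

lemma three_point:
  fixes p q r :: real
  shows "max 0 (- p) \<le> \<bar>max 0 q - max 0 (- p)\<bar> + \<bar>max 0 r - max 0 (- p)\<bar> + \<bar>max 0 r - max 0 (- q)\<bar>"
  by (auto simp: max_def abs_if)

text \<open>If \<open>k\<close> were not integrable, the integrand could only be integrable through cancellation between
  \<open>b x\<close> and \<open>b y\<close>. But the differences along three equidistant collinear points control \<open>b x\<close>
  itself, and the cosine average of a radial kernel controls its total mass.\<close>

lemma integrable_kernel_of_divergence:
  fixes k :: "'a::euclidean_space \<Rightarrow> real" and b :: "'a \<Rightarrow> 'a"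
  assumes k_meas [measurable]: "k \<in> borel_measurable borel" and k_nonneg: "\<And>s. 0 \<le> k s"
    and radial: "\<And>s. k s = \<phi> (norm s)"
    and doubling: "\<And>s. s \<noteq> 0 \<Longrightarrow> k (2 *\<^sub>R s) \<le> 2 * k s"
    and moment: "integrable lborel (\<lambda>s. k s * norm s)"
    and b_meas [measurable]: "b \<in> borel_measurable borel"
    and b_bound: "AE x in lborel. norm (b x) \<le> C" and b_nz: "\<And>x. b x \<noteq> 0"
    and div: "AE x in lborel. integrable lborel
       (\<lambda>y. k (y - x) * (max 0 (b y \<bullet> sgn (y - x)) - max 0 (- (b x \<bullet> sgn (y - x)))))"
  shows "integrable lborel k"
proof -
  \<comment> \<open>The absolute divergence integrand in terms of the displacement s.\<close>
  define g where "g x s = ennreal (k s * \<bar>max 0 (b (s + x) \<bullet> sgn s) - max 0 (- (b x \<bullet> sgn s))\<bar>)" for x s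
  have g_meas [measurable]: "(\<lambda>p. g (fst p) (snd p)) \<in> borel_measurable (lborel \<Otimes>\<^sub>M lborel)"
    unfolding g_def by measurable
  define I where "I x = (\<integral>\<^sup>+s. g x s \<partial>lborel)" for x
  have I_meas [measurable]: "I \<in> borel_measurable borel"
    using lborel.borel_measurable_nn_integral_fst[OF g_meas] by (simp add: I_def[abs_def])
  have I_fin: "AE x in lborel. I x < \<infinity>"
    using div
  proof eventually_elim
    case (elim x)
    have "(\<integral>\<^sup>+y. ennreal (k (y - x) * \<bar>max 0 (b y \<bullet> sgn (y - x)) - max 0 (- (b x \<bullet> sgn (y - x)))\<bar>) \<partial>lborel) < \<infinity>"
      using elim k_nonneg by (simp add: integrable_iff_bounded abs_mult)
    also have "(\<integral>\<^sup>+y. ennreal (k (y - x) * \<bar>max 0 (b y \<bullet> sgn (y - x)) - max 0 (- (b x \<bullet> sgn (y - x)))\<bar>) \<partial>lborel) = I x"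
      unfolding I_def g_def
      using nn_integral_lborel_shift[of "\<lambda>y. ennreal (k (y - x) * \<bar>max 0 (b y \<bullet> sgn (y - x)) - max 0 (- (b x \<bullet> sgn (y - x)))\<bar>)" x]
      by (simp add: add.commute)
    finally show ?case .
  qed
  \<comment> \<open>For x in \<open>B1\<close> and |s| \<le> 1 the points x and x + s lie in
    \<open>B2\<close>. The third point x + 2 s occurs only as the far end of a pair, so no condition
    is put on it.\<close>
  define B1 B2 :: "'a set" where "B1 = ball 0 1" and "B2 = ball 0 2"
  have [measurable]: "B1 \<in> sets borel" "B2 \<in> sets borel" by (auto simp: B1_def B2_def)
  \<comment> \<open>I is finite almost everywhere, but neither bounded nor known to be integrable.
    It is used only where it is at most j; the remaining part of \<open>B2\<close> gets small
    measure as j grows and is handled by the bound on b.\<close>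
  define bad where "bad j = {x \<in> B2. \<not> I x \<le> of_nat j}" for j :: nat
  have [measurable]: "bad j \<in> sets borel" for j unfolding bad_def by measurable
  define c where "c = 2 * (real DIM('a))\<^sup>2"
  have "c > 0" by (simp add: c_def)
  define C' where "C' = max C 1"
  \<comment> \<open>Positive because b vanishes nowhere; it weighs the kernel mass in the lower
    estimate.\<close>
  define \<beta> where "\<beta> = (\<integral>\<^sup>+x. indicator B1 x * ennreal (norm (b x)) \<partial>lborel)"
  have "\<beta> \<noteq> 0"
  proof
    assume "\<beta> = 0"
    then have "AE x in lborel. indicator B1 x * ennreal (norm (b x)) = 0"
      unfolding \<beta>_def by (subst (asm) nn_integral_0_iff_AE) auto
    then have "AE x in lborel. x \<notin> B1"
      by eventually_elim (use b_nz in \<open>auto simp: indicator_def split: if_splits\<close>)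
    then have "emeasure lborel B1 = 0"
      by (subst (asm) AE_iff_measurable[of B1]) auto
    then show False using unit_ball_vol_pos[of "real DIM('a)"] by (simp add: B1_def emeasure_ball)
  qed
  have "\<beta> \<le> (\<integral>\<^sup>+x. ennreal C' * indicator B1 x \<partial>lborel)"
    unfolding \<beta>_def
  proof (rule nn_integral_mono_AE)
    show "AE x in lborel. indicator B1 x * ennreal (norm (b x)) \<le> ennreal C' * indicator B1 x"
      using b_bound by eventually_elim (auto simp: indicator_def C'_def intro!: ennreal_leI)
  qed
  also have "\<dots> < \<infinity>"
    using emeasure_lborel_ball_finite[of "0::'a" 1]
    by (subst nn_integral_cmult_indicator) (auto simp: B1_def ennreal_mult_less_top)
  finally obtain \<beta>' where \<beta>': "\<beta> = ennreal \<beta>'" "\<beta>' > 0"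
    using \<open>\<beta> \<noteq> 0\<close> by (cases \<beta>) (auto simp: less_le)
  have "(\<lambda>j. emeasure lborel (bad j)) \<longlonglongrightarrow> emeasure lborel (\<Inter>j. bad j)"
  proof (rule Lim_emeasure_decseq)
    show "decseq bad"
    proof (rule decseq_SucI)
      show "bad (Suc j) \<subseteq> bad j" for j
        unfolding bad_def by (auto intro: order_trans[of _ "of_nat j"])
    qed
    show "emeasure lborel (bad j) \<noteq> \<infinity>" for j
    proof -
      have "emeasure lborel (bad j) \<le> emeasure lborel B2" by (rule emeasure_mono) (auto simp: bad_def)
      also have "\<dots> < \<infinity>" unfolding B2_def by (rule emeasure_lborel_ball_finite)
      finally show ?thesis by simp
    qed
  qed auto
  moreover have "emeasure lborel (\<Inter>j. bad j) = 0"
  proof (subst AE_iff_measurable[symmetric, where P = "\<lambda>x. x \<notin> (\<Inter>j. bad j)"])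
    show "AE x in lborel. x \<notin> (\<Inter>j. bad j)"
      using I_fin
    proof eventually_elim
      case (elim x)
      then obtain r where r: "I x = ennreal r" by (cases "I x") auto
      obtain j :: nat where "r < real j" using reals_Archimedean2 by blast
      then have "x \<notin> bad j" by (simp add: bad_def r ennreal_of_nat_eq_real_of_nat ennreal_leI)
      then show ?case by blast
    qed
  qed auto
  ultimately have bad_lim: "(\<lambda>j. emeasure lborel (bad j)) \<longlonglongrightarrow> 0" by simp
  \<comment> \<open>Chosen so that c * 2 C' \<mu> = \<beta>'/2: the contribution of the bad points
    is then half of the lower estimate and can be absorbed.\<close>
  define \<mu> where "\<mu> = \<beta>' / (4 * C' * c)"
  have "\<mu> > 0" using \<beta>' \<open>c > 0\<close> by (simp add: \<mu>_def C'_def)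
  then have "eventually (\<lambda>j. emeasure lborel (bad j) < ennreal \<mu>) sequentially"
    by (intro order_tendstoD[OF bad_lim]) simp
  then obtain j where j: "emeasure lborel (bad j) < ennreal \<mu>"
    by (auto simp: eventually_sequentially)
  define M where "M = {x \<in> B2. I x \<le> of_nat j}"
  have M_meas [measurable]: "M \<in> sets borel" unfolding M_def by measurable
  obtain V where V: "emeasure lborel B2 = ennreal V" "V > 0"
    by (rule that[of "unit_ball_vol (real DIM('a)) * 2 ^ DIM('a)"]) (simp_all add: B2_def emeasure_ball)
  have IM: "(\<integral>\<^sup>+x. indicator M x * I x \<partial>lborel) \<le> ennreal (real j * V)"
  proof -
    have "(\<integral>\<^sup>+x. indicator M x * I x \<partial>lborel) \<le> (\<integral>\<^sup>+x. of_nat j * indicator B2 x \<partial>lborel)"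
      by (rule nn_integral_mono) (auto simp: M_def indicator_def)
    also have "\<dots> = of_nat j * ennreal V" using V by (simp add: nn_integral_cmult)
    finally show ?thesis by (simp add: ennreal_mult' ennreal_of_nat_eq_real_of_nat)
  qed
  \<comment> \<open>One weight for all three pairs: it lies below k(2 s), for the pair at distance 2
    |s|, and below 2 k(s), for the two pairs at distance |s|. The truncation near 0 makes its mass
    finite, which the absorption needs.\<close>
  define h where "h n s = (if 1 / real (Suc n) \<le> norm s \<and> norm s \<le> 1 then k (2 *\<^sub>R s) else 0)" for n s
  have h_meas [measurable]: "h n \<in> borel_measurable borel" for n unfolding h_def by measurable
  have h_nonneg: "0 \<le> h n s" for n s by (simp add: h_def k_nonneg)
  have h_le: "h n s \<le> k (2 *\<^sub>R s)" "h n s \<le> 2 * k s" for n s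
    using doubling[of s] k_nonneg[of "2 *\<^sub>R s"] k_nonneg[of s]
    by (cases "s = 0"; auto simp: h_def)+
  define \<kappa> where "\<kappa> n = (\<integral>\<^sup>+s. ennreal (h n s) \<partial>lborel)" for n
  have \<kappa>_fin: "\<kappa> n < \<infinity>" for n
  proof -
    have "\<kappa> n \<le> (\<integral>\<^sup>+s. ennreal (2 * real (Suc n) * (k s * norm s)) \<partial>lborel)"
      unfolding \<kappa>_def
    proof (intro nn_integral_mono ennreal_leI)
      fix s
      show "h n s \<le> 2 * real (Suc n) * (k s * norm s)"
      proof (cases "1 / real (Suc n) \<le> norm s")
        case True
        have "2 * k s * 1 \<le> 2 * k s * (real (Suc n) * norm s)"
          using True k_nonneg[of s] by (intro mult_left_mono) (auto simp: field_simps)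
        then show ?thesis using h_le(2)[of n s] by (simp add: mult_ac)
      qed (simp add: h_def k_nonneg)
    qed
    also have "\<dots> = ennreal (LINT s|lborel. 2 * real (Suc n) * (k s * norm s))"
      using moment k_nonneg by (intro nn_integral_eq_integral integrable_mult_right) auto
    also have "\<dots> < \<infinity>" by simp
    finally show ?thesis .
  qed
  define \<Lambda> where "\<Lambda> n = (\<integral>\<^sup>+x. \<integral>\<^sup>+s. indicator B1 x * (ennreal (h n s) * ennreal (max 0 (- (b x \<bullet> sgn s)))) \<partial>lborel \<partial>lborel)" for n
  \<comment> \<open>The cosine average applied at each x to the radial weight
    \<open>h n\<close>.\<close>
  have lower: "\<beta> * \<kappa> n \<le> ennreal c * \<Lambda> n" for n
  proof -
    have hr: "ennreal (h n s) = ennreal (if 1 / real (Suc n) \<le> norm s \<and> norm s \<le> 1 then \<phi> (2 * norm s) else 0)" for s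
      by (simp add: h_def radial)
    have "\<beta> * \<kappa> n = (\<integral>\<^sup>+x. indicator B1 x * (ennreal (norm (b x)) * \<kappa> n) \<partial>lborel)"
      unfolding \<beta>_def by (simp add: nn_integral_multc[symmetric] mult.assoc)
    also have "\<dots> \<le> (\<integral>\<^sup>+x. indicator B1 x * (ennreal c * (\<integral>\<^sup>+s. ennreal (h n s) * ennreal (max 0 (- (b x \<bullet> sgn s))) \<partial>lborel)) \<partial>lborel)"
    proof (intro nn_integral_mono mult_left_mono)
      fix x
      have "(\<lambda>s. ennreal (h n s)) \<in> borel_measurable borel" by measurable
      then show "ennreal (norm (b x)) * \<kappa> n \<le> ennreal c * (\<integral>\<^sup>+s. ennreal (h n s) * ennreal (max 0 (- (b x \<bullet> sgn s))) \<partial>lborel)"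
        unfolding \<kappa>_def c_def hr
        by (rule nn_integral_radial_cosine[where \<phi> = "\<lambda>r. ennreal (if 1 / real (Suc n) \<le> r \<and> r \<le> 1 then \<phi> (2 * r) else 0)"])
    qed simp
    also have "\<dots> = (\<integral>\<^sup>+x. ennreal c * (\<integral>\<^sup>+s. indicator B1 x * (ennreal (h n s) * ennreal (max 0 (- (b x \<bullet> sgn s)))) \<partial>lborel) \<partial>lborel)"
      by (subst nn_integral_cmult) (auto simp: mult_ac)
    also have "\<dots> = ennreal c * \<Lambda> n" unfolding \<Lambda>_def by (rule nn_integral_cmult) measurable
    finally show ?thesis .
  qed
  have upper: "\<Lambda> n \<le> ennreal (5 * (real j * V)) + ennreal (2 * C' * \<mu>) * \<kappa> n" for n
  proof -
    \<comment> \<open>The first three terms are the pairs of \<open>three_point\<close>, used when x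
      and x + s are good; the last two are the crude bound by C', used when x or x + s is
      bad.\<close>
    let ?F1 = "\<lambda>x s. 2 * (indicator M x * g x s)"
    let ?F2 = "\<lambda>x s. indicator M x * g x (2 *\<^sub>R s)"
    let ?F3 = "\<lambda>x s. 2 * (indicator M (s + x) * g (s + x) s)"
    let ?F4 = "\<lambda>x s. ennreal C' * (ennreal (h n s) * indicator (bad j) x)"
    let ?F5 = "\<lambda>x s. ennreal C' * (ennreal (h n s) * indicator (bad j) (s + x))"
    have pt: "indicator B1 x * (ennreal (h n s) * ennreal (max 0 (- (b x \<bullet> sgn s))))
       \<le> ?F1 x s + ?F2 x s + ?F3 x s + ?F4 x s + ?F5 x s" if bx: "norm (b x) \<le> C" for x s
    proof (cases "x \<in> B1 \<and> h n s \<noteq> 0")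
      case False
      then show ?thesis by auto
    next
      case True
      then have x: "norm x < 1" and s: "norm s \<le> 1" by (auto simp: B1_def h_def split: if_splits)
      have mem: "x \<in> B2" "s + x \<in> B2"
        using x s norm_triangle_ineq[of s x] by (auto simp: B2_def)
      let ?p = "b x \<bullet> sgn s" and ?q = "b (s + x) \<bullet> sgn s" and ?r = "b (s + (s + x)) \<bullet> sgn s"
      show ?thesis
      proof (cases "x \<in> M \<and> s + x \<in> M")
        case True
        have sg: "sgn (2 *\<^sub>R s) = sgn s" by (simp add: sgn_scaleR)
        have "h n s * max 0 (- ?p) \<le> h n s * (\<bar>max 0 ?q - max 0 (- ?p)\<bar> + \<bar>max 0 ?r - max 0 (- ?p)\<bar> + \<bar>max 0 ?r - max 0 (- ?q)\<bar>)"
          by (intro mult_left_mono three_point h_nonneg)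
        also have "\<dots> = h n s * \<bar>max 0 ?q - max 0 (- ?p)\<bar> + h n s * \<bar>max 0 ?r - max 0 (- ?p)\<bar> + h n s * \<bar>max 0 ?r - max 0 (- ?q)\<bar>"
          by (simp only: distrib_left)
        also have "\<dots> \<le> 2 * k s * \<bar>max 0 ?q - max 0 (- ?p)\<bar> + k (2 *\<^sub>R s) * \<bar>max 0 ?r - max 0 (- ?p)\<bar> + 2 * k s * \<bar>max 0 ?r - max 0 (- ?q)\<bar>"
          by (intro add_mono mult_right_mono h_le) auto
        finally have "ennreal (h n s * max 0 (- ?p)) \<le> ennreal (2 * k s * \<bar>max 0 ?q - max 0 (- ?p)\<bar> + k (2 *\<^sub>R s) * \<bar>max 0 ?r - max 0 (- ?p)\<bar> + 2 * k s * \<bar>max 0 ?r - max 0 (- ?q)\<bar>)"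
          by (rule ennreal_leI)
        also have "\<dots> = 2 * g x s + g x (2 *\<^sub>R s) + 2 * g (s + x) s"
          unfolding g_def sg using k_nonneg
          by (simp add: ennreal_plus ennreal_mult scaleR_2 add.assoc mult.assoc)
        also have "\<dots> \<le> ?F1 x s + ?F2 x s + ?F3 x s + ?F4 x s + ?F5 x s"
          using True by (auto simp: add.assoc intro: add_increasing2)
        finally show ?thesis using h_nonneg[of n s] by (auto simp: ennreal_mult indicator_def)
      next
        case False
        then have bad: "x \<in> bad j \<or> s + x \<in> bad j" using mem by (auto simp: M_def bad_def)
        have "\<bar>?p\<bar> \<le> norm (b x) * norm (sgn s)" by (rule Cauchy_Schwarz_ineq2)
        also have "\<dots> \<le> norm (b x) * 1" by (intro mult_left_mono) (auto simp: norm_sgn)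
        finally have "max 0 (- ?p) \<le> C'" using bx by (auto simp: C'_def)
        then have "ennreal (h n s) * ennreal (max 0 (- ?p)) \<le> ennreal (h n s) * ennreal C'"
          by (intro mult_left_mono ennreal_leI) auto
        also have "\<dots> \<le> ?F4 x s + ?F5 x s"
          using bad by (auto simp: mult_ac)
        also have "\<dots> \<le> ?F1 x s + ?F2 x s + ?F3 x s + ?F4 x s + ?F5 x s"
          by (simp add: add.assoc)
        finally show ?thesis by (auto simp: indicator_def)
      qed
    qed
    have [measurable]: "(\<lambda>x. g (f1 x) (f2 x)) \<in> borel_measurable N" if "f1 \<in> borel_measurable N" "f2 \<in> borel_measurable N"
      for N :: "'z measure" and f1 f2 :: "'z \<Rightarrow> 'a"
      using that unfolding g_def by measurable
    have "\<Lambda> n \<le> (\<integral>\<^sup>+x. \<integral>\<^sup>+s. ?F1 x s + ?F2 x s + ?F3 x s + ?F4 x s + ?F5 x s \<partial>lborel \<partial>lborel)"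
      unfolding \<Lambda>_def
    proof (rule nn_integral_mono_AE)
      show "AE x in lborel. (\<integral>\<^sup>+s. indicator B1 x * (ennreal (h n s) * ennreal (max 0 (- (b x \<bullet> sgn s)))) \<partial>lborel)
        \<le> (\<integral>\<^sup>+s. ?F1 x s + ?F2 x s + ?F3 x s + ?F4 x s + ?F5 x s \<partial>lborel)"
        using b_bound by eventually_elim (intro nn_integral_mono pt)
    qed
    also have "\<dots> = (\<integral>\<^sup>+x. \<integral>\<^sup>+s. ?F1 x s \<partial>lborel \<partial>lborel) + (\<integral>\<^sup>+x. \<integral>\<^sup>+s. ?F2 x s \<partial>lborel \<partial>lborel)
       + (\<integral>\<^sup>+x. \<integral>\<^sup>+s. ?F3 x s \<partial>lborel \<partial>lborel) + (\<integral>\<^sup>+x. \<integral>\<^sup>+s. ?F4 x s \<partial>lborel \<partial>lborel)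
       + (\<integral>\<^sup>+x. \<integral>\<^sup>+s. ?F5 x s \<partial>lborel \<partial>lborel)"
      by (simp add: nn_integral_add)
    also have "\<dots> \<le> 2 * ennreal (real j * V) + ennreal (real j * V) + 2 * ennreal (real j * V)
       + ennreal C' * (ennreal \<mu> * \<kappa> n) + ennreal C' * (ennreal \<mu> * \<kappa> n)"
    proof (intro add_mono)
      have F1: "(\<integral>\<^sup>+x. \<integral>\<^sup>+s. ?F1 x s \<partial>lborel \<partial>lborel) = 2 * (\<integral>\<^sup>+x. indicator M x * I x \<partial>lborel)"
        unfolding I_def by (simp add: nn_integral_cmult)
      show "(\<integral>\<^sup>+x. \<integral>\<^sup>+s. ?F1 x s \<partial>lborel \<partial>lborel) \<le> 2 * ennreal (real j * V)"
        unfolding F1 by (intro mult_left_mono IM) simp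
      have "(\<integral>\<^sup>+x. \<integral>\<^sup>+s. ?F2 x s \<partial>lborel \<partial>lborel) \<le> (\<integral>\<^sup>+x. indicator M x * I x \<partial>lborel)"
      proof (rule nn_integral_mono)
        fix x
        \<comment> \<open>Substituting 2 s for s yields a factor 2^d on the favourable side, which
          is discarded.\<close>
        have "(\<integral>\<^sup>+s. g x (2 *\<^sub>R s) \<partial>lborel) \<le> ennreal (\<bar>2\<bar> ^ DIM('a)) * (\<integral>\<^sup>+s. g x (2 *\<^sub>R s) \<partial>lborel)"
          using mult_right_mono[of 1 "ennreal (\<bar>2\<bar> ^ DIM('a))" "\<integral>\<^sup>+s. g x (2 *\<^sub>R s) \<partial>lborel"] by simp
        also have "\<dots> = I x" unfolding I_def by (rule nn_integral_lborel_scale[symmetric]) auto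
        finally show "(\<integral>\<^sup>+s. ?F2 x s \<partial>lborel) \<le> indicator M x * I x"
          by (simp add: nn_integral_cmult mult_left_mono)
      qed
      also note IM
      finally show "(\<integral>\<^sup>+x. \<integral>\<^sup>+s. ?F2 x s \<partial>lborel \<partial>lborel) \<le> ennreal (real j * V)" .
      \<comment> \<open>For fixed s the base point x + s is translated back to x, which reduces this
        term to the first one.\<close>
      have "(\<integral>\<^sup>+x. \<integral>\<^sup>+s. ?F3 x s \<partial>lborel \<partial>lborel) = (\<integral>\<^sup>+s. \<integral>\<^sup>+x. ?F3 x s \<partial>lborel \<partial>lborel)"
        by (rule lborel_pair.Fubini'[symmetric]) measurable
      also have "\<dots> = (\<integral>\<^sup>+s. \<integral>\<^sup>+x. ?F1 x s \<partial>lborel \<partial>lborel)"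
        by (intro nn_integral_cong nn_integral_lborel_shift) measurable
      also have "\<dots> = (\<integral>\<^sup>+x. \<integral>\<^sup>+s. ?F1 x s \<partial>lborel \<partial>lborel)"
        by (rule lborel_pair.Fubini') measurable
      also have "\<dots> \<le> 2 * ennreal (real j * V)"
        unfolding F1 by (intro mult_left_mono IM) simp
      finally show "(\<integral>\<^sup>+x. \<integral>\<^sup>+s. ?F3 x s \<partial>lborel \<partial>lborel) \<le> 2 * ennreal (real j * V)" .
      have F4: "(\<integral>\<^sup>+x. \<integral>\<^sup>+s. ?F4 x s \<partial>lborel \<partial>lborel) = ennreal C' * (emeasure lborel (bad j) * \<kappa> n)"
        unfolding \<kappa>_def by (simp add: nn_integral_cmult nn_integral_multc mult_ac)
      also have "\<dots> \<le> ennreal C' * (ennreal \<mu> * \<kappa> n)"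
        using j by (intro mult_left_mono mult_right_mono) auto
      finally show "(\<integral>\<^sup>+x. \<integral>\<^sup>+s. ?F4 x s \<partial>lborel \<partial>lborel) \<le> ennreal C' * (ennreal \<mu> * \<kappa> n)" .
      have "(\<integral>\<^sup>+x. \<integral>\<^sup>+s. ?F5 x s \<partial>lborel \<partial>lborel) = (\<integral>\<^sup>+s. \<integral>\<^sup>+x. ?F5 x s \<partial>lborel \<partial>lborel)"
        by (rule lborel_pair.Fubini'[symmetric]) measurable
      also have "\<dots> = (\<integral>\<^sup>+s. \<integral>\<^sup>+x. ?F4 x s \<partial>lborel \<partial>lborel)"
        by (intro nn_integral_cong nn_integral_lborel_shift) measurable
      also have "\<dots> = (\<integral>\<^sup>+x. \<integral>\<^sup>+s. ?F4 x s \<partial>lborel \<partial>lborel)"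
        by (rule lborel_pair.Fubini') measurable
      also have "\<dots> \<le> ennreal C' * (ennreal \<mu> * \<kappa> n)"
        unfolding F4 using j by (intro mult_left_mono mult_right_mono) auto
      finally show "(\<integral>\<^sup>+x. \<integral>\<^sup>+s. ?F5 x s \<partial>lborel \<partial>lborel) \<le> ennreal C' * (ennreal \<mu> * \<kappa> n)" .
    qed
    also have "\<dots> = ennreal (5 * (real j * V)) + ennreal (2 * C' * \<mu>) * \<kappa> n"
    proof -
      obtain t where t: "\<kappa> n = ennreal t" "0 \<le> t" using \<kappa>_fin[of n] by (cases "\<kappa> n") auto
      have nn: "0 \<le> real j * V" "0 \<le> C'" "0 \<le> \<mu>" "0 \<le> 5 * (real j * V)" "0 \<le> 2 * C' * \<mu>"
        using V \<open>\<mu> > 0\<close> by (auto simp: C'_def)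
      show ?thesis unfolding t(1)
        by (simp only: mult_2[of "ennreal (real j * V)"] ennreal_mult[symmetric] ennreal_plus[symmetric] nn t(2)
            add_nonneg_nonneg mult_nonneg_nonneg) (simp add: algebra_simps)
    qed
    finally show ?thesis .
  qed
  \<comment> \<open>From \<beta>' t \<le> 5 c j V + \<beta>' t / 2, where 5 = 2 + 1 + 2 counts the
    weights of the three pairs. The bound does not depend on the truncation n.\<close>
  define Q where "Q = 10 * c * real j * V / \<beta>'"
  have \<kappa>_le: "\<kappa> n \<le> ennreal Q" for n
  proof -
    obtain t where t: "\<kappa> n = ennreal t" "0 \<le> t" using \<kappa>_fin[of n] by (cases "\<kappa> n") auto
    have nn: "0 \<le> real j * V" "0 < C'" "0 \<le> \<mu>" "0 \<le> c" using V \<open>\<mu> > 0\<close> \<open>c > 0\<close> by (auto simp: C'_def)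
    have "\<beta> * \<kappa> n \<le> ennreal c * (ennreal (5 * (real j * V)) + ennreal (2 * C' * \<mu>) * \<kappa> n)"
      by (rule order_trans[OF lower]) (intro mult_left_mono upper, simp)
    then have "ennreal (\<beta>' * t) \<le> ennreal (c * (5 * (real j * V) + 2 * C' * \<mu> * t))"
      unfolding t(1) \<beta>'(1) using nn t(2) \<beta>'(2)
      by (simp add: ennreal_mult[symmetric] ennreal_plus[symmetric] del: ennreal_plus)
    then have "\<beta>' * t \<le> c * (5 * (real j * V) + 2 * C' * \<mu> * t)"
      using nn t(2) by (subst (asm) ennreal_le_iff) auto
    moreover have "c * (2 * C' * \<mu> * t) = \<beta>' * t / 2"
      using nn \<open>c > 0\<close> by (simp add: \<mu>_def field_simps)
    ultimately have "\<beta>' * t \<le> 10 * c * real j * V" by (simp add: distrib_left)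
    then have "t \<le> Q" using \<beta>'(2) by (simp add: Q_def pos_le_divide_eq mult.commute)
    then show ?thesis unfolding t(1) by (rule ennreal_leI)
  qed
  have near: "(\<integral>\<^sup>+s. ennreal (if norm s \<le> 1 then k (2 *\<^sub>R s) else 0) \<partial>lborel) \<le> ennreal Q"
  proof (rule nn_integral_le_of_tendsto_AE[where g = h])
    have "AE s::'a in lborel. s \<noteq> 0" by (rule AE_lborel_singleton)
    then show "AE s in lborel. (\<lambda>n. h n s) \<longlonglongrightarrow> (if norm s \<le> 1 then k (2 *\<^sub>R s) else 0)"
    proof eventually_elim
      case (elim s)
      then obtain n0 where n0: "inverse (real (Suc n0)) < norm s"
        using reals_Archimedean[of "norm s"] by auto
      have "eventually (\<lambda>n. h n s = (if norm s \<le> 1 then k (2 *\<^sub>R s) else 0)) sequentially"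
        using eventually_ge_at_top[of n0]
      proof eventually_elim
        case (elim n)
        have "1 / real (Suc n) \<le> 1 / real (Suc n0)" using elim by (intro divide_left_mono) auto
        then show ?case using n0 by (simp add: h_def inverse_eq_divide)
      qed
      then show ?case by (rule tendsto_eventually)
    qed
    show "\<forall>\<^sub>F n in sequentially. (\<integral>\<^sup>+s. ennreal (h n s) \<partial>lborel) \<le> ennreal Q"
      using \<kappa>_le by (simp add: \<kappa>_def)
  qed measurable
  \<comment> \<open>Beyond the unit ball the first moment of k controls its mass; a dilation by 2
    then returns from k(2 s) to k(s).\<close>
  have "(\<integral>\<^sup>+s. ennreal (k (2 *\<^sub>R s)) \<partial>lborel)
     \<le> (\<integral>\<^sup>+s. ennreal (if norm s \<le> 1 then k (2 *\<^sub>R s) else 0) + ennreal (2 * (k s * norm s)) \<partial>lborel)"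
  proof (rule nn_integral_mono)
    fix s
    show "ennreal (k (2 *\<^sub>R s)) \<le> ennreal (if norm s \<le> 1 then k (2 *\<^sub>R s) else 0) + ennreal (2 * (k s * norm s))"
    proof (cases "norm s \<le> 1")
      case False
      have "k s * 1 \<le> k s * norm s" using False k_nonneg by (intro mult_left_mono) auto
      moreover have "k (2 *\<^sub>R s) \<le> 2 * k s" using False by (intro doubling) auto
      ultimately show ?thesis using False by (simp add: ennreal_leI)
    qed simp
  qed
  also have "\<dots> = (\<integral>\<^sup>+s. ennreal (if norm s \<le> 1 then k (2 *\<^sub>R s) else 0) \<partial>lborel) + (\<integral>\<^sup>+s. ennreal (2 * (k s * norm s)) \<partial>lborel)"
    by (rule nn_integral_add) measurable
  also have "(\<integral>\<^sup>+s. ennreal (2 * (k s * norm s)) \<partial>lborel) = ennreal (LINT s|lborel. 2 * (k s * norm s))"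
    using moment k_nonneg by (intro nn_integral_eq_integral integrable_mult_right) auto
  also have "(\<integral>\<^sup>+s. ennreal (if norm s \<le> 1 then k (2 *\<^sub>R s) else 0) \<partial>lborel) + \<dots> < \<infinity>"
    using near by (auto simp: top_unique less_top[symmetric])
  finally have "(\<integral>\<^sup>+s. ennreal (k (2 *\<^sub>R s)) \<partial>lborel) < \<infinity>" .
  then have "(\<integral>\<^sup>+s. ennreal (k s) \<partial>lborel) < \<infinity>"
    using nn_integral_lborel_scale[of "\<lambda>s. ennreal (k s)" 2] by (simp add: ennreal_mult_less_top)
  then show ?thesis using k_nonneg by (intro integrableI_bounded) auto
qed

section \<open>The energy space of the bounded domain\<close>

locale nonlocal_domain =
  fixes \<Omega> :: "'a::euclidean_space set" and \<delta> :: real and \<gamma> :: "real \<Rightarrow> real"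
  assumes domain: "open \<Omega>" "bounded \<Omega>" "\<Omega> \<noteq> {}"
    and horizon: "\<delta> > 0"
    and kernel_nonneg: "\<forall>r\<in>{0..1}. \<gamma> r \<ge> 0"
    and kernel_decreasing: "antimono_on {0<..1} \<gamma>"
    and kernel_support: "\<forall>r>1. \<gamma> r = 0"
    and kernel_moment: "(LINT s:ball (0::'a) 1|lborel. \<gamma> (norm s) * (norm s)\<^sup>2) = real DIM('a)"
begin

lemma \<gamma>_nonneg: "r \<ge> 0 \<Longrightarrow> 0 \<le> \<gamma> r"
  using kernel_nonneg kernel_support by (cases "r \<le> 1") auto

lemma \<gamma>_mono: "0 < r \<Longrightarrow> r \<le> r' \<Longrightarrow> \<gamma> r' \<le> \<gamma> r"
  using kernel_decreasing kernel_support \<gamma>_nonneg[of r]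
  by (cases "r' \<le> 1") (auto simp: monotone_on_def)

text \<open>Monotonicity makes the profile Borel on positive radii; the value at the origin is
  patched in.\<close>

lemma \<gamma>_norm_measurable [measurable]: "(\<lambda>s::'a. \<gamma> (norm s / \<delta>)) \<in> borel_measurable borel"
proof -
  have "mono_on {0<..} (\<lambda>r. - \<gamma> r)"
    using \<gamma>_mono by (auto simp: monotone_on_def)
  then have "(\<lambda>r. - \<gamma> r) \<in> borel_measurable (restrict_space borel {0<..})"
    by (rule borel_measurable_mono_on_fnc)
  then have "(\<lambda>r. if r \<in> {0<..} then - \<gamma> r else 0) \<in> borel_measurable borel"
    by (subst (asm) measurable_restrict_space_iff[of _ _ 0]) auto
  from measurable_compose[OF _ this, of "\<lambda>s::'a. norm s / \<delta>" borel]
  have [measurable]: "(\<lambda>s::'a. if norm s / \<delta> \<in> {0<..} then - \<gamma> (norm s / \<delta>) else 0) \<in> borel_measurable borel"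
    by measurable
  have "(\<lambda>s::'a. \<gamma> (norm s / \<delta>)) = (\<lambda>s. if s = 0 then \<gamma> 0 else - (if norm s / \<delta> \<in> {0<..} then - \<gamma> (norm s / \<delta>) else 0))"
    using horizon by (auto simp: fun_eq_iff)
  also have "\<dots> \<in> borel_measurable borel" by measurable
  finally show ?thesis .
qed

abbreviation K :: "'a \<Rightarrow> real" where "K \<equiv> diff_kernel \<gamma> \<delta>"

lemma diff_kernel_measurable [measurable]: "K \<in> borel_measurable borel"
  unfolding diff_kernel_def[abs_def] by measurable

lemma diff_kernel_nonneg: "0 \<le> K s"
  using horizon by (simp add: diff_kernel_def \<gamma>_nonneg)

lemma diff_kernel_support: "\<delta> < norm s \<Longrightarrow> K s = 0"
  using horizon kernel_support by (simp add: diff_kernel_def)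

text \<open>A divergent integral would be 0 by convention, whereas the normalization makes it d >
  0.\<close>

lemma integrable_moment_unit: "set_integrable lborel (ball (0::'a) 1) (\<lambda>s. \<gamma> (norm s) * (norm s)\<^sup>2)"
proof (rule ccontr)
  assume "\<not> set_integrable lborel (ball (0::'a) 1) (\<lambda>s. \<gamma> (norm s) * (norm s)\<^sup>2)"
  then have "(LINT s:ball (0::'a) 1|lborel. \<gamma> (norm s) * (norm s)\<^sup>2) = 0"
    unfolding set_integrable_def set_lebesgue_integral_def by (rule not_integrable_integral_eq)
  then show False using kernel_moment by simp
qed

lemma integrable_indicator_bounded:
  "A \<in> sets borel \<Longrightarrow> bounded A \<Longrightarrow> integrable lborel (\<lambda>s. c * indicator A s :: real)" for A :: "'b::euclidean_space set"
  using emeasure_bounded_finite[of A] by (intro integrable_mult_right integrable_real_indicator) auto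

lemma diff_kernel_moment: "integrable lborel (\<lambda>s. K s * (norm s)\<^sup>2)"
proof -
  let ?f = "\<lambda>s::'a. \<gamma> (norm s) * (norm s)\<^sup>2"
  \<comment> \<open>The profile may be nonzero at radius 1, which the open ball misses; the sphere
    is a null set and is added by hand.\<close>
  have "integrable lborel (\<lambda>s. indicator (ball (0::'a) 1) s *\<^sub>R ?f s + \<gamma> 1 * indicator (sphere 0 1) s)"
    using integrable_moment_unit unfolding set_integrable_def
    by (rule Bochner_Integration.integrable_add) (rule integrable_indicator_bounded, auto)
  also have "(\<lambda>s. indicator (ball (0::'a) 1) s *\<^sub>R ?f s + \<gamma> 1 * indicator (sphere 0 1) s) = ?f"
    using kernel_support by (auto simp: fun_eq_iff indicator_def)
  finally have f: "integrable lborel ?f" .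
  have [measurable]: "?f \<in> borel_measurable borel" using f by auto
  have "(\<integral>\<^sup>+s. ennreal (?f s) \<partial>lborel)
      = ennreal (\<bar>1 / \<delta>\<bar> ^ DIM('a)) * (\<integral>\<^sup>+s. ennreal (?f ((1 / \<delta>) *\<^sub>R s)) \<partial>lborel)"
    using horizon by (intro nn_integral_lborel_scale) auto
  moreover have "(\<integral>\<^sup>+s. ennreal (?f s) \<partial>lborel) < \<infinity>"
    using f by (simp add: integrable_iff_bounded \<gamma>_nonneg)
  ultimately have "(\<integral>\<^sup>+s. ennreal (?f ((1 / \<delta>) *\<^sub>R s)) \<partial>lborel) < \<infinity>"
    using horizon by (auto simp: ennreal_mult_less_top)
  then have "integrable lborel (\<lambda>s. ?f ((1 / \<delta>) *\<^sub>R s))"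
    using horizon by (intro integrableI_bounded) (auto simp: \<gamma>_nonneg)
  then have "integrable lborel (\<lambda>s. \<delta>\<^sup>2 / \<delta> ^ (DIM('a) + 2) * ?f ((1 / \<delta>) *\<^sub>R s))"
    by (rule integrable_mult_right)
  also have "(\<lambda>s. \<delta>\<^sup>2 / \<delta> ^ (DIM('a) + 2) * ?f ((1 / \<delta>) *\<^sub>R s)) = (\<lambda>s. K s * (norm s)\<^sup>2)"
    using horizon by (auto simp: fun_eq_iff diff_kernel_def power_divide)
  finally show ?thesis .
qed

text \<open>The profile is positive at some radius r, as otherwise the moment would be 0, and by
  monotonicity it is at least \<gamma>(r) at all smaller positive radii.\<close>

lemma diff_kernel_lower: "\<exists>\<rho>>0. \<exists>c>0. \<forall>s. 0 < norm s \<and> norm s < \<rho> \<longrightarrow> c \<le> K s"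
proof -
  have "\<exists>r\<in>{0<..1}. \<gamma> r \<noteq> 0"
  proof (rule ccontr)
    assume "\<not> ?thesis"
    then have "\<gamma> (norm s) * (norm s)\<^sup>2 = 0" if "s \<in> ball 0 1" for s :: 'a
      using that by (cases "s = 0") auto
    then have "(LINT s:ball (0::'a) 1|lborel. \<gamma> (norm s) * (norm s)\<^sup>2) = (LINT s:ball (0::'a) 1|lborel. 0)"
      by (intro set_lebesgue_integral_cong) auto
    then show False using kernel_moment by simp
  qed
  then obtain r where r: "0 < r" "\<gamma> r > 0" using \<gamma>_nonneg by (force simp: less_le)
  have "\<gamma> r / \<delta> ^ (DIM('a) + 2) \<le> K s" if s: "0 < norm s" "norm s < r * \<delta>" for s
  proof -
    have "\<gamma> r \<le> \<gamma> (norm s / \<delta>)"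
      using s horizon by (intro \<gamma>_mono) (auto simp: field_simps)
    then show ?thesis
      using horizon unfolding diff_kernel_def by (intro divide_right_mono) auto
  qed
  moreover have "r * \<delta> > 0" "\<gamma> r / \<delta> ^ (DIM('a) + 2) > 0" using r horizon by auto
  ultimately show ?thesis by blast
qed

sublocale nonlocal_kernel K \<Omega>
proof
  show "K (- s) = K s" for s by (simp add: diff_kernel_def)
qed (use diff_kernel_nonneg diff_kernel_moment diff_kernel_lower domain in auto)

section \<open>Passing from the extended domain to the whole space\<close>

abbreviation D :: "'a set" where "D \<equiv> extended_domain \<delta> \<Omega>"

lemma D_measurable [measurable]: "D \<in> sets borel" "interaction_domain \<delta> \<Omega> \<in> sets borel"
proof -
  have "open {x. infdist x (frontier \<Omega>) < \<delta>}"
    by (intro open_Collect_less continuous_intros)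
  then have [measurable]: "{x. infdist x (frontier \<Omega>) < \<delta>} \<in> sets borel" by auto
  have "interaction_domain \<delta> \<Omega> = {x. infdist x (frontier \<Omega>) < \<delta>} - \<Omega>"
    by (auto simp: interaction_domain_def)
  then show "interaction_domain \<delta> \<Omega> \<in> sets borel" by simp
  then show "D \<in> sets borel" by (simp add: extended_domain_def)
qed

text \<open>A segment from x outside \<Omega> to y inside meets the frontier at a point other than
  y, since \<Omega> is open. This gives a strict inequality, as the interaction domain requires,
  although |x - y| = \<delta> is allowed, where K may be nonzero.\<close>

lemma near_\<Omega>_in_D:
  assumes y: "y \<in> \<Omega>" and xy: "norm (x - y) \<le> \<delta>"
  shows "x \<in> D"
proof (cases "x \<in> \<Omega>")
  case False
  have "closed_segment x y \<inter> frontier \<Omega> \<noteq> {}"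
    by (rule connected_Int_frontier) (use y False in auto)
  then obtain z where z: "z \<in> closed_segment x y" "z \<in> frontier \<Omega>" by blast
  have "z \<notin> \<Omega>" using z(2) domain(1) by (simp add: frontier_def interior_open)
  then have "z \<noteq> y" using y by blast
  have "x \<noteq> y" using False y by blast
  have "dist x z < dist x y"
  proof (cases "z = x")
    case True
    then show ?thesis using \<open>x \<noteq> y\<close> by simp
  next
    case False
    then have "z \<in> open_segment x y" using z(1) \<open>z \<noteq> y\<close> by (simp add: open_segment_def)
    from dist_in_open_segment[OF this] show ?thesis by (simp add: dist_commute)
  qed
  then have "infdist x (frontier \<Omega>) < \<delta>"
    using infdist_le[OF z(2), of x] xy by (simp add: dist_norm)
  then show ?thesis using False by (simp add: extended_domain_def interaction_domain_def)
qed (simp add: extended_domain_def)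

lemma K_outside: "y \<in> \<Omega> \<Longrightarrow> x \<notin> D \<Longrightarrow> K (y - x) = 0 \<and> K (x - y) = 0"
  using near_\<Omega>_in_D[of y x] diff_kernel_support[of "y - x"] diff_kernel_support[of "x - y"]
  by (force simp: norm_minus_commute[of x y])

text \<open>A member of the energy space is arbitrary outside D and zero in the interaction domain
  only almost everywhere. \<open>restr\<close> gives the representative that vanishes at every point
  off \<Omega>; \<open>ext0\<close> below keeps all values on D and links the two almost
  everywhere.\<close>

definition restr :: "('a \<Rightarrow> real) \<Rightarrow> 'a \<Rightarrow> real" where
  "restr u x = (if x \<in> \<Omega> then u x else 0)"

definition ext0 :: "('a \<Rightarrow> real) \<Rightarrow> 'a \<Rightarrow> real" where
  "ext0 u x = (if x \<in> D then u x else 0)"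

definition admissible :: "('a \<Rightarrow> real) set" where
  "admissible = {u. set_borel_measurable lborel D u \<and> ae_eq_on (interaction_domain \<delta> \<Omega>) u (\<lambda>x. 0)}"

lemma ext0_measurable: "u \<in> admissible \<Longrightarrow> ext0 u \<in> borel_measurable borel"
proof -
  assume "u \<in> admissible"
  moreover have "(\<lambda>x. indicator D x *\<^sub>R u x) = ext0 u" by (auto simp: ext0_def fun_eq_iff)
  ultimately show ?thesis by (simp add: admissible_def set_borel_measurable_def)
qed

lemma restr_eq: "restr u x = indicator \<Omega> x * ext0 u x"
  by (auto simp: restr_def ext0_def indicator_def extended_domain_def)

lemma restr_measurable: "u \<in> admissible \<Longrightarrow> restr u \<in> borel_measurable borel"
  using ext0_measurable[of u] unfolding restr_eq[abs_def] by measurable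

lemma ext0_AE_restr:
  assumes "u \<in> admissible"
  shows "AE x in lborel. ext0 u x = restr u x"
proof -
  have "AE x in lborel. x \<in> interaction_domain \<delta> \<Omega> \<longrightarrow> u x = 0"
    using assms by (simp add: admissible_def ae_eq_on_def)
  then show ?thesis by eventually_elim (auto simp: ext0_def restr_def extended_domain_def)
qed

text \<open>A pair not contained in D contributes nothing on the right: either both points lie off
  \<Omega> and the differences vanish, or one lies in \<Omega>, the other outside D, and K
  vanishes.\<close>

lemma kernel_term_restr:
  assumes "ext0 u x = restr u x" "ext0 u y = restr u y" "ext0 v x = restr v x" "ext0 v y = restr v y"
  shows "(if x \<in> D \<and> y \<in> D then K (y - x) * (u y - u x) * (v y - v x) else 0)
     = K (y - x) * (restr u y - restr u x) * (restr v y - restr v x)"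
proof -
  have sub: "\<Omega> \<subseteq> D" by (auto simp: extended_domain_def)
  show ?thesis
  proof (cases "x \<in> D \<and> y \<in> D")
    case True
    then show ?thesis using assms by (simp add: ext0_def)
  next
    case False
    then consider "x \<notin> D" "y \<in> \<Omega>" | "y \<notin> D" "x \<in> \<Omega>" | "x \<notin> \<Omega>" "y \<notin> \<Omega>" using sub by blast
    then show ?thesis
    proof cases
      case 1
      then show ?thesis using K_outside[of y x] by auto
    next
      case 2
      then show ?thesis using K_outside[of x y] by auto
    next
      case 3
      then show ?thesis using False by (auto simp: restr_def)
    qed
  qed
qed

lemma energy_space_iff: "u \<in> energy_space \<gamma> \<delta> \<Omega> \<longleftrightarrow> u \<in> admissible \<and> restr u \<in> space0"
proof (cases "u \<in> admissible")
  case False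
  then show ?thesis by (auto simp: energy_space_def admissible_def)
next
  case True
  note [measurable] = restr_measurable[OF True] ext0_measurable[OF True]
  note ae = ext0_AE_restr[OF True]
  have sq: "set_integrable lborel D (\<lambda>x. (u x)\<^sup>2) \<longleftrightarrow> integrable lborel (\<lambda>x. (restr u x)\<^sup>2)"
  proof -
    have "set_integrable lborel D (\<lambda>x. (u x)\<^sup>2) \<longleftrightarrow> integrable lborel (\<lambda>x. (ext0 u x)\<^sup>2)"
      unfolding set_integrable_def by (rule arg_cong[where f = "integrable lborel"]) (auto simp: ext0_def fun_eq_iff)
    also have "\<dots> \<longleftrightarrow> integrable lborel (\<lambda>x. (restr u x)\<^sup>2)"
    proof (rule integrable_cong_AE)
      show "AE x in lborel. (ext0 u x)\<^sup>2 = (restr u x)\<^sup>2" using ae by eventually_elim simp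
    qed measurable
    finally show ?thesis .
  qed
  have "(\<integral>\<^sup>+x\<in>D. (\<integral>\<^sup>+y\<in>D. ennreal (K (y - x) * (u y - u x)\<^sup>2) \<partial>lborel) \<partial>lborel)
      = (\<integral>\<^sup>+x. \<integral>\<^sup>+y. ennreal (K (y - x) * (restr u y - restr u x)\<^sup>2) \<partial>lborel \<partial>lborel)"
  proof (rule nn_integral_cong_AE)
    show "AE x in lborel. (\<integral>\<^sup>+y\<in>D. ennreal (K (y - x) * (u y - u x)\<^sup>2) \<partial>lborel) * indicator D x
       = (\<integral>\<^sup>+y. ennreal (K (y - x) * (restr u y - restr u x)\<^sup>2) \<partial>lborel)"
      using ae
    proof eventually_elim
      case x: (elim x)
      show ?case
      proof (cases "x \<in> D")
        case True
        have "(\<integral>\<^sup>+y\<in>D. ennreal (K (y - x) * (u y - u x)\<^sup>2) \<partial>lborel) = (\<integral>\<^sup>+y. ennreal (K (y - x) * (restr u y - restr u x)\<^sup>2) \<partial>lborel)"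
        proof (rule nn_integral_cong_AE)
          show "AE y in lborel. ennreal (K (y - x) * (u y - u x)\<^sup>2) * indicator D y = ennreal (K (y - x) * (restr u y - restr u x)\<^sup>2)"
            using ae
          proof eventually_elim
            case (elim y)
            show ?case using kernel_term_restr[OF x elim x elim] True
              by (auto simp: power2_eq_square indicator_def mult.assoc split: if_splits)
          qed
        qed
        then show ?thesis using True by simp
      next
        case False
        have "(\<integral>\<^sup>+y. ennreal (K (y - x) * (restr u y - restr u x)\<^sup>2) \<partial>lborel) = (\<integral>\<^sup>+y. 0 \<partial>(lborel :: 'a measure))"
        proof (rule nn_integral_cong_AE)
          show "AE y in lborel. ennreal (K (y - x) * (restr u y - restr u x)\<^sup>2) = 0"
            using ae
          proof eventually_elim
            case (elim y)
            show ?case using kernel_term_restr[OF x elim x elim] False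
              by (auto simp: power2_eq_square mult.assoc)
          qed
        qed
        then show ?thesis using False by simp
      qed
    qed
  qed
  also have "\<dots> = (\<integral>\<^sup>+p. ennreal (K (snd p - fst p) * (restr u (snd p) - restr u (fst p))\<^sup>2) \<partial>(lborel \<Otimes>\<^sub>M lborel))"
    by (subst lborel.nn_integral_fst[symmetric]) auto
  finally have fin: "(\<integral>\<^sup>+x\<in>D. (\<integral>\<^sup>+y\<in>D. ennreal (K (y - x) * (u y - u x)\<^sup>2) \<partial>lborel) \<partial>lborel) < \<infinity>
     \<longleftrightarrow> integrable (lborel \<Otimes>\<^sub>M lborel) (\<lambda>(x, y). K (y - x) * (restr u y - restr u x)\<^sup>2)"
    by (simp add: integrable_iff_bounded case_prod_unfold abs_mult K_nonneg)
  show ?thesis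
    unfolding energy_space_def space0_def mem_Collect_eq sq fin
    using True by (auto simp: admissible_def restr_def)
qed

lemma energy_inner_eq:
  assumes u: "u \<in> energy_space \<gamma> \<delta> \<Omega>" and v: "v \<in> energy_space \<gamma> \<delta> \<Omega>"
  shows "energy_inner \<gamma> \<delta> \<Omega> u v = form0 (restr u) (restr v)"
proof -
  have adm: "u \<in> admissible" "v \<in> admissible" and sp: "restr u \<in> space0" "restr v \<in> space0"
    using u v energy_space_iff by auto
  note [measurable] = restr_measurable[OF adm(1)] ext0_measurable[OF adm(1)]
    restr_measurable[OF adm(2)] ext0_measurable[OF adm(2)]
  let ?P = "\<lambda>p. (if fst p \<in> D \<and> snd p \<in> D then K (snd p - fst p) * (ext0 u (snd p) - ext0 u (fst p)) * (ext0 v (snd p) - ext0 v (fst p)) else 0)"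
  have "energy_inner \<gamma> \<delta> \<Omega> u v = (LINT x|lborel. LINT y|lborel. ?P (x, y))"
    unfolding energy_inner_def set_lebesgue_integral_def integral_scaleR_right[symmetric]
    by (intro Bochner_Integration.integral_cong refl) (auto simp: ext0_def indicator_def)
  also have "\<dots> = (LINT x|lborel. LINT y|lborel. (case (x, y) of (x, y) \<Rightarrow> K (y - x) * (restr u y - restr u x) * (restr v y - restr v x)))"
  proof (rule double_integral_cong_AE)
    show "AE x in lborel. AE y in lborel. ?P (x, y) = (case (x, y) of (x, y) \<Rightarrow> K (y - x) * (restr u y - restr u x) * (restr v y - restr v x))"
      using ext0_AE_restr[OF adm(1)] ext0_AE_restr[OF adm(2)]
    proof eventually_elim
      case x: (elim x)
      show ?case using ext0_AE_restr[OF adm(1)] ext0_AE_restr[OF adm(2)]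
      proof eventually_elim
        case (elim y)
        show ?case
          unfolding fst_conv snd_conv prod.case kernel_term_restr[OF x(1) elim(1) x(2) elim(2), symmetric]
          by (simp add: ext0_def)
      qed
    qed
  qed measurable
  also have "\<dots> = form0 (restr u) (restr v)"
    unfolding form0_def by (rule lborel_pair.integral_fst'[OF integrable_form0[OF sp]])
  finally show ?thesis .
qed

lemma restr_add [simp]: "restr (u + v) = restr u + restr v"
  and restr_scale [simp]: "restr (c *\<^sub>R u) = c *\<^sub>R restr u"
  and restr_diff [simp]: "restr (u - v) = restr u - restr v"
  and restr_zero [simp]: "restr 0 = 0"
  by (auto simp: restr_def fun_eq_iff)

lemma subspace_admissible: "subspace admissible"
proof (rule subspaceI)
  show "0 \<in> admissible" by (simp add: admissible_def set_borel_measurable_def ae_eq_on_def)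
  fix u assume u: "u \<in> admissible"
  then show "c *\<^sub>R u \<in> admissible" for c
  proof -
    have "(\<lambda>x. c * (indicator D x *\<^sub>R u x)) \<in> borel_measurable lborel"
      using u by (intro borel_measurable_times) (auto simp: admissible_def set_borel_measurable_def)
    moreover have "(\<lambda>x. c * (indicator D x *\<^sub>R u x)) = (\<lambda>x. indicator D x *\<^sub>R (c *\<^sub>R u) x)"
      by (auto simp: fun_eq_iff)
    moreover have "AE x in lborel. x \<in> interaction_domain \<delta> \<Omega> \<longrightarrow> u x = 0"
      using u by (simp add: admissible_def ae_eq_on_def)
    then have "AE x in lborel. x \<in> interaction_domain \<delta> \<Omega> \<longrightarrow> (c *\<^sub>R u) x = 0"
      by eventually_elim simp
    ultimately show ?thesis by (simp add: admissible_def set_borel_measurable_def ae_eq_on_def)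
  qed
  fix v assume v: "v \<in> admissible"
  show "u + v \<in> admissible"
  proof -
    have "(\<lambda>x. indicator D x *\<^sub>R u x + indicator D x *\<^sub>R v x) \<in> borel_measurable lborel"
      using u v by (intro borel_measurable_add) (auto simp: admissible_def set_borel_measurable_def)
    moreover have "(\<lambda>x. indicator D x *\<^sub>R u x + indicator D x *\<^sub>R v x) = (\<lambda>x. indicator D x *\<^sub>R (u + v) x)"
      by (auto simp: fun_eq_iff distrib_left)
    moreover have "AE x in lborel. x \<in> interaction_domain \<delta> \<Omega> \<longrightarrow> u x = 0"
      "AE x in lborel. x \<in> interaction_domain \<delta> \<Omega> \<longrightarrow> v x = 0"
      using u v by (simp_all add: admissible_def ae_eq_on_def)
    then have "AE x in lborel. x \<in> interaction_domain \<delta> \<Omega> \<longrightarrow> (u + v) x = 0"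
      by eventually_elim simp
    ultimately show ?thesis by (simp add: admissible_def set_borel_measurable_def ae_eq_on_def)
  qed
qed

lemma subspace_energy_space: "subspace (energy_space \<gamma> \<delta> \<Omega>)"
  using subspace_admissible subspace_space0
  by (auto simp: subspace_def energy_space_iff)

lemma space0_subset_energy_space:
  assumes w: "w \<in> space0"
  shows "w \<in> energy_space \<gamma> \<delta> \<Omega>" "restr w = w"
proof -
  note [measurable] = space0D(1)[OF w]
  show r: "restr w = w" using space0D(2)[OF w] by (auto simp: restr_def fun_eq_iff)
  have "w \<in> admissible"
    using space0D(2)[OF w] by (auto simp: admissible_def set_borel_measurable_def ae_eq_on_def interaction_domain_def)
  then show "w \<in> energy_space \<gamma> \<delta> \<Omega>" using w r by (simp add: energy_space_iff)
qed

sublocale S: complete_semi_inner "energy_space \<gamma> \<delta> \<Omega>" "energy_inner \<gamma> \<delta> \<Omega>"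
proof
  let ?S = "energy_space \<gamma> \<delta> \<Omega>"
  show "subspace ?S" by (rule subspace_energy_space)
  then have [simp]: "u + v \<in> ?S" "c *\<^sub>R u \<in> ?S" "u - v \<in> ?S" if "u \<in> ?S" "v \<in> ?S" for u v c
    using that by (auto simp: subspace_add subspace_diff subspace_scale)
  have r: "restr u \<in> space0" if "u \<in> ?S" for u using that by (simp add: energy_space_iff)
  show "energy_inner \<gamma> \<delta> \<Omega> (u + v) w = energy_inner \<gamma> \<delta> \<Omega> u w + energy_inner \<gamma> \<delta> \<Omega> v w"
    if "u \<in> ?S" "v \<in> ?S" "w \<in> ?S" for u v w
    using that r by (simp add: energy_inner_eq E.add_left)
  show "energy_inner \<gamma> \<delta> \<Omega> (c *\<^sub>R u) w = c * energy_inner \<gamma> \<delta> \<Omega> u w" if "u \<in> ?S" "w \<in> ?S" for u w c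
    using that r by (simp add: energy_inner_eq E.scale_left)
  show "energy_inner \<gamma> \<delta> \<Omega> u v = energy_inner \<gamma> \<delta> \<Omega> v u" if "u \<in> ?S" "v \<in> ?S" for u v
    using that r by (simp add: energy_inner_eq E.sym)
  show "0 \<le> energy_inner \<gamma> \<delta> \<Omega> u u" if "u \<in> ?S" for u
    using that r by (simp add: energy_inner_eq E.nonneg)
  fix X assume X: "\<And>n. X n \<in> ?S"
    "\<And>n. energy_inner \<gamma> \<delta> \<Omega> (X (Suc n) - X n) (X (Suc n) - X n) \<le> (1/4)^n"
  have "\<exists>x\<in>space0. (\<lambda>n. form0 (restr (X n) - x) (restr (X n) - x)) \<longlonglongrightarrow> 0"
    by (rule E.rapid_complete) (use X r in \<open>auto simp: energy_inner_eq\<close>)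
  then obtain x where x: "x \<in> space0" "(\<lambda>n. form0 (restr (X n) - x) (restr (X n) - x)) \<longlonglongrightarrow> 0" by blast
  show "\<exists>x\<in>?S. (\<lambda>n. energy_inner \<gamma> \<delta> \<Omega> (X n - x) (X n - x)) \<longlonglongrightarrow> 0"
    using x(2) X(1) space0_subset_energy_space[OF x(1)]
    by (intro bexI[of _ x]) (simp_all add: energy_inner_eq)
qed

lemma energy_norm_eq: "energy_norm \<gamma> \<delta> \<Omega> u = S.nrm u"
  by (simp add: energy_norm_def S.nrm_def)

text \<open>The bridge between the nonzero elements in the almost everywhere sense and the nonzero
  seminorm of the abstract theory; it also turns uniqueness up to null vectors into equality almost
  everywhere.\<close>

lemma nrm_eq_0_iff:
  assumes u: "u \<in> energy_space \<gamma> \<delta> \<Omega>"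
  shows "S.nrm u = 0 \<longleftrightarrow> ae_eq_on D u (\<lambda>x. 0)"
proof -
  have adm: "u \<in> admissible" and sp: "restr u \<in> space0" using u by (auto simp: energy_space_iff)
  have "S.nrm u = 0 \<longleftrightarrow> form0 (restr u) (restr u) = 0"
    by (simp add: S.nrm_def energy_inner_eq[OF u u])
  also have "\<dots> \<longleftrightarrow> (AE x in lborel. restr u x = 0)"
    using form0_eq_0_imp[OF sp] form0_eq_0_if_AE[OF space0D(1)[OF sp] space0D(1)[OF sp]] by blast
  also have "\<dots> \<longleftrightarrow> (AE x in lborel. ext0 u x = 0)"
  proof
    show "AE x in lborel. ext0 u x = 0" if "AE x in lborel. restr u x = 0"
      using that ext0_AE_restr[OF adm] by eventually_elim simp
    show "AE x in lborel. restr u x = 0" if "AE x in lborel. ext0 u x = 0"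
      using that ext0_AE_restr[OF adm] by eventually_elim simp
  qed
  also have "\<dots> \<longleftrightarrow> ae_eq_on D u (\<lambda>x. 0)"
    by (simp add: ae_eq_on_def ext0_def)
  finally show ?thesis .
qed

lemma nonzero_energy_space_eq: "nonzero_energy_space \<gamma> \<delta> \<Omega> = {u \<in> energy_space \<gamma> \<delta> \<Omega>. S.nrm u \<noteq> 0}"
  unfolding nonzero_energy_space_def using nrm_eq_0_iff by blast

lemma nonzero_energy_space_nonempty: "nonzero_energy_space \<gamma> \<delta> \<Omega> \<noteq> {}"
proof -
  obtain w where "w \<in> space0" "form0 w w \<noteq> 0" using exists_form0_nonzero by blast
  then have "w \<in> nonzero_energy_space \<gamma> \<delta> \<Omega>"
    using space0_subset_energy_space[of w] unfolding nonzero_energy_space_eq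
    by (simp add: S.nrm_def energy_inner_eq)
  then show ?thesis by blast
qed

end

section \<open>Convection-diffusion\<close>

text \<open>\<open>b0\<close> is a representative of b that is bounded at every point, as the bound
  on \<theta> demands; b itself is kept because H may be defined by its exact values.
  \<open>b0_cases\<close> preserves the sign of b0(x) \<bullet> (y - x) on hemispheres.\<close>

locale nonlocal_convection = nonlocal_domain \<Omega> \<delta> \<gamma>
  for \<Omega> :: "'a::euclidean_space set" and \<delta> \<gamma> +
  fixes \<eta> :: real and H :: "'a \<Rightarrow> 'a set" and b b0 :: "'a \<Rightarrow> 'a" and C :: real
  assumes eta: "\<eta> > 0"
    and H_ball: "H x \<subseteq> ball x \<delta>"
    and H_meas: "(\<lambda>p. indicator (H (fst p)) (snd p) :: real) \<in> borel_measurable (borel \<Otimes>\<^sub>M borel)"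
    and b_meas [measurable]: "b \<in> borel_measurable borel"
    and b0_meas [measurable]: "b0 \<in> borel_measurable borel"
    and b0_bound: "norm (b0 x) \<le> C"
    and b0_cases: "b0 x = b x \<or> b0 x = 0"
    and b0_eq: "AE x in lborel. b x = b0 x"
begin

definition \<theta> :: "'a \<Rightarrow> 'a \<Rightarrow> real" where
  "\<theta> x y = indicator (H x) y * (b0 x \<bullet> sgn (y - x)) * norm (y - x) / \<eta>"

lemma conv_kernel_eq: "conv_kernel \<gamma> \<eta> \<delta> (s :: 'a) = norm s / \<eta> * K s"
  using horizon by (simp add: conv_kernel_def conv_profile_def diff_kernel_def)

lemma conv_kernel_nonneg: "0 \<le> conv_kernel \<gamma> \<eta> \<delta> (s :: 'a)"
  using eta by (simp add: conv_kernel_eq diff_kernel_nonneg)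

lemma conv_kernel_measurable [measurable]: "(conv_kernel \<gamma> \<eta> \<delta> :: 'a \<Rightarrow> real) \<in> borel_measurable borel"
  unfolding conv_kernel_eq[abs_def] by measurable

lemma \<theta>_measurable: "(\<lambda>(x, y). \<theta> x y) \<in> borel_measurable (borel \<Otimes>\<^sub>M borel)"
proof -
  note [measurable] = H_meas
  show ?thesis unfolding \<theta>_def case_prod_unfold by measurable
qed

lemma H_measurable_lborel: "(\<lambda>p. indicator (H (fst p)) (snd p) :: real) \<in> borel_measurable (lborel \<Otimes>\<^sub>M lborel)"
  using H_meas by (simp cong: measurable_cong_sets)

lemma H_borel: "H x \<in> sets borel"
proof -
  have "(\<lambda>y. indicator (H (fst (x, y))) (snd (x, y)) :: real) \<in> borel_measurable borel"
    by (rule measurable_compose[OF _ H_meas]) measurable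
  then show ?thesis by (simp add: borel_measurable_indicator_iff)
qed

lemma \<theta>_abs_le: "\<bar>\<theta> x y\<bar> \<le> C / \<eta> * norm (y - x)"
proof -
  have "\<bar>b0 x \<bullet> sgn (y - x)\<bar> \<le> norm (b0 x) * norm (sgn (y - x))" by (rule Cauchy_Schwarz_ineq2)
  also have "\<dots> \<le> norm (b0 x) * 1" by (intro mult_left_mono) (auto simp: norm_sgn)
  finally have 1: "\<bar>b0 x \<bullet> sgn (y - x)\<bar> \<le> C" using b0_bound[of x] by simp
  then have "\<bar>indicator (H x) y * (b0 x \<bullet> sgn (y - x))\<bar> \<le> C"
    using order_trans[OF abs_ge_zero 1] by (auto simp: indicator_def)
  then have "\<bar>indicator (H x) y * (b0 x \<bullet> sgn (y - x))\<bar> * (norm (y - x) / \<eta>) \<le> C * (norm (y - x) / \<eta>)"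
    using eta by (intro mult_right_mono) auto
  then show ?thesis using eta by (simp add: \<theta>_def abs_mult)
qed

text \<open>Finite energy makes almost every section in y square integrable against K, and the
  second moment supplies the factor |y - x|. Integrability is needed to move the inner product with
  the velocity into the vector integral.\<close>

lemma gradient_integrable_AE:
  assumes w: "w \<in> space0"
  shows "AE x in lborel. integrable lborel
      (\<lambda>y. indicator (H x) y *\<^sub>R ((conv_kernel \<gamma> \<eta> \<delta> (y - x) * (w y - w x)) *\<^sub>R sgn (y - x)))"
  using lborel_pair.AE_integrable_fst'[OF space0D(4)[OF w]]
proof eventually_elim
  case (elim x)
  note [measurable] = space0D(1)[OF w] H_borel[of x]
  show ?case
  proof (rule Bochner_Integration.integrable_bound)
    have "integrable lborel (\<lambda>y. K (y - x) * (norm (y - x))\<^sup>2)"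
      using integrable_lborel_shift[of "\<lambda>s. K s * (norm s)\<^sup>2" x] K_moment by simp
    then show "integrable lborel (\<lambda>y. 1 / \<eta> * (K (y - x) * (w y - w x)\<^sup>2 + K (y - x) * (norm (y - x))\<^sup>2))"
      using elim by (intro integrable_mult_right Bochner_Integration.integrable_add) auto
    show "AE y in lborel. norm (indicator (H x) y *\<^sub>R ((conv_kernel \<gamma> \<eta> \<delta> (y - x) * (w y - w x)) *\<^sub>R sgn (y - x)))
       \<le> norm (1 / \<eta> * (K (y - x) * (w y - w x)\<^sup>2 + K (y - x) * (norm (y - x))\<^sup>2))"
    proof (rule AE_I2)
      fix y
      have "norm (indicator (H x) y *\<^sub>R ((conv_kernel \<gamma> \<eta> \<delta> (y - x) * (w y - w x)) *\<^sub>R sgn (y - x)))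
         \<le> conv_kernel \<gamma> \<eta> \<delta> (y - x) * \<bar>w y - w x\<bar>"
        using conv_kernel_nonneg[of "y - x"] by (auto simp: indicator_def abs_mult norm_sgn)
      also have "\<dots> = 1 / \<eta> * (K (y - x) * \<bar>(w y - w x) * norm (y - x)\<bar>)"
        by (simp add: conv_kernel_eq abs_mult)
      also have "\<dots> \<le> 1 / \<eta> * (K (y - x) * ((w y - w x)\<^sup>2 + (norm (y - x))\<^sup>2))"
        using eta by (intro mult_left_mono abs_mult_le_sum_squares K_nonneg) auto
      also have "\<dots> \<le> norm (1 / \<eta> * (K (y - x) * (w y - w x)\<^sup>2 + K (y - x) * (norm (y - x))\<^sup>2))"
        by (simp only: distrib_left real_norm_def abs_ge_self)
      finally show "norm (indicator (H x) y *\<^sub>R ((conv_kernel \<gamma> \<eta> \<delta> (y - x) * (w y - w x)) *\<^sub>R sgn (y - x)))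
        \<le> norm (1 / \<eta> * (K (y - x) * (w y - w x)\<^sup>2 + K (y - x) * (norm (y - x))\<^sup>2))" .
    qed
  qed measurable
qed

text \<open>For x in \<Omega> the region H x lies in D, so the arbitrary values of u beyond D never
  enter.\<close>

lemma gradient_term:
  assumes u: "u \<in> energy_space \<gamma> \<delta> \<Omega>" and x: "x \<in> \<Omega>"
  shows "nonlocal_gradient \<gamma> \<eta> \<delta> H u x
     = (LINT y|lborel. indicator (H x) y *\<^sub>R ((conv_kernel \<gamma> \<eta> \<delta> (y - x) * (ext0 u y - ext0 u x)) *\<^sub>R sgn (y - x)))"
    and "nonlocal_gradient \<gamma> \<eta> \<delta> H u x
     = (LINT y|lborel. indicator (H x) y *\<^sub>R ((conv_kernel \<gamma> \<eta> \<delta> (y - x) * (restr u y - restr u x)) *\<^sub>R sgn (y - x)))"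
proof -
  have adm: "u \<in> admissible" using u by (simp add: energy_space_iff)
  note [measurable] = restr_measurable[OF adm] ext0_measurable[OF adm] H_borel[of x]
  have xD: "x \<in> D" using x by (simp add: extended_domain_def)
  have HD: "y \<in> D" if "y \<in> H x" for y
    using H_ball[of x] that near_\<Omega>_in_D[OF x, of y] by (auto simp: dist_norm norm_minus_commute)
  show 1: "nonlocal_gradient \<gamma> \<eta> \<delta> H u x
     = (LINT y|lborel. indicator (H x) y *\<^sub>R ((conv_kernel \<gamma> \<eta> \<delta> (y - x) * (ext0 u y - ext0 u x)) *\<^sub>R sgn (y - x)))"
    unfolding nonlocal_gradient_def set_lebesgue_integral_def
    by (intro Bochner_Integration.integral_cong refl) (auto simp: indicator_def ext0_def HD xD)
  have xe: "ext0 u x = restr u x" using x xD by (simp add: ext0_def restr_def)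
  show "nonlocal_gradient \<gamma> \<eta> \<delta> H u x
     = (LINT y|lborel. indicator (H x) y *\<^sub>R ((conv_kernel \<gamma> \<eta> \<delta> (y - x) * (restr u y - restr u x)) *\<^sub>R sgn (y - x)))"
    unfolding 1
  proof (rule integral_cong_AE)
    show "AE y in lborel. indicator (H x) y *\<^sub>R ((conv_kernel \<gamma> \<eta> \<delta> (y - x) * (ext0 u y - ext0 u x)) *\<^sub>R sgn (y - x))
      = indicator (H x) y *\<^sub>R ((conv_kernel \<gamma> \<eta> \<delta> (y - x) * (restr u y - restr u x)) *\<^sub>R sgn (y - x))"
      using ext0_AE_restr[OF adm] by eventually_elim (simp add: xe)
  qed measurable
qed

lemma convection_eq:
  assumes u: "u \<in> energy_space \<gamma> \<delta> \<Omega>" and v: "v \<in> energy_space \<gamma> \<delta> \<Omega>"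
  shows "(LINT x:\<Omega>|lborel. (b x \<bullet> nonlocal_gradient \<gamma> \<eta> \<delta> H u x) * v x) = conv0 \<theta> (restr u) (restr v)"
proof -
  have adm: "u \<in> admissible" "v \<in> admissible" and sp: "restr u \<in> space0" "restr v \<in> space0"
    using u v energy_space_iff by auto
  note [measurable] = restr_measurable[OF adm(1)] ext0_measurable[OF adm(1)] restr_measurable[OF adm(2)]
    H_measurable_lborel
  define P where "P x = (LINT y|lborel. indicator (H x) y *\<^sub>R ((conv_kernel \<gamma> \<eta> \<delta> (y - x) * (ext0 u y - ext0 u x)) *\<^sub>R sgn (y - x)))" for x
  have P_meas [measurable]: "P \<in> borel_measurable borel"
  proof -
    have "(\<lambda>(x, y). indicator (H x) y *\<^sub>R ((conv_kernel \<gamma> \<eta> \<delta> (y - x) * (ext0 u y - ext0 u x)) *\<^sub>R sgn (y - x))) \<in> borel_measurable (borel \<Otimes>\<^sub>M lborel)"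
      using H_measurable_lborel unfolding case_prod_unfold by measurable
    from lborel.borel_measurable_lebesgue_integral[OF this] show ?thesis unfolding P_def .
  qed
  define R where "R p = \<theta> (fst p) (snd p) * K (snd p - fst p) * (restr u (snd p) - restr u (fst p)) * restr v (fst p)" for p
  have R: "integrable (lborel \<Otimes>\<^sub>M lborel) R"
    using integrable_conv0[OF \<theta>_measurable \<theta>_abs_le sp] by (simp add: R_def[abs_def] case_prod_unfold)
  have "(LINT x:\<Omega>|lborel. (b x \<bullet> nonlocal_gradient \<gamma> \<eta> \<delta> H u x) * v x)
      = (LINT x|lborel. (b x \<bullet> P x) * restr v x)"
    unfolding set_lebesgue_integral_def
    by (intro Bochner_Integration.integral_cong refl) (auto simp: restr_def P_def gradient_term(1)[OF u] indicator_def)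
  also have "\<dots> = (LINT x|lborel. LINT y|lborel. R (x, y))"
  proof -
    have ae: "AE x in lborel. (b x \<bullet> P x) * restr v x = (LINT y|lborel. R (x, y))"
      using gradient_integrable_AE[OF sp(1)] b0_eq
    proof eventually_elim
      case (elim x)
      show ?case
      proof (cases "x \<in> \<Omega>")
        case True
        let ?h = "\<lambda>y. indicator (H x) y *\<^sub>R ((conv_kernel \<gamma> \<eta> \<delta> (y - x) * (restr u y - restr u x)) *\<^sub>R sgn (y - x))"
        have "P x = (LINT y|lborel. ?h y)"
          using gradient_term[OF u True] by (simp add: P_def)
        then have "b x \<bullet> P x = (LINT y|lborel. b0 x \<bullet> ?h y)"
          using elim integral_inner_right[of "b0 x" lborel ?h] by simp
        then have "(b x \<bullet> P x) * restr v x = (LINT y|lborel. b0 x \<bullet> ?h y * restr v x)"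
          by simp
        moreover have "b0 x \<bullet> ?h y * restr v x = R (x, y)" for y
          by (simp add: R_def \<theta>_def conv_kernel_eq mult_ac)
        ultimately show ?thesis by (simp only:)
      qed (simp add: R_def restr_def)
    qed
    have [measurable]: "R \<in> borel_measurable (lborel \<Otimes>\<^sub>M lborel)" using R by auto
    show ?thesis by (rule integral_cong_AE) (use ae in auto)
  qed
  also have "\<dots> = conv0 \<theta> (restr u) (restr v)"
    using lborel_pair.integral_fst'[OF R] by (simp add: R_def[abs_def] conv0_def case_prod_unfold)
  finally show ?thesis .
qed


lemma convdiff_eq:
  assumes "u \<in> energy_space \<gamma> \<delta> \<Omega>" "v \<in> energy_space \<gamma> \<delta> \<Omega>"
  shows "convdiff_form \<gamma> \<eta> \<delta> H b \<epsilon> \<Omega> u v = \<epsilon> * form0 (restr u) (restr v) + conv0 \<theta> (restr u) (restr v)"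
  using assms by (simp add: convdiff_form_def convection_eq energy_inner_eq)

lemma bilinear_convdiff: "S.bilinear_on (convdiff_form \<gamma> \<eta> \<delta> H b \<epsilon> \<Omega>)"
proof -
  note B = bilinear_conv0[OF \<theta>_measurable \<theta>_abs_le, unfolded E.bilinear_on_def]
  have sp: "restr u \<in> space0" if "u \<in> energy_space \<gamma> \<delta> \<Omega>" for u using that by (simp add: energy_space_iff)
  show ?thesis
    unfolding S.bilinear_on_def
    using B by (auto simp: convdiff_eq E.expand sp distrib_left)
qed

lemma convdiff_bound:
  assumes "\<epsilon> > 0"
  shows "\<exists>M. \<forall>u\<in>energy_space \<gamma> \<delta> \<Omega>. \<forall>v\<in>energy_space \<gamma> \<delta> \<Omega>.
    \<bar>convdiff_form \<gamma> \<eta> \<delta> H b \<epsilon> \<Omega> u v\<bar> \<le> M * S.nrm u * S.nrm v"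
proof -
  let ?a = "energy_inner \<gamma> \<delta> \<Omega>"
  obtain Q where Q: "\<And>w z. w \<in> space0 \<Longrightarrow> z \<in> space0 \<Longrightarrow> \<bar>conv0 \<theta> w z\<bar> \<le> Q * (form0 w w + form0 z z)"
    using conv0_bound[OF \<theta>_measurable \<theta>_abs_le] by blast
  have "\<bar>convdiff_form \<gamma> \<eta> \<delta> H b \<epsilon> \<Omega> u v\<bar> \<le> (\<epsilon> + Q) * (?a u u + ?a v v)"
    if u: "u \<in> energy_space \<gamma> \<delta> \<Omega>" and v: "v \<in> energy_space \<gamma> \<delta> \<Omega>" for u v
  proof -
    have "\<bar>?a u v\<bar> \<le> S.nrm u * S.nrm v" by (rule S.Cauchy_Schwarz[OF u v])
    also have "\<dots> \<le> (S.nrm u)\<^sup>2 + (S.nrm v)\<^sup>2"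
      using abs_mult_le_sum_squares[of "S.nrm u" "S.nrm v"] by linarith
    finally have "\<epsilon> * \<bar>?a u v\<bar> \<le> \<epsilon> * (?a u u + ?a v v)"
      using assms u v by (simp add: S.nrm_sq)
    moreover have "\<bar>conv0 \<theta> (restr u) (restr v)\<bar> \<le> Q * (?a u u + ?a v v)"
      using Q[of "restr u" "restr v"] u v by (simp add: energy_inner_eq energy_space_iff)
    moreover have "\<bar>convdiff_form \<gamma> \<eta> \<delta> H b \<epsilon> \<Omega> u v\<bar> \<le> \<epsilon> * \<bar>?a u v\<bar> + \<bar>conv0 \<theta> (restr u) (restr v)\<bar>"
      unfolding convdiff_form_def convection_eq[OF u v]
      using abs_triangle_ineq[of "\<epsilon> * ?a u v" "conv0 \<theta> (restr u) (restr v)"] assms by (simp add: abs_mult)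
    ultimately show ?thesis by (simp add: distrib_right)
  qed
  from S.bilinear_bound[OF bilinear_convdiff this] show ?thesis by blast
qed

lemma well_posed:
  assumes eps: "\<epsilon> > 0" and dual: "f \<in> opt_dual \<gamma> \<eta> \<delta> H b \<epsilon> \<Omega>"
    and positive: "\<And>w. w \<in> space0 \<Longrightarrow> 0 \<le> conv0 \<theta> w w"
  shows "\<exists>u\<in>energy_space \<gamma> \<delta> \<Omega>.
           (\<forall>v\<in>energy_space \<gamma> \<delta> \<Omega>. convdiff_form \<gamma> \<eta> \<delta> H b \<epsilon> \<Omega> u v = f v)
         \<and> (\<forall>w\<in>energy_space \<gamma> \<delta> \<Omega>.
              (\<forall>v\<in>energy_space \<gamma> \<delta> \<Omega>. convdiff_form \<gamma> \<eta> \<delta> H b \<epsilon> \<Omega> w v = f v)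
              \<longrightarrow> ae_eq_on (extended_domain \<delta> \<Omega>) w u)
         \<and> energy_norm \<gamma> \<delta> \<Omega> u = opt_dual_norm \<gamma> \<eta> \<delta> H b \<epsilon> \<Omega> f"
proof -
  let ?S = "energy_space \<gamma> \<delta> \<Omega>" and ?B = "convdiff_form \<gamma> \<eta> \<delta> H b \<epsilon> \<Omega>"
  obtain M where M: "\<And>u v. u \<in> ?S \<Longrightarrow> v \<in> ?S \<Longrightarrow> \<bar>?B u v\<bar> \<le> M * S.nrm u * S.nrm v"
    using convdiff_bound[OF eps] by blast
  obtain C where C: "\<And>v. v \<in> ?S \<Longrightarrow> \<bar>f v\<bar> \<le> C * opt_norm \<gamma> \<eta> \<delta> H b \<epsilon> \<Omega> v"
    using dual unfolding opt_dual_def by blast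
  have f_add: "\<And>u v. u \<in> ?S \<Longrightarrow> v \<in> ?S \<Longrightarrow> f (u + v) = f u + f v"
    and f_scale: "\<And>c v. v \<in> ?S \<Longrightarrow> f (c *\<^sub>R v) = c * f v"
    using dual by (auto simp: opt_dual_def plus_fun_def scaleR_fun_def)
  have coercive: "\<epsilon> * energy_inner \<gamma> \<delta> \<Omega> u u \<le> ?B u u" if "u \<in> ?S" for u
    using positive[of "restr u"] that by (simp add: convdiff_form_def convection_eq energy_space_iff)
  have opt: "opt_norm \<gamma> \<eta> \<delta> H b \<epsilon> \<Omega> v = (SUP u\<in>nonzero_energy_space \<gamma> \<delta> \<Omega>. \<bar>?B u v\<bar> / S.nrm u)" for v
    by (simp add: opt_norm_def energy_norm_eq)
  from S.optimal_test_norm[OF bilinear_convdiff M coercive eps nonzero_energy_space_eq nonzero_energy_space_nonempty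
      opt f_add f_scale C]
  obtain u where u: "u \<in> ?S" "\<And>v. v \<in> ?S \<Longrightarrow> ?B u v = f v"
    "\<And>w. w \<in> ?S \<Longrightarrow> (\<forall>v\<in>?S. ?B w v = f v) \<Longrightarrow> S.nrm (w - u) = 0"
    "S.nrm u = (SUP v\<in>nonzero_energy_space \<gamma> \<delta> \<Omega>. \<bar>f v\<bar> / opt_norm \<gamma> \<eta> \<delta> H b \<epsilon> \<Omega> v)"
    by blast
  have "ae_eq_on D w u" if "w \<in> ?S" "\<forall>v\<in>?S. ?B w v = f v" for w
    using u(3)[OF that] nrm_eq_0_iff[of "w - u"] that(1) u(1) by (simp add: ae_eq_on_def)
  then show ?thesis
    using u(1,2,4) by (auto simp: energy_norm_eq opt_dual_norm_def)
qed

text \<open>On full balls with constant velocity, \<theta> is an odd function of the displacement,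
  so the form vanishes on the diagonal.\<close>

lemma conv0_nonneg_A:
  assumes A: "assumption_A \<delta> H b0" and w: "w \<in> space0"
  shows "0 \<le> conv0 \<theta> w w"
proof -
  obtain c where c: "\<And>x. b0 x = c" and H: "\<And>x. H x = ball x \<delta>"
    using A by (auto simp: assumption_A_def)
  define g :: "'a \<Rightarrow> real" where "g s = (if norm s < \<delta> then (c \<bullet> sgn s) * norm s / \<eta> else 0)" for s
  have \<theta>_eq: "\<theta> = (\<lambda>x y. g (y - x))"
    by (auto simp: fun_eq_iff \<theta>_def g_def c H dist_norm norm_minus_commute indicator_def)
  have "conv0 (\<lambda>x y. g (y - x)) w w = 0"
  proof (rule conv0_odd[where L = "C / \<eta>"])
    show "\<bar>g s\<bar> \<le> C / \<eta> * norm s" for s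
      using \<theta>_abs_le[of 0 s] by (simp add: \<theta>_eq)
    show "g \<in> borel_measurable borel" unfolding g_def by measurable
  qed (use w in \<open>auto simp: g_def sgn_minus\<close>)
  then show ?thesis by (simp add: \<theta>_eq)
qed

text \<open>The hemispheres lie upwind, so \<theta> is nonpositive, and its antisymmetrization
  against K integrates to minus the divergence.\<close>

lemma conv0_nonneg_B:
  assumes B: "assumption_B \<gamma> \<eta> \<delta> H b" and region: "influence_region \<delta> \<eta> H"
    and w: "w \<in> space0"
  shows "0 \<le> conv0 \<theta> w w"
proof -
  have div_int: "AE x in lborel. integrable lborel (divergence_integrand \<gamma> \<eta> \<delta> H b x)"
    and div: "AE x in lborel. - nonlocal_divergence \<gamma> \<eta> \<delta> H b x \<ge> 0"
    and H: "\<And>x. H x = {y \<in> ball x \<delta>. - (b x \<bullet> (y - x)) > 0}"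
    using B by (auto simp: assumption_B_def)
  \<comment> \<open>A zero of b would make the hemisphere empty, contradicting its volume fraction
    \<eta> > 0.\<close>
  have b_nz: "b x \<noteq> 0" for x
  proof
    assume "b x = 0"
    then have "H x = {}" by (simp add: H)
    moreover have "measure lborel (H x) / measure lborel (ball x \<delta>) = \<eta>"
      using region by (simp add: influence_region_def)
    ultimately show False using eta by simp
  qed
  \<comment> \<open>The regions lie in open balls, while the convection kernel may be nonzero at |s|
    = \<delta>.\<close>
  define k :: "'a \<Rightarrow> real" where "k s = (if norm s < \<delta> then conv_kernel \<gamma> \<eta> \<delta> s else 0)" for s
  have sgn_pos: "0 < v \<bullet> sgn s \<longleftrightarrow> 0 < v \<bullet> s" "v \<bullet> sgn s < 0 \<longleftrightarrow> v \<bullet> s < 0" for v s :: 'a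
    by (cases "s = 0"; simp add: sgn_div_norm zero_less_mult_iff mult_less_0_iff)+
  \<comment> \<open>Membership of y in H x selects the negative part of b(x) in direction y - x;
    membership of x in H y selects the positive part of b(y).\<close>
  have integrand: "divergence_integrand \<gamma> \<eta> \<delta> H b x y
     = k (y - x) * (max 0 (b y \<bullet> sgn (y - x)) - max 0 (- (b x \<bullet> sgn (y - x))))" for x y
  proof -
    have "b y \<bullet> (x - y) = - (b y \<bullet> (y - x))" by (simp add: inner_diff_right)
    then have "indicator (H x) y * (b x \<bullet> sgn (y - x)) + indicator (H y) x * (b y \<bullet> sgn (y - x))
       = (if norm (y - x) < \<delta> then max 0 (b y \<bullet> sgn (y - x)) - max 0 (- (b x \<bullet> sgn (y - x))) else 0)"
      using sgn_pos[of "b x" "y - x"] sgn_pos[of "b y" "y - x"]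
      by (auto simp: H indicator_def dist_norm norm_minus_commute max_def)
    then show ?thesis
      by (simp add: divergence_integrand_def k_def inner_add_left)
  qed
  have k_int: "integrable lborel k"
  proof (rule integrable_kernel_of_divergence[where b = b and C = C
        and \<phi> = "\<lambda>r. if r < \<delta> then conv_profile \<gamma> \<eta> (r / \<delta>) / \<delta> ^ (DIM('a) + 1) else 0"])
    show "k \<in> borel_measurable borel" unfolding k_def by measurable
    show "0 \<le> k s" for s by (simp add: k_def conv_kernel_nonneg)
    show "k s = (if norm s < \<delta> then conv_profile \<gamma> \<eta> (norm s / \<delta>) / \<delta> ^ (DIM('a) + 1) else 0)" for s
      by (simp add: k_def conv_kernel_def)
    \<comment> \<open>The factor |s| doubles while the diffusion kernel does not increase along the
      ray.\<close>
    show "k (2 *\<^sub>R s) \<le> 2 * k s" if "s \<noteq> 0" for s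
    proof (cases "2 * norm s < \<delta>")
      case True
      have s: "norm s < \<delta>" using True norm_ge_zero[of s] by linarith
      have "\<gamma> (2 * norm s / \<delta>) \<le> \<gamma> (norm s / \<delta>)"
        using that horizon by (intro \<gamma>_mono) (auto simp: divide_right_mono)
      then have "K (2 *\<^sub>R s) \<le> K s"
        unfolding diff_kernel_def using horizon by (intro divide_right_mono) auto
      then have "2 * norm s / \<eta> * K (2 *\<^sub>R s) \<le> 2 * norm s / \<eta> * K s"
        using eta by (intro mult_left_mono) auto
      then show ?thesis using True s by (simp add: k_def conv_kernel_eq)
    qed (use conv_kernel_nonneg in \<open>simp add: k_def\<close>)
    show "integrable lborel (\<lambda>s. k s * norm s)"
    proof (rule Bochner_Integration.integrable_bound)
      show "integrable lborel (\<lambda>s. 1 / \<eta> * (K s * (norm s)\<^sup>2))" using K_moment by simp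
      show "AE s in lborel. norm (k s * norm s) \<le> norm (1 / \<eta> * (K s * (norm s)\<^sup>2))"
        by (rule AE_I2) (simp add: k_def conv_kernel_eq power2_eq_square abs_mult mult_ac)
      show "(\<lambda>s. k s * norm s) \<in> borel_measurable lborel" unfolding k_def by measurable
    qed
    show "AE x in lborel. norm (b x) \<le> C"
      using b0_eq by eventually_elim (simp add: b0_bound)
    show "AE x in lborel. integrable lborel (\<lambda>y. k (y - x) * (max 0 (b y \<bullet> sgn (y - x)) - max 0 (- (b x \<bullet> sgn (y - x)))))"
      using div_int by (simp add: integrand[abs_def])
  qed (use b_nz in auto)
  show ?thesis
  proof (rule conv0_nonneg_if_upwind[OF \<theta>_measurable \<theta>_abs_le _ _ _ w])
    \<comment> \<open>Restores K(s) |s| on the sphere |s| = \<delta>, where k is cut off; this is a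
      null set.\<close>
    define q where "q = \<gamma> 1 / \<delta> ^ (DIM('a) + 2) * \<delta>"
    have "integrable lborel (\<lambda>s. \<eta> * k s + q * indicator (sphere (0::'a) \<delta>) s)"
      by (intro Bochner_Integration.integrable_add integrable_mult_right k_int integrable_indicator_bounded) auto
    also have "(\<lambda>s. \<eta> * k s + q * indicator (sphere (0::'a) \<delta>) s) = (\<lambda>s. K s * norm s)"
    proof
      fix s :: 'a
      consider "norm s < \<delta>" | "norm s = \<delta>" | "norm s > \<delta>" by linarith
      then show "\<eta> * k s + q * indicator (sphere 0 \<delta>) s = K s * norm s"
        by cases (use eta horizon diff_kernel_support[of s] in
          \<open>auto simp: k_def conv_kernel_eq q_def diff_kernel_def indicator_def\<close>)
    qed
    finally show "integrable lborel (\<lambda>s. K s * norm s)" .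
    show "\<theta> x y \<le> 0" for x y
    proof (cases "y \<in> H x")
      case True
      then have "b x \<bullet> sgn (y - x) < 0" by (simp add: H sgn_pos)
      then have "b0 x \<bullet> sgn (y - x) \<le> 0" using b0_cases[of x] by auto
      then show ?thesis
        using True eta by (simp add: \<theta>_def mult_nonpos_nonneg divide_nonpos_pos)
    qed (simp add: \<theta>_def)
    have sections: "(\<lambda>y. \<theta> y x) \<in> borel_measurable borel" "\<theta> x \<in> borel_measurable borel" for x
      using measurable_compose[OF _ \<theta>_measurable, of "\<lambda>y. (y, x)" borel]
        measurable_compose[OF _ \<theta>_measurable, of "\<lambda>y. (x, y)" borel] by auto
    show "AE x in lborel. 0 \<le> (LINT y|lborel. (\<theta> y x - \<theta> x y) * K (y - x))"
      using div div_int b0_eq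
    proof eventually_elim
      case (elim x)
      note [measurable] = sections borel_measurable_integrable[OF elim(2)]
      have "(LINT y|lborel. (\<theta> y x - \<theta> x y) * K (y - x)) = (LINT y|lborel. - divergence_integrand \<gamma> \<eta> \<delta> H b x y)"
      proof (rule integral_cong_AE)
        show "AE y in lborel. (\<theta> y x - \<theta> x y) * K (y - x) = - divergence_integrand \<gamma> \<eta> \<delta> H b x y"
          using b0_eq
        proof eventually_elim
          case (elim y)
          have "sgn (x - y) = - sgn (y - x)" using sgn_minus[of "y - x"] by simp
          then show ?case
            using elim \<open>b x = b0 x\<close>
            by (simp add: \<theta>_def divergence_integrand_def conv_kernel_eq inner_add_left norm_minus_commute[of x y] algebra_simps add_divide_distrib)
        qed
      qed measurable
      also have "\<dots> = - nonlocal_divergence \<gamma> \<eta> \<delta> H b x" by (simp add: nonlocal_divergence_def)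
      finally show ?case using elim(1) by simp
    qed
  qed
qed

end

theorem theorem3p8:
  fixes \<Omega> :: "'a::euclidean_space set"
    and \<delta> \<eta> \<epsilon> :: real
    and \<gamma> :: "real \<Rightarrow> real"
    and H :: "'a \<Rightarrow> 'a set"
    and b :: "'a \<Rightarrow> 'a"
    and f :: "('a \<Rightarrow> real) \<Rightarrow> real"
  assumes domain: "open \<Omega>" "connected \<Omega>" "bounded \<Omega>" "\<Omega> \<noteq> {}"
    and horizon: "\<delta> > 0"
    and kernel_nonneg: "\<forall>r\<in>{0..1}. \<gamma> r \<ge> 0"
    and kernel_decreasing: "antimono_on {0<..1} \<gamma>"
    and kernel_support: "\<forall>r>1. \<gamma> r = 0"
    and kernel_moment: "(LINT s:ball (0::'a) 1|lborel. \<gamma> (norm s) * (norm s)\<^sup>2) = real DIM('a)"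
    and eta: "\<eta> > 0"
    and region: "influence_region \<delta> \<eta> H"
    and field: "L_infinity_field b"
    and AB: "assumption_A \<delta> H b \<or> assumption_B \<gamma> \<eta> \<delta> H b"
    and eps: "\<epsilon> > 0"
    and dual: "f \<in> opt_dual \<gamma> \<eta> \<delta> H b \<epsilon> \<Omega>"
  shows "\<exists>u\<in>energy_space \<gamma> \<delta> \<Omega>.
           (\<forall>v\<in>energy_space \<gamma> \<delta> \<Omega>. convdiff_form \<gamma> \<eta> \<delta> H b \<epsilon> \<Omega> u v = f v)
         \<and> (\<forall>w\<in>energy_space \<gamma> \<delta> \<Omega>.
              (\<forall>v\<in>energy_space \<gamma> \<delta> \<Omega>. convdiff_form \<gamma> \<eta> \<delta> H b \<epsilon> \<Omega> w v = f v)
              \<longrightarrow> ae_eq_on (extended_domain \<delta> \<Omega>) w u)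
         \<and> energy_norm \<gamma> \<delta> \<Omega> u = opt_dual_norm \<gamma> \<eta> \<delta> H b \<epsilon> \<Omega> f"
proof -
  have b_meas [measurable]: "b \<in> borel_measurable borel" using field by (simp add: L_infinity_field_def)
  obtain C where C: "AE x in lborel. norm (b x) \<le> C"
    using field by (auto simp: L_infinity_field_def)
  \<comment> \<open>Sets b to 0 on the null set where the essential bound fails.\<close>
  define b0 where "b0 x = (if norm (b x) \<le> C then b x else 0)" for x
  interpret nonlocal_domain \<Omega> \<delta> \<gamma>
    by unfold_locales (fact assms)+
  \<comment> \<open>The maximum with 0 also covers points where b0 is 0, as the sign of C is
    unknown.\<close>
  interpret nonlocal_convection \<Omega> \<delta> \<gamma> \<eta> H b b0 "max C 0"
  proof
    show "H x \<subseteq> ball x \<delta>" for x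
    proof -
      obtain A where "H x = {y \<in> ball x \<delta>. y - x \<in> A}"
        using region unfolding influence_region_def ball_sector_def by blast
      then show ?thesis by auto
    qed
    show "(\<lambda>p. indicator (H (fst p)) (snd p) :: real) \<in> borel_measurable (borel \<Otimes>\<^sub>M borel)"
      using AB
    proof
      assume "assumption_A \<delta> H b"
      then have "(\<lambda>p. indicator (H (fst p)) (snd p) :: real) = (\<lambda>p. if dist (fst p) (snd p) < \<delta> then 1 else 0)"
        by (auto simp: assumption_A_def fun_eq_iff)
      then show ?thesis by simp
    next
      assume "assumption_B \<gamma> \<eta> \<delta> H b"
      then have "(\<lambda>p. indicator (H (fst p)) (snd p) :: real)
        = (\<lambda>p. if dist (fst p) (snd p) < \<delta> \<and> - (b (fst p) \<bullet> (snd p - fst p)) > 0 then 1 else 0)"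
        by (auto simp: assumption_B_def fun_eq_iff)
      then show ?thesis by simp
    qed
    show "b0 \<in> borel_measurable borel" unfolding b0_def by measurable
    show "AE x in lborel. b x = b0 x" using C by eventually_elim (simp add: b0_def)
  qed (use eta in \<open>auto simp: b0_def\<close>)
  show ?thesis
  proof (rule well_posed[OF eps dual])
    fix w :: "'a \<Rightarrow> real" assume w: "w \<in> space0"
    show "0 \<le> conv0 \<theta> w w"
      using AB
    proof
      assume "assumption_A \<delta> H b"
      \<comment> \<open>The truncation depends on b(x) alone, so a constant field stays
        constant.\<close>
      then have "assumption_A \<delta> H b0" unfolding assumption_A_def b0_def by metis
      then show ?thesis using w by (rule conv0_nonneg_A)
    next
      assume "assumption_B \<gamma> \<eta> \<delta> H b"
      then show ?thesis using region w by (rule conv0_nonneg_B)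
    qed
  qed
qed

end
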